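(* Let $N$ be an infinitely generated free nilpotent group of nilpotency class $c\ge 2$. Let $\Delta$ be an automorphism of the group $\mathrm{Aut}(N)$ such that $\Delta(\tau)=\tau$ for every $\tau\in\mathrm{Inn}(N)$. Then $\Delta(\alpha)=\alpha$ for every $\alpha\in \mathrm{IA}_2(N)$.
   Context: A free nilpotent group of class $c$ is a group isomorphic to $F/\gamma_{c+1}(F)$, with $F$ free and $\gamma_k$ denoting the terms of the lower central series ($\gamma_1(F)=F$, $\gamma_{k+1}(F)=[\gamma_k(F),F]$); infinitely generated means $F$ has infinite rank. $\mathrm{Inn}(N)$ is the group of inner automorphisms of $N$. $\mathrm{IA}_2(N)$ is the kernel of the homomorphism $\mathrm{Aut}(N)\to\mathrm{Aut}(N/\gamma_3(N))$ determined by the natural homomorphism $N\to N/\gamma_3(N)$ (where $\gamma_3(N)=[N,N,N]$); it is trivial if $c=2$. *)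

theory Defs
  imports "HOL-Algebra.Generated_Groups" "HOL-Algebra.Bij"
begin

section \<open>Free groups\<close>

text \<open>
  The letter \<open>(False, x)\<close> stands for the generator \<open>x\<close> and \<open>(True, x)\<close> for its formal inverse.
  Elements of the free group with basis \<open>B\<close> are the reduced words over \<open>B\<close>; the product is
  concatenation followed by free reduction.
\<close>

definition flip_letter :: "bool \<times> 'b \<Rightarrow> bool \<times> 'b" where
  "flip_letter l = (\<not> fst l, snd l)"

definition reduced :: "(bool \<times> 'b) list \<Rightarrow> bool" where
  "reduced = successively (\<lambda>l m. m \<noteq> flip_letter l)"

fun cons_red :: "bool \<times> 'b \<Rightarrow> (bool \<times> 'b) list \<Rightarrow> (bool \<times> 'b) list" where
  "cons_red l [] = [l]"
| "cons_red l (m # w) = (if m = flip_letter l then w else l # m # w)"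

definition free_group :: "'b set \<Rightarrow> (bool \<times> 'b) list monoid" where
  "free_group B =
     \<lparr>carrier = {w. reduced w \<and> set w \<subseteq> UNIV \<times> B},
      mult = (\<lambda>u v. foldr cons_red u v),
      one = []\<rparr>"

lemma flip_flip [simp]: "flip_letter (flip_letter l) = l"
  by (simp add: flip_letter_def)

lemma snd_flip [simp]: "snd (flip_letter l) = snd l"
  by (simp add: flip_letter_def)

lemma flip_neq [simp]: "flip_letter l \<noteq> l" "l \<noteq> flip_letter l"
  by (auto simp: flip_letter_def prod_eq_iff)

lemma reduced_Nil [simp]: "reduced []"
  by (simp add: reduced_def)

lemma reduced_Cons:
  "reduced (l # w) \<longleftrightarrow> reduced w \<and> (w = [] \<or> hd w \<noteq> flip_letter l)"
  by (auto simp: reduced_def successively_Cons)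

lemma reduced_cons_red: "reduced w \<Longrightarrow> reduced (cons_red l w)"
  by (cases w) (auto simp: reduced_Cons)

lemma set_cons_red: "set (cons_red l w) \<subseteq> insert l (set w)"
  by (cases w) auto

lemma reduced_foldr: "reduced v \<Longrightarrow> reduced (foldr cons_red u v)"
  by (induction u) (auto simp: reduced_cons_red)

lemma set_foldr_cons_red: "set (foldr cons_red u v) \<subseteq> set u \<union> set v"
  by (induction u) (use set_cons_red in fastforce)+

lemma cons_red_flip: "reduced w \<Longrightarrow> cons_red l (cons_red (flip_letter l) w) = w"
proof (cases w)
  case (Cons m v)
  assume "reduced w"
  with Cons show ?thesis by (cases v) (auto simp: reduced_Cons)
qed simp

lemma foldr_cons_red_Nil: "reduced u \<Longrightarrow> foldr cons_red u [] = u"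
proof (induction u)
  case (Cons l u)
  then show ?case by (cases u) (auto simp: reduced_Cons)
qed simp

lemma foldr_cons_red_assoc1:
  assumes "reduced v"
  shows "foldr cons_red (cons_red l u) v = cons_red l (foldr cons_red u v)"
  using assms by (cases u) (auto simp: cons_red_flip reduced_foldr)

lemma foldr_cons_red_assoc:
  assumes "reduced w"
  shows "foldr cons_red (foldr cons_red u v) w = foldr cons_red u (foldr cons_red v w)"
  using assms by (induction u) (simp_all add: foldr_cons_red_assoc1)

lemma foldr_cons_red_inverse:
  "reduced v \<Longrightarrow> foldr cons_red (rev (map flip_letter u)) (foldr cons_red u v) = v"
proof (induction u)
  case (Cons l u)
  have "cons_red (flip_letter l) (cons_red l (foldr cons_red u v)) = foldr cons_red u v"
    using cons_red_flip[OF reduced_foldr[OF Cons.prems], of "flip_letter l"] by simp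
  with Cons show ?case by simp
qed simp

theorem group_free_group: "group (free_group B)"
proof (rule groupI)
  fix u assume "u \<in> carrier (free_group B)"
  then have u: "reduced u" "set u \<subseteq> UNIV \<times> B"
    by (auto simp: free_group_def)
  let ?v = "foldr cons_red (rev (map flip_letter u)) []"
  have "set ?v \<subseteq> UNIV \<times> B"
    using set_foldr_cons_red[of "rev (map flip_letter u)" "[]"] u(2)
    by (fastforce simp: flip_letter_def)
  moreover have "foldr cons_red ?v u = []"
    using foldr_cons_red_assoc[OF u(1), of "rev (map flip_letter u)" "[]"]
      foldr_cons_red_inverse[of "[]" u] foldr_cons_red_Nil[OF u(1)] by simp
  ultimately show "\<exists>v\<in>carrier (free_group B). v \<otimes>\<^bsub>free_group B\<^esub> u = \<one>\<^bsub>free_group B\<^esub>"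
    by (intro bexI[of _ ?v]) (auto simp: free_group_def reduced_foldr)
next
  fix u v assume "u \<in> carrier (free_group B)" "v \<in> carrier (free_group B)"
  then show "u \<otimes>\<^bsub>free_group B\<^esub> v \<in> carrier (free_group B)"
    using set_foldr_cons_red[of u v] by (auto simp: free_group_def reduced_foldr)
qed (auto simp: free_group_def foldr_cons_red_assoc)

text \<open>The universal property of the basis \<open>B\<close>.\<close>

definition word_value :: "('a, 'm) monoid_scheme \<Rightarrow> ('b \<Rightarrow> 'a) \<Rightarrow> (bool \<times> 'b) list \<Rightarrow> 'a" where
  "word_value G f w =
     foldr (\<lambda>l g. (if fst l then inv\<^bsub>G\<^esub> (f (snd l)) else f (snd l)) \<otimes>\<^bsub>G\<^esub> g) w \<one>\<^bsub>G\<^esub>"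

lemma word_value_simps [simp]:
  "word_value G f [] = \<one>\<^bsub>G\<^esub>"
  "word_value G f (l # w) =
     (if fst l then inv\<^bsub>G\<^esub> (f (snd l)) else f (snd l)) \<otimes>\<^bsub>G\<^esub> word_value G f w"
  by (simp_all add: word_value_def)

context group
begin

lemma word_value_closed:
  "f \<in> B \<rightarrow> carrier G \<Longrightarrow> set w \<subseteq> UNIV \<times> B \<Longrightarrow> word_value G f w \<in> carrier G"
  by (induction w) (auto intro!: m_closed)

lemma word_value_cons_red:
  assumes "f \<in> B \<rightarrow> carrier G" "set (l # w) \<subseteq> UNIV \<times> B"
  shows "word_value G f (cons_red l w) = word_value G f (l # w)"
proof (cases w)
  case (Cons m v)
  have cl: "f (snd l) \<in> carrier G" "word_value G f v \<in> carrier G"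
    using assms Cons by (auto intro!: word_value_closed[of f B])
  show ?thesis
    using cl Cons by (auto simp: flip_letter_def m_assoc[symmetric])
qed simp

lemma word_value_mult:
  assumes f: "f \<in> B \<rightarrow> carrier G" and "set u \<subseteq> UNIV \<times> B" and v: "set v \<subseteq> UNIV \<times> B"
  shows "word_value G f (foldr cons_red u v) = word_value G f u \<otimes> word_value G f v"
  using assms(2)
proof (induction u)
  case Nil
  show ?case using word_value_closed[OF f v] by simp
next
  case (Cons l u)
  have "set (foldr cons_red u v) \<subseteq> UNIV \<times> B"
    using set_foldr_cons_red[of u v] Cons.prems v by auto
  then have "word_value G f (foldr cons_red (l # u) v) = word_value G f (l # foldr cons_red u v)"
    using word_value_cons_red[OF f, of l "foldr cons_red u v"] Cons.prems by simp
  moreover have "f (snd l) \<in> carrier G"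
    using Cons.prems f by auto
  moreover have "word_value G f u \<in> carrier G" "word_value G f v \<in> carrier G"
    using Cons.prems v by (auto intro!: word_value_closed[OF f])
  ultimately show ?case
    using Cons by (auto simp: m_assoc)
qed

theorem free_group_universal:
  assumes "f \<in> B \<rightarrow> carrier G"
  shows "\<exists>h \<in> hom (free_group B) G. \<forall>x\<in>B. h [(False, x)] = f x"
proof (intro bexI ballI)
  show "word_value G f \<in> hom (free_group B) G"
    using assms by (auto simp: hom_def free_group_def word_value_mult word_value_closed)
  show "word_value G f [(False, x)] = f x" if "x \<in> B" for x
    using funcset_mem[OF assms that] by simp
qed

end

theorem free_group_universal_unique:
  assumes "group G" and h: "h \<in> hom (free_group B) G" and k: "k \<in> hom (free_group B) G"
    and eq: "\<And>x. x \<in> B \<Longrightarrow> h [(False, x)] = k [(False, x)]"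
    and "w \<in> carrier (free_group B)"
  shows "h w = k w"
proof -
  interpret F: group "free_group B" by (rule group_free_group)
  interpret G: group G by fact
  interpret h: group_hom "free_group B" G h
    by unfold_locales (rule h)
  interpret k: group_hom "free_group B" G k
    by unfold_locales (rule k)
  have letter: "h [l] = k [l]" if "snd l \<in> B" for l
  proof (cases l)
    case (Pair b x)
    have x: "[(False, x)] \<in> carrier (free_group B)" "[(True, x)] \<in> carrier (free_group B)"
      using that Pair by (auto simp: free_group_def reduced_def)
    have "[(True, x)] \<otimes>\<^bsub>free_group B\<^esub> [(False, x)] = \<one>\<^bsub>free_group B\<^esub>"
      by (simp add: free_group_def flip_letter_def)
    then have inv: "[(True, x)] = inv\<^bsub>free_group B\<^esub> [(False, x)]"
      using F.inv_equality x by metis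
    show ?thesis
      using eq[of x] that Pair x inv by (cases b) auto
  qed
  show ?thesis
    using assms(5)
  proof (induction w)
    case Nil
    show ?case using h.hom_one k.hom_one by (simp add: free_group_def)
  next
    case (Cons l w)
    have w: "w \<in> carrier (free_group B)" "[l] \<in> carrier (free_group B)" "snd l \<in> B"
      using Cons.prems by (auto simp: free_group_def reduced_Cons)
    have "l # w = [l] \<otimes>\<^bsub>free_group B\<^esub> w"
      using Cons.prems by (cases w) (auto simp: free_group_def reduced_Cons)
    then show ?case
      using Cons.IH w letter by (simp del: set_simps)
  qed
qed


section \<open>The lower central series and free nilpotent groups\<close>

definition commutator_subgroup :: "('a, 'm) monoid_scheme \<Rightarrow> 'a set \<Rightarrow> 'a set \<Rightarrow> 'a set" where
  "commutator_subgroup G H K =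
     generate G (\<Union>h\<in>H. \<Union>k\<in>K. {h \<otimes>\<^bsub>G\<^esub> k \<otimes>\<^bsub>G\<^esub> inv\<^bsub>G\<^esub> h \<otimes>\<^bsub>G\<^esub> inv\<^bsub>G\<^esub> k})"

text \<open>The series is indexed from 1; the value at index 0 is a dummy.\<close>

fun lower_central :: "('a, 'm) monoid_scheme \<Rightarrow> nat \<Rightarrow> 'a set" where
  "lower_central G 0 = carrier G"
| "lower_central G (Suc 0) = carrier G"
| "lower_central G (Suc (Suc k)) = commutator_subgroup G (lower_central G (Suc k)) (carrier G)"

text \<open>
  \<open>free_nilpotent_group B c N\<close>: \<open>N\<close> is a free nilpotent group of class \<open>c\<close> whose rank is the
  cardinality of \<open>B\<close>.
\<close>

definition free_nilpotent_group :: "'b set \<Rightarrow> nat \<Rightarrow> ('a, 'm) monoid_scheme \<Rightarrow> bool" where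
  "free_nilpotent_group B c N \<longleftrightarrow>
     group N \<and> N \<cong> free_group B Mod lower_central (free_group B) (c + 1)"


section \<open>Automorphisms\<close>

text \<open>As in \<^const>\<open>auto\<close>, automorphisms are extensional functions on the carrier.\<close>

definition Inn :: "('a, 'm) monoid_scheme \<Rightarrow> ('a \<Rightarrow> 'a) set" where
  "Inn G = {\<lambda>x\<in>carrier G. g \<otimes>\<^bsub>G\<^esub> x \<otimes>\<^bsub>G\<^esub> inv\<^bsub>G\<^esub> g |g. g \<in> carrier G}"

text \<open>For \<open>H\<close> normal and invariant under \<open>\<alpha>\<close>, this sends the coset \<open>H #> x\<close> to \<open>H #> \<alpha> x\<close>.\<close>

definition induced_aut ::
  "('a, 'm) monoid_scheme \<Rightarrow> 'a set \<Rightarrow> ('a \<Rightarrow> 'a) \<Rightarrow> ('a set \<Rightarrow> 'a set)" where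
  "induced_aut G H \<alpha> = (\<lambda>C\<in>carrier (G Mod H). \<alpha> ` C)"

definition IA2 :: "('a, 'm) monoid_scheme \<Rightarrow> ('a \<Rightarrow> 'a) set" where
  "IA2 G = kernel (AutoGroup G) (AutoGroup (G Mod lower_central G 3))
             (induced_aut G (lower_central G 3))"

context group
begin

lemma commutator_subgroup_closed:
  assumes "H \<subseteq> carrier G" "K \<subseteq> carrier G"
  shows "subgroup (commutator_subgroup G H K) G"
  unfolding commutator_subgroup_def using assms
  by (intro generate_is_subgroup) (auto simp: subset_iff)

lemma lower_central_subset: "lower_central G k \<subseteq> carrier G"
proof (induction k)
  case (Suc k)
  then show ?case
    by (cases k) (simp_all add: commutator_subgroup_closed[THEN subgroup.subset])
qed simp

lemma subgroup_lower_central: "subgroup (lower_central G k) G"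
  by (cases "(G, k)" rule: lower_central.cases)
    (auto simp: subgroup_self intro!: commutator_subgroup_closed lower_central_subset)

lemma auto_image_lower_central:
  assumes "\<alpha> \<in> auto G"
  shows "\<alpha> ` lower_central G k = lower_central G k"
proof -
  have \<alpha>: "\<alpha> \<in> hom G G" "\<alpha> ` carrier G = carrier G"
    using assms by (auto simp: auto_def Bij_def bij_betw_def)
  interpret \<alpha>: group_hom G G \<alpha>
    by unfold_locales (rule \<alpha>)
  have comm: "\<alpha> ` commutator_subgroup G H K = commutator_subgroup G (\<alpha> ` H) (\<alpha> ` K)"
    if "H \<subseteq> carrier G" "K \<subseteq> carrier G" for H K
  proof -
    let ?S = "\<Union>h\<in>H. \<Union>k\<in>K. {h \<otimes> k \<otimes> inv h \<otimes> inv k}"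
    have "?S \<subseteq> carrier G" using that by (auto simp: subset_iff)
    moreover have "\<alpha> (h \<otimes> k \<otimes> inv h \<otimes> inv k) = \<alpha> h \<otimes> \<alpha> k \<otimes> inv (\<alpha> h) \<otimes> inv (\<alpha> k)"
      if "h \<in> H" "k \<in> K" for h k
      using that \<open>H \<subseteq> carrier G\<close> \<open>K \<subseteq> carrier G\<close> by (simp add: subset_iff)
    then have "\<alpha> ` ?S =
        (\<Union>h\<in>\<alpha> ` H. \<Union>k\<in>\<alpha> ` K. {h \<otimes> k \<otimes> inv h \<otimes> inv k})"
      by (simp add: image_UN)
    ultimately show ?thesis
      unfolding commutator_subgroup_def using \<alpha>.generate_img[of ?S] by simp
  qed
  show ?thesis
  proof (induction k)
    case (Suc k)
    then show ?case
      by (cases k) (simp_all add: \<alpha> comm lower_central_subset)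
  qed (simp add: \<alpha>)
qed

lemma inner_in_auto:
  assumes g: "g \<in> carrier G"
  shows "(\<lambda>x\<in>carrier G. g \<otimes> x \<otimes> inv g) \<in> auto G"
proof -
  have cancel: "inv g \<otimes> (g \<otimes> z) = z" "g \<otimes> (inv g \<otimes> z) = z" if "z \<in> carrier G" for z
    using g that by (simp_all add: m_assoc[symmetric])
  have *: "g \<otimes> (inv g \<otimes> x \<otimes> g) \<otimes> inv g = x" "inv g \<otimes> (g \<otimes> x \<otimes> inv g) \<otimes> g = x"
    if "x \<in> carrier G" for x
    using g that by (simp_all add: m_assoc cancel)
  have "g \<otimes> (x \<otimes> y) \<otimes> inv g = g \<otimes> x \<otimes> inv g \<otimes> (g \<otimes> y \<otimes> inv g)"
    if "x \<in> carrier G" "y \<in> carrier G" for x y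
    using g that by (simp add: m_assoc cancel)
  moreover have "bij_betw (\<lambda>x\<in>carrier G. g \<otimes> x \<otimes> inv g) (carrier G) (carrier G)"
    by (rule bij_betw_byWitness[where f' = "\<lambda>x. inv g \<otimes> x \<otimes> g"]) (use g * in auto)
  ultimately show ?thesis
    using g by (auto simp: auto_def Bij_def hom_def)
qed

lemma normal_lower_central: "lower_central G k \<lhd> G"
proof (rule normal_invI[OF subgroup_lower_central])
  fix g h assume *: "g \<in> carrier G" "h \<in> lower_central G k"
  then have "h \<in> carrier G" using lower_central_subset by blast
  moreover have "(\<lambda>x\<in>carrier G. g \<otimes> x \<otimes> inv g) h \<in> lower_central G k"
    using auto_image_lower_central[OF inner_in_auto[OF *(1)], of k] *(2) by blast
  ultimately show "g \<otimes> h \<otimes> inv g \<in> lower_central G k" by simp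
qed

text \<open>The map whose kernel is taken in \<^const>\<open>IA2\<close> is a group homomorphism.\<close>

lemma induced_aut_coset:
  assumes "\<alpha> \<in> auto G" "x \<in> carrier G"
  shows "induced_aut G (lower_central G k) \<alpha> (lower_central G k #> x)
           = lower_central G k #> \<alpha> x"
proof -
  have "\<alpha> (h \<otimes> x) = \<alpha> h \<otimes> \<alpha> x" if "h \<in> lower_central G k" for h
    using assms that lower_central_subset[of k] by (auto simp: auto_def hom_def)
  then have "\<alpha> ` (lower_central G k #> x) = \<alpha> ` lower_central G k #> \<alpha> x"
    by (fastforce simp: r_coset_def image_UN)
  with assms show ?thesis
    by (simp add: induced_aut_def carrier_FactGroup auto_image_lower_central)
qed

theorem induced_aut_hom:
  "induced_aut G (lower_central G k)
     \<in> hom (AutoGroup G) (AutoGroup (G Mod lower_central G k))"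
proof -
  let ?H = "lower_central G k" and ?I = "induced_aut G (lower_central G k)"
  interpret H: normal ?H G by (rule normal_lower_central)
  have carr: "carrier (G Mod ?H) = (\<lambda>x. ?H #> x) ` carrier G"
    by (rule carrier_FactGroup)
  have in_carr: "\<alpha> x \<in> carrier G" if "\<alpha> \<in> auto G" "x \<in> carrier G" for \<alpha> x
    using that by (auto simp: auto_def hom_def)
  have I_auto: "?I \<alpha> \<in> auto (G Mod ?H)" if \<alpha>: "\<alpha> \<in> auto G" for \<alpha>
  proof -
    have bij: "bij_betw \<alpha> (carrier G) (carrier G)" and hom: "\<alpha> \<in> hom G G"
      using \<alpha> by (auto simp: auto_def Bij_def)
    have "?I \<alpha> ` carrier (G Mod ?H) = (\<lambda>x. ?H #> x) ` \<alpha> ` carrier G"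
      unfolding carr image_image using induced_aut_coset[OF \<alpha>] by simp
    then have surj: "?I \<alpha> ` carrier (G Mod ?H) = carrier (G Mod ?H)"
      using bij by (simp add: carr bij_betw_def)
    have sub: "C \<subseteq> carrier G" if "C \<in> carrier (G Mod ?H)" for C
      using that H.rcosets_carrier[OF group_axioms] by (auto simp: FactGroup_def)
    have "inj_on (?I \<alpha>) (carrier (G Mod ?H))"
      using bij sub by (auto simp: inj_on_def induced_aut_def bij_betw_def
          inj_on_image_eq_iff[of \<alpha> "carrier G"])
    with surj have Bij: "?I \<alpha> \<in> Bij (carrier (G Mod ?H))"
      by (auto simp: Bij_def bij_betw_def induced_aut_def)
    have "?I \<alpha> (C <#> D) = ?I \<alpha> C <#> ?I \<alpha> D"
      if CD: "C \<in> carrier (G Mod ?H)" "D \<in> carrier (G Mod ?H)" for C D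
    proof -
      obtain x y where xy: "x \<in> carrier G" "y \<in> carrier G" "C = ?H #> x" "D = ?H #> y"
        using CD by (auto simp: carr)
      have "?I \<alpha> (C <#> D) = ?H #> (\<alpha> x \<otimes> \<alpha> y)"
        using xy by (simp add: H.rcos_sum induced_aut_coset[OF \<alpha>] hom_mult[OF hom])
      also have "\<dots> = ?I \<alpha> C <#> ?I \<alpha> D"
        using xy by (simp add: H.rcos_sum induced_aut_coset[OF \<alpha>] in_carr[OF \<alpha>])
      finally show ?thesis .
    qed
    then have "?I \<alpha> \<in> hom (G Mod ?H) (G Mod ?H)"
      using Bij_imp_funcset[OF Bij] by (simp add: hom_def)
    with Bij show ?thesis by (simp add: auto_def)
  qed
  have "?I (compose (carrier G) \<alpha> \<beta>) = compose (carrier (G Mod ?H)) (?I \<alpha>) (?I \<beta>)"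
    if \<alpha>: "\<alpha> \<in> auto G" and \<beta>: "\<beta> \<in> auto G" and \<gamma>: "compose (carrier G) \<alpha> \<beta> \<in> auto G"
    for \<alpha> \<beta>
  proof (rule extensionalityI[where A = "carrier (G Mod ?H)"])
    fix C assume C: "C \<in> carrier (G Mod ?H)"
    then obtain x where "x \<in> carrier G" "C = ?H #> x"
      by (auto simp: carr)
    then show "?I (compose (carrier G) \<alpha> \<beta>) C = compose (carrier (G Mod ?H)) (?I \<alpha>) (?I \<beta>) C"
      using C induced_aut_coset[OF \<gamma>] induced_aut_coset[OF \<alpha>] induced_aut_coset[OF \<beta>]
        in_carr[OF \<beta>] by (simp add: compose_eq)
  qed (simp_all add: induced_aut_def)
  moreover have "compose (carrier G) \<alpha> \<beta> \<in> auto G" if "\<alpha> \<in> auto G" "\<beta> \<in> auto G" for \<alpha> \<beta>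
    using group.is_monoid[OF AutoGroup, THEN monoid.m_closed, of \<alpha> \<beta>] that
    by (simp add: AutoGroup_def BijGroup_def auto_def)
  ultimately show ?thesis
    using I_auto by (auto simp: hom_def AutoGroup_def BijGroup_def auto_def)
qed

end

end

theory Submission
  imports Defs HOL.Modules "HOL-Library.Function_Algebras" "HOL-Library.Multiset"
    "HOL-Library.Nat_Bijection"
begin

text \<open>
  As \<open>\<Delta>\<close> fixes the inner automorphisms, \<open>\<Delta> \<alpha>\<close> and \<open>\<alpha>\<close> differ by a homomorphism of \<open>N\<close> into its
  centre, which is \<open>\<gamma>\<^sub>c(N)\<close>. The group \<open>IA(N)\<close> of automorphisms acting trivially on the
  abelianization acts trivially on these homomorphisms, so on \<open>IA(N)\<close> the discrepancy is a
  homomorphism to an abelian group and vanishes on commutators. Infinite rank makes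
  \<open>IA\<^sub>2(N)\<close> consist of products of commutators of elements of \<open>IA(N)\<close>: descending along the
  filtration, one has to treat \<open>x\<^sub>b \<mapsto> x\<^sub>b w\<^sub>b\<close> with \<open>w\<^sub>b \<in> \<gamma>\<^sub>k\<^sub>+\<^sub>1(N)\<close> modulo \<open>\<gamma>\<^sub>k\<^sub>+\<^sub>2(N)\<close>, and after splitting
  into finitely many factors there are spare generators avoided by all \<open>w\<^sub>b\<close>. A factor
  \<open>[u, x\<^sub>v]\<close> of \<open>w\<^sub>b\<close> arises from the commutator of \<open>x\<^sub>b \<mapsto> x\<^sub>b [y, x\<^sub>v]\<close> and \<open>y \<mapsto> y u\<close> with a spare \<open>y\<close>;
  the error terms are pushed to infinity along a tree of spare generators.

  That the centre is \<open>\<gamma>\<^sub>c(N)\<close> amounts to Magnus' theorem that the lower central series of a free group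
  is induced by the powers of the augmentation ideal; it is obtained here without Hall bases, by
  Lazard elimination.
\<close>

section \<open>Commutator calculus modulo the lower central series\<close>

text \<open>Trading a bracket for one with a spare generator leaves an error of the same degree
  \<open>k + 1\<close> on the spare generators, so descending the filtration never absorbs it. But
  an automorphism may move infinitely many generators at once, which permits an Eilenberg swindle:
  one commutator replaces errors \<open>t_1, t_2, ...\<close> on the levels 1, 2, ... of the tree by
  \<open>t_2, t_3, ...\<close>, and the quotient of the two families is \<open>t_1\<close> alone, up
  to inversion. Level 0 is handled by a commutator of its own because its generators are the letters
  of the words: moving them together with higher levels would alter letters other than the first and
  destroy the shape of the errors. The bound at \<open>IA_2\<close> comes from the automorphism
  sending \<open>y\<close> to \<open>y u\<close> with \<open>u\<close> in \<gamma> k: it lies in IA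
  only if \<open>k \<ge> 2\<close>. The elements \<open>w_b\<close> may jointly involve every
  generator. Spare ones appear only after the factors of each \<open>w_b\<close> are sorted by a
  part of the basis that they avoid. In Magnus' theorem what matters is that a product of
  commutators with vanishing Lie element lies one step deeper. This concerns relations only, hence
  no basis of the free Lie ring is required.\<close>

context group
begin

lemma group_word_simps:
  "x \<in> carrier G \<Longrightarrow> y \<in> carrier G \<Longrightarrow> inv x \<otimes> (x \<otimes> y) = y"
  "x \<in> carrier G \<Longrightarrow> y \<in> carrier G \<Longrightarrow> x \<otimes> (inv x \<otimes> y) = y"
  "x \<in> carrier G \<Longrightarrow> y \<in> carrier G \<Longrightarrow> inv (x \<otimes> y) = inv y \<otimes> inv x"
  "x \<in> carrier G \<Longrightarrow> y \<in> carrier G \<Longrightarrow> z \<in> carrier G \<Longrightarrow> x \<otimes> y \<otimes> z = x \<otimes> (y \<otimes> z)"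
  by (simp_all add: m_assoc[symmetric] inv_mult_group)

abbreviation \<gamma> :: "nat \<Rightarrow> 'a set" where
  "\<gamma> n \<equiv> lower_central G n"

definition gcomm :: "'a \<Rightarrow> 'a \<Rightarrow> 'a" where
  "gcomm g h = g \<otimes> h \<otimes> inv g \<otimes> inv h"

lemma gcomm_closed [simp, intro]:
  "g \<in> carrier G \<Longrightarrow> h \<in> carrier G \<Longrightarrow> gcomm g h \<in> carrier G"
  by (simp add: gcomm_def)

lemma gcomm_one [simp]:
  "g \<in> carrier G \<Longrightarrow> gcomm g \<one> = \<one>" "g \<in> carrier G \<Longrightarrow> gcomm \<one> g = \<one>"
  by (simp_all add: gcomm_def)

lemma gcomm_self [simp]: "g \<in> carrier G \<Longrightarrow> gcomm g g = \<one>"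
  by (simp add: gcomm_def group_word_simps)

lemma inv_gcomm: "g \<in> carrier G \<Longrightarrow> h \<in> carrier G \<Longrightarrow> inv (gcomm g h) = gcomm h g"
  by (simp add: gcomm_def group_word_simps)

lemma gcomm_mult_left:
  "g \<in> carrier G \<Longrightarrow> h \<in> carrier G \<Longrightarrow> k \<in> carrier G
    \<Longrightarrow> gcomm (g \<otimes> h) k = (g \<otimes> gcomm h k \<otimes> inv g) \<otimes> gcomm g k"
  by (simp add: gcomm_def group_word_simps)

lemma gcomm_inv_left:
  "g \<in> carrier G \<Longrightarrow> k \<in> carrier G \<Longrightarrow> gcomm (inv g) k = inv g \<otimes> inv (gcomm g k) \<otimes> g"
  by (simp add: gcomm_def group_word_simps)

lemma gcomm_mult_right:
  "g \<in> carrier G \<Longrightarrow> h \<in> carrier G \<Longrightarrow> k \<in> carrier G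
    \<Longrightarrow> gcomm k (g \<otimes> h) = gcomm k g \<otimes> (g \<otimes> gcomm k h \<otimes> inv g)"
  by (simp add: gcomm_def group_word_simps)

text \<open>For the convention [g, h] = g h g^-1 h^-1 the conjugations sit on the outer entries; in
  this form the product cancels by expansion alone.\<close>

lemma Hall_Witt:
  assumes "a \<in> carrier G" "b \<in> carrier G" "d \<in> carrier G"
  shows "gcomm (gcomm a b) (b \<otimes> d \<otimes> inv b) \<otimes> gcomm (gcomm b d) (d \<otimes> a \<otimes> inv d)
    \<otimes> gcomm (gcomm d a) (a \<otimes> b \<otimes> inv a) = \<one>"
  using assms by (simp add: gcomm_def group_word_simps)

lemma lower_central_one [simp]: "\<one> \<in> \<gamma> n"
  by (rule subgroup.one_closed[OF subgroup_lower_central])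

lemma lower_central_mult: "g \<in> \<gamma> n \<Longrightarrow> h \<in> \<gamma> n \<Longrightarrow> g \<otimes> h \<in> \<gamma> n"
  by (rule subgroup.m_closed[OF subgroup_lower_central])

lemma lower_central_inv: "g \<in> \<gamma> n \<Longrightarrow> inv g \<in> \<gamma> n"
  by (rule subgroup.m_inv_closed[OF subgroup_lower_central])

lemma lower_central_closed: "g \<in> \<gamma> n \<Longrightarrow> g \<in> carrier G"
  using lower_central_subset by blast

lemma lower_central_conj:
  "g \<in> carrier G \<Longrightarrow> h \<in> \<gamma> n \<Longrightarrow> g \<otimes> h \<otimes> inv g \<in> \<gamma> n"
  by (rule normal.inv_op_closed2[OF normal_lower_central])

lemma lower_central_conj':
  "g \<in> carrier G \<Longrightarrow> h \<in> \<gamma> n \<Longrightarrow> inv g \<otimes> h \<otimes> g \<in> \<gamma> n"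
  by (rule normal.inv_op_closed1[OF normal_lower_central])

lemma gcomm_lower_central_Suc:
  assumes "n > 0" "u \<in> \<gamma> n" "g \<in> carrier G"
  shows "gcomm u g \<in> \<gamma> (Suc n)"
proof -
  obtain k where k: "n = Suc k" using assms(1) by (cases n) auto
  show ?thesis
    using assms unfolding k lower_central.simps commutator_subgroup_def gcomm_def
    by (intro generate.incl) blast
qed

lemma lower_central_least:
  assumes "n > 0" "subgroup H G"
    and "\<And>u g. u \<in> \<gamma> n \<Longrightarrow> g \<in> carrier G \<Longrightarrow> gcomm u g \<in> H"
  shows "\<gamma> (Suc n) \<subseteq> H"
proof -
  obtain k where k: "n = Suc k" using assms(1) by (cases n) auto
  show ?thesis
    using assms(3) unfolding k lower_central.simps commutator_subgroup_def gcomm_def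
    by (intro generate_subgroup_incl[OF _ assms(2)]) blast
qed

lemma lower_central_Suc_subset: "\<gamma> (Suc n) \<subseteq> \<gamma> n"
proof (cases n)
  case (Suc k)
  have "gcomm u g \<in> \<gamma> n" if "u \<in> \<gamma> n" "g \<in> carrier G" for u g
  proof -
    have "gcomm u g = u \<otimes> (g \<otimes> inv u \<otimes> inv g)"
      using that lower_central_closed by (auto simp: gcomm_def m_assoc)
    then show ?thesis
      using that lower_central_conj[OF that(2) lower_central_inv[OF that(1)]] lower_central_mult by simp
  qed
  then show ?thesis
    using Suc by (intro lower_central_least) (auto simp: subgroup_lower_central)
qed simp

lemma lower_central_antimono: "m \<le> n \<Longrightarrow> \<gamma> n \<subseteq> \<gamma> m"
  using lift_Suc_antimono_le[of "lower_central G" m n] lower_central_Suc_subset by blast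

lemma lower_centralD: "g \<in> \<gamma> n \<Longrightarrow> m \<le> n \<Longrightarrow> g \<in> \<gamma> m"
  using lower_central_antimono by blast

text \<open>The three subgroup argument: by Hall-Witt the bracket of \<open>[v, g]\<close> with
  \<open>u\<close> is expressed by two other brackets, and the induction hypothesis for
  \<open>j\<close> applies to both, once with \<open>i + 1\<close> in place of
  \<open>i\<close>.\<close>

lemma gcomm_lower_central:
  assumes "i > 0" "j > 0" "u \<in> \<gamma> i" "v \<in> \<gamma> j"
  shows "gcomm u v \<in> \<gamma> (i + j)"
  using assms(2,1,3,4)
proof (induction j arbitrary: i u v rule: nat_induct_non_zero)
  case 1
  then show ?case using gcomm_lower_central_Suc by simp
next
  case (Suc j)
  let ?L = "\<lambda>n. \<gamma> n"
  define H where "H = {h \<in> carrier G. \<forall>u\<in>?L i. gcomm h u \<in> ?L (i + Suc j)}"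
  have "subgroup H G"
  proof
    fix g h assume gh: "g \<in> H" "h \<in> H"
    have "gcomm (g \<otimes> h) u \<in> ?L (i + Suc j)" if "u \<in> ?L i" for u
    proof -
      have u: "u \<in> carrier G" using that lower_central_closed by blast
      have "g \<otimes> gcomm h u \<otimes> inv g \<in> ?L (i + Suc j)"
        using gh that by (intro lower_central_conj) (auto simp: H_def)
      then show ?thesis
        using gh that u by (simp add: gcomm_mult_left H_def lower_central_mult)
    qed
    then show "g \<otimes> h \<in> H" using gh by (auto simp: H_def)
  next
    fix g assume g: "g \<in> H"
    have "gcomm (inv g) u \<in> ?L (i + Suc j)" if "u \<in> ?L i" for u
    proof -
      have u: "u \<in> carrier G" using that lower_central_closed by blast
      have "inv g \<otimes> inv (gcomm g u) \<otimes> g \<in> ?L (i + Suc j)"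
        using g that by (intro lower_central_conj' lower_central_inv) (auto simp: H_def)
      then show ?thesis using g u by (simp add: gcomm_inv_left H_def)
    qed
    then show "inv g \<in> H" using g by (auto simp: H_def)
  qed (auto simp: H_def dest: lower_central_closed)
  moreover have "gcomm v g \<in> H" if v: "v \<in> ?L j" and g: "g \<in> carrier G" for v g
  proof -
    have vc: "v \<in> carrier G" using v lower_central_closed by blast
    have "gcomm (gcomm v g) u \<in> ?L (i + Suc j)" if u: "u \<in> ?L i" for u
    proof -
      \<comment> \<open>Hall-Witt yields a bracket with
        \<open>g \<otimes> d \<otimes> inv g\<close>, so \<open>u\<close> is conjugated back
        beforehand.\<close>
      define d where "d = inv g \<otimes> u \<otimes> g"
      have d: "d \<in> ?L i" unfolding d_def by (rule lower_central_conj'[OF g u])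
      have uc: "u \<in> carrier G" and dc: "d \<in> carrier G" using u d lower_central_closed by blast+
      have ud: "g \<otimes> d \<otimes> inv g = u" using g uc by (simp add: d_def group_word_simps)
      have 1: "gcomm (gcomm g d) (d \<otimes> v \<otimes> inv d) \<in> ?L (i + Suc j)"
      proof -
        have "gcomm g d \<in> ?L (Suc i)"
          using lower_central_inv[OF gcomm_lower_central_Suc[OF Suc.prems(1) d g]] g dc
          by (simp add: inv_gcomm)
        then show ?thesis
          using Suc.IH[of "Suc i" "gcomm g d" "d \<otimes> v \<otimes> inv d"] lower_central_conj[OF dc v] by simp
      qed
      have 2: "gcomm (gcomm d v) (v \<otimes> g \<otimes> inv v) \<in> ?L (i + Suc j)"
        using gcomm_lower_central_Suc[of "i + j" "gcomm d v" "v \<otimes> g \<otimes> inv v"]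
          Suc.IH[OF Suc.prems(1) d v] Suc.hyps g vc by simp
      let ?x = "gcomm (gcomm g d) (d \<otimes> v \<otimes> inv d)" and ?y = "gcomm (gcomm d v) (v \<otimes> g \<otimes> inv v)"
      have "gcomm (gcomm v g) u \<otimes> ?x \<otimes> ?y = \<one>"
        using Hall_Witt[OF vc g dc] ud by simp
      then have "gcomm (gcomm v g) u = inv (?x \<otimes> ?y)"
        using vc g dc uc by (intro inv_equality[symmetric]) (auto simp: m_assoc)
      then show ?thesis using 1 2 lower_central_inv lower_central_mult by simp
    qed
    then show ?thesis using vc g by (auto simp: H_def)
  qed
  ultimately have "?L (Suc j) \<subseteq> H"
    using Suc.hyps by (intro lower_central_least) auto
  then have "gcomm v u \<in> ?L (i + Suc j)" using Suc.prems by (auto simp: H_def)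
  then show ?case
    using lower_central_inv[of "gcomm v u"] Suc.prems lower_central_closed inv_gcomm by metis
qed

section \<open>Congruence modulo a term of the series, and the Lie ring laws for commutators\<close>

definition lcong :: "nat \<Rightarrow> 'a \<Rightarrow> 'a \<Rightarrow> bool" where
  "lcong n g h \<longleftrightarrow> g \<in> carrier G \<and> h \<in> carrier G \<and> inv g \<otimes> h \<in> \<gamma> n"

lemma lcong_closed: "lcong n g h \<Longrightarrow> g \<in> carrier G" "lcong n g h \<Longrightarrow> h \<in> carrier G"
  by (auto simp: lcong_def)

lemma lcong_refl [simp]: "g \<in> carrier G \<Longrightarrow> lcong n g g"
  by (simp add: lcong_def)

lemma lcong_sym: "lcong n g h \<Longrightarrow> lcong n h g"
  using lower_central_inv[of "inv g \<otimes> h" n] by (auto simp: lcong_def inv_mult_group)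

lemma lcong_trans [trans]:
  assumes "lcong n g h" "lcong n h k" shows "lcong n g k"
proof -
  have "(inv g \<otimes> h) \<otimes> (inv h \<otimes> k) \<in> \<gamma> n"
    using assms lower_central_mult by (auto simp: lcong_def)
  moreover have "(inv g \<otimes> h) \<otimes> (inv h \<otimes> k) = inv g \<otimes> k"
    using assms by (simp add: lcong_def group_word_simps)
  ultimately show ?thesis using assms by (simp add: lcong_def)
qed

lemma lcong_mono: "lcong n g h \<Longrightarrow> m \<le> n \<Longrightarrow> lcong m g h"
  by (auto simp: lcong_def intro: lower_centralD)

lemma lcong_mult:
  assumes "lcong n g g'" "lcong n h h'" shows "lcong n (g \<otimes> h) (g' \<otimes> h')"
proof -
  have "(inv h \<otimes> (inv g \<otimes> g') \<otimes> h) \<otimes> (inv h \<otimes> h') \<in> \<gamma> n"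
    using assms by (intro lower_central_mult[OF lower_central_conj']) (auto simp: lcong_def)
  moreover have "(inv h \<otimes> (inv g \<otimes> g') \<otimes> h) \<otimes> (inv h \<otimes> h') = inv (g \<otimes> h) \<otimes> (g' \<otimes> h')"
    using assms by (simp add: lcong_def group_word_simps)
  ultimately show ?thesis using assms by (simp add: lcong_def)
qed

lemma lcong_inv:
  assumes "lcong n g h" shows "lcong n (inv g) (inv h)"
proof -
  have "h \<otimes> inv (inv g \<otimes> h) \<otimes> inv h \<in> \<gamma> n"
    using assms by (intro lower_central_conj[OF _ lower_central_inv]) (auto simp: lcong_def)
  moreover have "h \<otimes> inv (inv g \<otimes> h) \<otimes> inv h = inv (inv g) \<otimes> inv h"
    using assms by (simp add: lcong_def group_word_simps)
  ultimately show ?thesis using assms by (simp add: lcong_def)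
qed

lemma lcong_one_iff: "lcong n \<one> g \<longleftrightarrow> g \<in> \<gamma> n"
  using lower_central_closed by (auto simp: lcong_def)

lemma lcong_one_iff': "lcong n g \<one> \<longleftrightarrow> g \<in> \<gamma> n"
  using lcong_one_iff lcong_sym by blast

lemma lcong_mult_right: "g \<in> carrier G \<Longrightarrow> e \<in> \<gamma> n \<Longrightarrow> lcong n g (g \<otimes> e)"
  using lower_central_closed by (auto simp: lcong_def group_word_simps)

lemma lcong_lower_central:
  "lcong n g h \<Longrightarrow> m \<le> n \<Longrightarrow> g \<in> \<gamma> m \<Longrightarrow> h \<in> \<gamma> m"
  using lcong_one_iff lcong_mono lcong_trans by metis

lemma lcong_commute:
  assumes "i > 0" "j > 0" "u \<in> \<gamma> i" "v \<in> \<gamma> j" "n \<le> i + j"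
  shows "lcong n (u \<otimes> v) (v \<otimes> u)"
proof -
  have c: "u \<in> carrier G" "v \<in> carrier G" using assms lower_central_closed by blast+
  have "lcong n (v \<otimes> u) (v \<otimes> u \<otimes> gcomm (inv u) (inv v))"
    using assms c gcomm_lower_central[OF assms(1,2) lower_central_inv lower_central_inv]
    by (intro lcong_mult_right) (auto intro: lower_centralD)
  moreover have "v \<otimes> u \<otimes> gcomm (inv u) (inv v) = u \<otimes> v"
    using c by (simp add: gcomm_def group_word_simps)
  ultimately show ?thesis using lcong_sym by simp
qed

lemma lcong_conj:
  assumes "i > 0" "u \<in> \<gamma> i" "g \<in> carrier G" "n \<le> Suc i"
  shows "lcong n (g \<otimes> u \<otimes> inv g) u"
proof -
  have c: "u \<in> carrier G" using assms lower_central_closed by blast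
  have "lcong n (g \<otimes> u \<otimes> inv g) (u \<otimes> g \<otimes> inv g)"
    using assms lcong_mult[OF lcong_commute[of 1 i g u n] lcong_refl[of "inv g"]] by simp
  then show ?thesis using c assms by (simp add: group_word_simps)
qed

text \<open>The conjugation in \<open>gcomm_mult_left\<close> is invisible one step deeper. Together
  with the next lemmas this makes commutators a bilinear bracket on the associated graded ring; the
  bound on \<open>n\<close>, instead of an equation, spares weakening the modulus
  afterwards.\<close>

lemma lcong_gcomm_mult_left:
  assumes "i > 0" "j > 0" "u \<in> \<gamma> i" "u' \<in> \<gamma> i" "v \<in> \<gamma> j"
    "n \<le> Suc (i + j)"
  shows "lcong n (gcomm (u \<otimes> u') v) (gcomm u v \<otimes> gcomm u' v)"
proof -
  have c: "u \<in> carrier G" "u' \<in> carrier G" "v \<in> carrier G" using assms lower_central_closed by blast+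
  have k: "gcomm u' v \<in> \<gamma> (i + j)" "gcomm u v \<in> \<gamma> (i + j)"
    using assms gcomm_lower_central by auto
  have "lcong n ((u \<otimes> gcomm u' v \<otimes> inv u) \<otimes> gcomm u v) (gcomm u' v \<otimes> gcomm u v)"
    using assms c k by (intro lcong_mult lcong_conj[of "i + j"]) auto
  also have "lcong n \<dots> (gcomm u v \<otimes> gcomm u' v)"
    using assms k by (intro lcong_commute[of "i + j" "i + j"]) auto
  finally show ?thesis using c by (simp add: gcomm_mult_left)
qed

lemma lcong_gcomm_mult_right:
  assumes "i > 0" "j > 0" "u \<in> \<gamma> i" "u' \<in> \<gamma> i" "v \<in> \<gamma> j"
    "n \<le> Suc (i + j)"
  shows "lcong n (gcomm v (u \<otimes> u')) (gcomm v u \<otimes> gcomm v u')"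
proof -
  have c: "u \<in> carrier G" "u' \<in> carrier G" "v \<in> carrier G" using assms lower_central_closed by blast+
  have k: "gcomm v u' \<in> \<gamma> (i + j)"
    using assms gcomm_lower_central[of j i v u'] by (simp add: add.commute)
  have "lcong n (gcomm v u \<otimes> (u \<otimes> gcomm v u' \<otimes> inv u)) (gcomm v u \<otimes> gcomm v u')"
    using assms c k by (intro lcong_mult lcong_conj[of "i + j"]) auto
  then show ?thesis using c by (simp add: gcomm_mult_right)
qed

lemma lcong_gcomm_inv_left:
  assumes "i > 0" "j > 0" "u \<in> \<gamma> i" "v \<in> \<gamma> j" "n \<le> Suc (i + j)"
  shows "lcong n (gcomm (inv u) v) (inv (gcomm u v))"
proof -
  have c: "u \<in> carrier G" "v \<in> carrier G" using assms lower_central_closed by blast+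
  have "lcong n (inv u \<otimes> inv (gcomm u v) \<otimes> inv (inv u)) (inv (gcomm u v))"
    using assms c gcomm_lower_central lower_central_inv by (intro lcong_conj[of "i + j"]) auto
  then show ?thesis using c by (simp add: gcomm_inv_left)
qed

lemma lcong_gcomm_left:
  assumes "i > 0" "j > 0" "lcong (Suc i) u u'" "v \<in> \<gamma> j" "n \<le> Suc (i + j)"
  shows "lcong n (gcomm u v) (gcomm u' v)"
proof -
  define e where "e = inv u \<otimes> u'"
  have c: "u \<in> carrier G" "v \<in> carrier G" "u' \<in> carrier G"
    using assms lower_central_closed lcong_closed by blast+
  have e: "e \<in> \<gamma> (Suc i)" "u' = u \<otimes> e" "e \<in> carrier G"
    using assms(3) c by (auto simp: e_def lcong_def group_word_simps)
  have "gcomm e v \<in> \<gamma> (Suc i + j)"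
    using assms e gcomm_lower_central by blast
  then have "u \<otimes> gcomm e v \<otimes> inv u \<in> \<gamma> n"
    using c assms by (intro lower_central_conj) (auto intro: lower_centralD)
  then have "lcong n (\<one> \<otimes> gcomm u v) ((u \<otimes> gcomm e v \<otimes> inv u) \<otimes> gcomm u v)"
    using c by (intro lcong_mult) (auto simp: lcong_one_iff)
  then show ?thesis using c e by (simp add: gcomm_mult_left)
qed

lemma lcong_gcomm_right:
  assumes "i > 0" "j > 0" "lcong (Suc i) u u'" "v \<in> \<gamma> j" "n \<le> Suc (i + j)"
  shows "lcong n (gcomm v u) (gcomm v u')"
  using lcong_inv[OF lcong_gcomm_left[OF assms]] assms
  by (metis inv_gcomm lcong_closed lower_central_closed)

text \<open>Hall-Witt after dropping the conjugations, which change an entry only by deeper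
  elements. The terms are arranged as the Leibniz rule for bracketing with \<open>w\<close>, the
  form in which it is applied.\<close>

lemma lcong_Jacobi:
  assumes "i > 0" "j > 0" "l > 0" "u \<in> \<gamma> i" "v \<in> \<gamma> j" "w \<in> \<gamma> l"
    "n \<le> Suc (i + j + l)"
  shows "lcong n (gcomm (gcomm u v) w) (gcomm (gcomm u w) v \<otimes> gcomm u (gcomm v w))"
proof -
  have c: "u \<in> carrier G" "v \<in> carrier G" "w \<in> carrier G" using assms lower_central_closed by blast+
  have *: "lcong n (gcomm (gcomm a b) (b \<otimes> d \<otimes> inv b)) (gcomm (gcomm a b) d)"
    if "a \<in> \<gamma> i'" "b \<in> \<gamma> j'" "d \<in> \<gamma> l'"
      "i' > 0" "j' > 0" "l' > 0" "i' + j' + l' = i + j + l" for a b d i' j' l'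
  proof (rule lcong_gcomm_right[of l' "i' + j'"])
    show "lcong (Suc l') (b \<otimes> d \<otimes> inv b) d"
      using that by (intro lcong_conj[of l']) (auto dest: lower_central_closed)
    show "gcomm a b \<in> \<gamma> (i' + j')" using that gcomm_lower_central by blast
  qed (use that assms in auto)
  let ?X = "gcomm (gcomm u v) w" and ?Y = "gcomm (gcomm v w) u" and ?Z = "gcomm (gcomm w u) v"
  have "lcong n (gcomm (gcomm u v) (v \<otimes> w \<otimes> inv v) \<otimes> gcomm (gcomm v w) (w \<otimes> u \<otimes> inv w)
    \<otimes> gcomm (gcomm w u) (u \<otimes> v \<otimes> inv u)) (?X \<otimes> ?Y \<otimes> ?Z)"
    using assms by (intro lcong_mult *[of _ i _ j _ l] *[of _ j _ l _ i] *[of _ l _ i _ j]) auto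
  then have 1: "lcong n \<one> (?X \<otimes> ?Y \<otimes> ?Z)" using Hall_Witt[OF c] by simp
  have "lcong n (\<one> \<otimes> (inv ?Z \<otimes> inv ?Y)) (?X \<otimes> ?Y \<otimes> ?Z \<otimes> (inv ?Z \<otimes> inv ?Y))"
    using c by (intro lcong_mult 1) auto
  then have "lcong n (inv ?Z \<otimes> inv ?Y) ?X" using c by (simp add: group_word_simps)
  moreover have "inv ?Y = gcomm u (gcomm v w)" using c by (simp add: inv_gcomm)
  moreover have "lcong n (inv ?Z) (gcomm (gcomm u w) v)"
  proof -
    have "gcomm w u \<in> \<gamma> (i + l)" using gcomm_lower_central[of l i w u] assms by (simp add: add.commute)
    then have "lcong n (gcomm (inv (gcomm w u)) v) (inv ?Z)"
      using assms by (intro lcong_gcomm_inv_left[of "i + l" j]) auto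
    then show ?thesis using c lcong_sym by (simp add: inv_gcomm)
  qed
  ultimately show ?thesis
    using c lcong_mult[of n "inv ?Z" "gcomm (gcomm u w) v" "inv ?Y" "inv ?Y"] lcong_sym lcong_trans
    by (metis gcomm_closed lcong_refl)
qed

text \<open>
  Words are stored in reverse order: \<open>lnc f [a\<^sub>m, \<dots>, a\<^sub>1]\<close> is the left-normed commutator
  \<open>[f a\<^sub>1, \<dots>, f a\<^sub>m]\<close>.
\<close>

fun lnc :: "('l \<Rightarrow> 'a) \<Rightarrow> 'l list \<Rightarrow> 'a" where
  "lnc f [] = \<one>"
| "lnc f [a] = f a"
| "lnc f (b # c # w) = gcomm (lnc f (c # w)) (f b)"

lemma lnc_Cons: "w \<noteq> [] \<Longrightarrow> lnc f (b # w) = gcomm (lnc f w) (f b)"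
  by (cases w) auto

definition signed :: "bool \<Rightarrow> 'a \<Rightarrow> 'a" where
  "signed s g = (if s then inv g else g)"

definition word_prod :: "('l \<Rightarrow> 'a) \<Rightarrow> (bool \<times> 'l list) list \<Rightarrow> 'a" where
  "word_prod f xs = foldr (\<lambda>(s, w) g. signed s (lnc f w) \<otimes> g) xs \<one>"

lemma word_prod_simps [simp]:
  "word_prod f [] = \<one>"
  "word_prod f ((s, w) # xs) = signed s (lnc f w) \<otimes> word_prod f xs"
  by (simp_all add: word_prod_def)

lemma lcong_signed: "lcong n g h \<Longrightarrow> lcong n (signed s g) (signed s h)"
  by (simp add: signed_def lcong_inv)

lemma signed_lower_central: "g \<in> \<gamma> n \<Longrightarrow> signed s g \<in> \<gamma> n"
  by (simp add: signed_def lower_central_inv)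

lemma signed_closed [simp]: "g \<in> carrier G \<Longrightarrow> signed s g \<in> carrier G"
  by (simp add: signed_def)

lemma lcong_gcomm_signed:
  assumes "i > 0" "j > 0" "u \<in> \<gamma> i" "v \<in> \<gamma> j" "n \<le> Suc (i + j)"
  shows "lcong n (gcomm (signed s u) v) (signed s (gcomm u v))"
  using lcong_gcomm_inv_left[OF assms] assms lower_central_closed by (auto simp: signed_def)

end

section \<open>Products of left-normed commutators in letters of prescribed depth\<close>

locale weighted_letters = group G for G (structure) +
  fixes f :: "'l \<Rightarrow> 'a" and wt :: "'l \<Rightarrow> nat"
  assumes letter: "\<And>l. f l \<in> \<gamma> (wt l)" and wt_pos: "\<And>l. wt l > 0"
begin

text \<open>Weight rather than length is the degree, because the letters
  \<open>[a, x, ..., x]\<close> created by elimination lie at different depths.\<close>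

abbreviation weight :: "'l list \<Rightarrow> nat" where
  "weight w \<equiv> sum_list (map wt w)"

definition homogeneous :: "nat \<Rightarrow> (bool \<times> 'l list) list \<Rightarrow> bool" where
  "homogeneous n xs \<longleftrightarrow> (\<forall>(s, w) \<in> set xs. w \<noteq> [] \<and> weight w = n)"

lemma homogeneous_simps [simp]:
  "homogeneous n []"
  "homogeneous n ((s, w) # xs) \<longleftrightarrow> w \<noteq> [] \<and> weight w = n \<and> homogeneous n xs"
  "homogeneous n (xs @ ys) \<longleftrightarrow> homogeneous n xs \<and> homogeneous n ys"
  by (auto simp: homogeneous_def)

lemma homogeneous_filter: "homogeneous n xs \<Longrightarrow> homogeneous n (filter P xs)"
  by (auto simp: homogeneous_def)

lemma letter_closed [simp]: "f l \<in> carrier G"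
  using letter lower_central_closed by blast

lemma weight_pos: "w \<noteq> [] \<Longrightarrow> weight w > 0"
  using wt_pos by (cases w) auto

lemma lnc_weight: "lnc f w \<in> \<gamma> (weight w)"
proof (induction w)
  case (Cons b w)
  show ?case
  proof (cases "w = []")
    case False
    have "gcomm (lnc f w) (f b) \<in> \<gamma> (weight w + wt b)"
      using False by (intro gcomm_lower_central weight_pos wt_pos Cons.IH letter)
    then show ?thesis using False by (simp add: lnc_Cons add.commute)
  qed (simp add: letter)
qed simp

lemma lnc_closed [simp]: "lnc f w \<in> carrier G"
  using lnc_weight lower_central_closed by blast

lemma word_prod_closed [simp]: "word_prod f xs \<in> carrier G"
  by (induction xs) auto

lemma word_prod_append: "word_prod f (xs @ ys) = word_prod f xs \<otimes> word_prod f ys"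
  by (induction xs) (auto simp: m_assoc)

lemma word_prod_lower_central:
  "homogeneous n xs \<Longrightarrow> word_prod f xs \<in> \<gamma> n"
  by (induction xs) (auto intro!: lower_central_mult signed_lower_central lnc_weight)

text \<open>Homogeneous factors of weight \<open>n\<close> commute modulo \<gamma> (n + 1), so they
  may be sorted freely.\<close>

lemma word_prod_filter:
  assumes "n > 0" "homogeneous n xs"
  shows "lcong (Suc n) (word_prod f xs) (word_prod f (filter P xs) \<otimes> word_prod f (filter (\<lambda>x. \<not> P x) xs))"
  using assms(2)
proof (induction xs)
  case (Cons x xs)
  obtain s w where x: "x = (s, w)" by (cases x)
  let ?p = "word_prod f (filter P xs)" and ?q = "word_prod f (filter (\<lambda>x. \<not> P x) xs)"
  let ?a = "signed s (lnc f w)"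
  have h: "homogeneous n xs" "weight w = n" using Cons.prems x by auto
  have a: "?a \<in> \<gamma> n" using h(2) lnc_weight signed_lower_central by blast
  have p: "?p \<in> \<gamma> n" using h homogeneous_filter word_prod_lower_central by blast
  have 1: "lcong (Suc n) (?a \<otimes> word_prod f xs) (?a \<otimes> (?p \<otimes> ?q))"
    using h by (intro lcong_mult Cons.IH) auto
  show ?case
  proof (cases "P x")
    case True
    then show ?thesis using 1 by (simp add: x m_assoc)
  next
    case False
    have "lcong (Suc n) (?a \<otimes> ?p \<otimes> ?q) (?p \<otimes> ?a \<otimes> ?q)"
      using assms(1) by (intro lcong_mult[OF lcong_commute[of n n]] a p) auto
    then have "lcong (Suc n) (?a \<otimes> (?p \<otimes> ?q)) (?p \<otimes> (?a \<otimes> ?q))" by (simp add: m_assoc)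
    then show ?thesis using lcong_trans[OF 1] False by (simp add: x)
  qed
qed simp

text \<open>Inversion reverses the factors, but their order is immaterial modulo \<gamma> (n +
  1).\<close>

lemma word_prod_signed:
  assumes "n > 0" "homogeneous n xs"
  shows "lcong (Suc n) (word_prod f (map (\<lambda>(t, w). (s \<noteq> t, w)) xs)) (signed s (word_prod f xs))"
  using assms(2)
proof (induction xs)
  case (Cons x xs)
  obtain t w where x: "x = (t, w)" by (cases x)
  have h: "homogeneous n xs" "weight w = n" using Cons.prems x by auto
  let ?p = "word_prod f xs" and ?a = "signed t (lnc f w)"
  have a: "?a \<in> \<gamma> n" using h(2) lnc_weight signed_lower_central by blast
  have p: "?p \<in> \<gamma> n" using h word_prod_lower_central by blast
  have st: "signed (s \<noteq> t) (lnc f w) = signed s ?a" by (auto simp: signed_def)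
  have 1: "lcong (Suc n) (signed s ?a \<otimes> word_prod f (map (\<lambda>(t, w). (s \<noteq> t, w)) xs)) (signed s ?a \<otimes> signed s ?p)"
    using h by (intro lcong_mult Cons.IH) auto
  have 2: "lcong (Suc n) (signed s ?a \<otimes> signed s ?p) (signed s (?a \<otimes> ?p))"
  proof -
    have "lcong (Suc n) (inv ?a \<otimes> inv ?p) (inv ?p \<otimes> inv ?a)"
      using assms(1) a p by (intro lcong_commute[of n n] lower_central_inv) auto
    then show ?thesis
      using inv_mult_group[of ?a ?p] by (auto simp: signed_def)
  qed
  show ?case using lcong_trans[OF 1 2] st by (simp add: x)
qed (simp add: signed_def)

lemma word_prod_gcomm:
  assumes "homogeneous n xs" "n > 0"
  shows "lcong (Suc (n + wt b)) (gcomm (word_prod f xs) (f b)) (word_prod f (map (\<lambda>(s, w). (s, b # w)) xs))"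
  using assms(1)
proof (induction xs)
  case (Cons x xs)
  obtain s w where x: "x = (s, w)" by (cases x)
  have h: "homogeneous n xs" "weight w = n" "w \<noteq> []" using Cons.prems x by auto
  let ?p = "word_prod f xs" and ?a = "signed s (lnc f w)"
  have l: "lnc f w \<in> \<gamma> n" using h(2) lnc_weight by blast
  have p: "?p \<in> \<gamma> n" using h word_prod_lower_central by blast
  have "lcong (Suc (n + wt b)) (gcomm (?a \<otimes> ?p) (f b)) (gcomm ?a (f b) \<otimes> gcomm ?p (f b))"
    using assms(2) l p by (intro lcong_gcomm_mult_left[of n "wt b"] wt_pos letter signed_lower_central) auto
  also have "lcong (Suc (n + wt b)) (gcomm ?a (f b) \<otimes> gcomm ?p (f b))
     (signed s (gcomm (lnc f w) (f b)) \<otimes> word_prod f (map (\<lambda>(s, w). (s, b # w)) xs))"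
    using assms(2) l h by (intro lcong_mult Cons.IH lcong_gcomm_signed[of n "wt b"] wt_pos letter) auto
  finally show ?case using h by (simp add: x lnc_Cons)
qed simp

end

section \<open>Groups with a generating family, and words spanning the graded quotients\<close>

locale generated_group = group G for G (structure) +
  fixes B :: "'x set" and x :: "'x \<Rightarrow> 'a"
  assumes gen_closed [simp]: "\<And>b. x b \<in> carrier G"
    and generating: "carrier G \<subseteq> generate G (x ` B)"

sublocale generated_group \<subseteq> weighted_letters G x "\<lambda>_. Suc 0"
  by unfold_locales auto

context generated_group
begin

lemma weight_length: "weight w = length w"
  by (simp add: sum_list_triv)

definition words :: "nat \<Rightarrow> (bool \<times> 'x list) list \<Rightarrow> bool" where
  "words m xs \<longleftrightarrow> (\<forall>(s, w) \<in> set xs. length w = m \<and> set w \<subseteq> B)"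

lemma words_simps [simp]:
  "words m []"
  "words m ((s, w) # xs) \<longleftrightarrow> length w = m \<and> set w \<subseteq> B \<and> words m xs"
  "words m (xs @ ys) \<longleftrightarrow> words m xs \<and> words m ys"
  by (simp_all add: words_def ball_Un)

lemma words_homogeneous: "words m xs \<Longrightarrow> m > 0 \<Longrightarrow> homogeneous m xs"
  by (auto simp: words_def homogeneous_def weight_length)

lemma generating_induct:
  assumes "subgroup H G" "\<And>b. b \<in> B \<Longrightarrow> x b \<in> H" "g \<in> carrier G"
  shows "g \<in> H"
  using generate_subgroup_incl[OF _ assms(1), of "x ` B"] generating assms(2,3) by blast

definition word_span :: "nat \<Rightarrow> 'a set" where
  "word_span m = {g \<in> \<gamma> m. \<exists>xs. words m xs \<and> lcong (Suc m) g (word_prod x xs)}"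

lemma word_spanI:
  "g \<in> \<gamma> m \<Longrightarrow> words m xs \<Longrightarrow> lcong (Suc m) g (word_prod x xs) \<Longrightarrow> g \<in> word_span m"
  unfolding word_span_def by blast

lemma word_spanE:
  assumes "g \<in> word_span m"
  obtains xs where "g \<in> \<gamma> m" "words m xs" "lcong (Suc m) g (word_prod x xs)"
  using assms unfolding word_span_def by blast

lemma word_span_cong:
  assumes "lcong (Suc m) g h" "h \<in> word_span m"
  shows "g \<in> word_span m"
proof -
  obtain xs where *: "h \<in> \<gamma> m" "words m xs" "lcong (Suc m) h (word_prod x xs)"
    using assms(2) by (rule word_spanE)
  show ?thesis
    using lcong_lower_central[OF lcong_sym[OF assms(1)] _ *(1)] *(2) lcong_trans[OF assms(1) *(3)]
    by (intro word_spanI) auto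
qed

lemma subgroup_word_span:
  assumes m: "m > 0"
  shows "subgroup (word_span m) G"
proof
  show "word_span m \<subseteq> carrier G"
    using lower_central_closed by (auto simp: word_span_def)
  show "\<one> \<in> word_span m"
    by (rule word_spanI[of _ _ "[]"]) simp_all
next
  fix g h assume "g \<in> word_span m" "h \<in> word_span m"
  then obtain xs ys where *: "words m xs" "lcong (Suc m) g (word_prod x xs)" "words m ys"
    "lcong (Suc m) h (word_prod x ys)" "g \<in> \<gamma> m" "h \<in> \<gamma> m"
    by (metis word_spanE)
  then show "g \<otimes> h \<in> word_span m"
    by (intro word_spanI[of _ _ "xs @ ys"] lower_central_mult)
      (simp_all add: word_prod_append lcong_mult)
next
  fix g assume "g \<in> word_span m"
  then obtain xs where *: "words m xs" "lcong (Suc m) g (word_prod x xs)" "g \<in> \<gamma> m"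
    by (metis word_spanE)
  let ?ys = "map (\<lambda>(t, w). (True \<noteq> t, w)) xs"
  have "lcong (Suc m) (word_prod x ?ys) (inv (word_prod x xs))"
    using word_prod_signed[OF m words_homogeneous[OF *(1) m], of True] by (simp add: signed_def)
  then have "lcong (Suc m) (inv g) (word_prod x ?ys)"
    using lcong_trans[OF lcong_inv[OF *(2)] lcong_sym] by blast
  moreover have "words m ?ys" using *(1) by (auto simp: words_def)
  ultimately show "inv g \<in> word_span m"
    using lower_central_inv[OF *(3)] by (intro word_spanI)
qed

text \<open>Modulo \<gamma> (m + 2) the bracket \<open>[u, g]\<close> is multiplicative in
  \<open>g\<close>, so the admissible \<open>g\<close> form a subgroup and only the generators
  \<open>x b\<close> matter; for these, \<open>b\<close> is prepended to the words of
  \<open>u\<close>.\<close>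

lemma lower_central_word_span: "m > 0 \<Longrightarrow> \<gamma> m \<subseteq> word_span m"
proof (induction m rule: nat_induct_non_zero)
  case 1
  have "x b \<in> word_span 1" if "b \<in> B" for b
    using that by (intro word_spanI[of _ _ "[(False, [b])]"]) (simp_all add: signed_def)
  then show ?case
    using generating_induct[OF subgroup_word_span[of 1]] by auto
next
  case (Suc m)
  let ?H = "word_span (Suc m)"
  have H: "subgroup ?H G" by (rule subgroup_word_span) simp
  have "gcomm u g \<in> ?H" if u: "u \<in> \<gamma> m" and g: "g \<in> carrier G" for u g
  proof -
    have uc: "u \<in> carrier G" using u lower_central_closed by blast
    let ?K = "{g \<in> carrier G. gcomm u g \<in> ?H}"
    have "subgroup ?K G"
    proof
      fix g h assume gh: "g \<in> ?K" "h \<in> ?K"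
      have "lcong (Suc (Suc m)) (gcomm u (g \<otimes> h)) (gcomm u g \<otimes> gcomm u h)"
        using u gh Suc.hyps by (intro lcong_gcomm_mult_right[of 1 m]) auto
      then show "g \<otimes> h \<in> ?K" using word_span_cong subgroup.m_closed[OF H] gh by blast
    next
      fix g assume g: "g \<in> ?K"
      have "lcong (Suc (Suc m)) (inv (gcomm (inv g) u)) (inv (inv (gcomm g u)))"
        using u g Suc.hyps by (intro lcong_inv lcong_gcomm_inv_left[of 1 m]) auto
      then have "lcong (Suc (Suc m)) (gcomm u (inv g)) (inv (gcomm u g))"
        using uc g by (simp add: inv_gcomm)
      then show "inv g \<in> ?K" using word_span_cong subgroup.m_inv_closed[OF H] g by blast
    next
      show "\<one> \<in> ?K" using uc subgroup.one_closed[OF H] by simp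
    qed auto
    moreover have "x b \<in> ?K" if "b \<in> B" for b
    proof -
      obtain xs where xs: "words m xs" "lcong (Suc m) u (word_prod x xs)"
        using Suc.IH u by (metis subsetD word_spanE)
      have "lcong (Suc (Suc m)) (gcomm u (x b)) (gcomm (word_prod x xs) (x b))"
        using xs Suc.hyps by (intro lcong_gcomm_left[of m 1]) auto
      also have "lcong (Suc (Suc m)) (gcomm (word_prod x xs) (x b)) (word_prod x (map (\<lambda>(s, w). (s, b # w)) xs))"
        using word_prod_gcomm[OF words_homogeneous[OF xs(1) Suc.hyps] Suc.hyps, of b] by simp
      finally have "lcong (Suc (Suc m)) (gcomm u (x b)) (word_prod x (map (\<lambda>(s, w). (s, b # w)) xs))" .
      moreover have "words (Suc m) (map (\<lambda>(s, w). (s, b # w)) xs)"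
        using xs(1) that by (fastforce simp: words_def)
      ultimately show ?thesis
        using word_spanI[OF gcomm_lower_central_Suc[OF Suc.hyps u, of "x b"]] uc by simp
    qed
    ultimately have "g \<in> ?K" using g by (rule generating_induct)
    then show ?thesis by simp
  qed
  then show ?case
    using Suc.hyps H by (intro lower_central_least) auto
qed

lemma lower_central_words:
  assumes "m > 0" "g \<in> \<gamma> m"
  obtains xs where "words m xs" "lcong (Suc m) g (word_prod x xs)"
  using assms lower_central_word_span by (meson subsetD word_spanE)

end

section \<open>Relations between left-normed commutators\<close>

text \<open>
  The functional \<open>g\<close> on the free associative ring, evaluated at the Lie element obtained by expanding
  the left-normed commutator of the letters of \<open>w\<close> (up to the sign of the opposite ring).
\<close>

fun word_pairing :: "'l list \<Rightarrow> ('l list \<Rightarrow> int) \<Rightarrow> int" where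
  "word_pairing [] g = 0"
| "word_pairing [a] g = g [a]"
| "word_pairing (b # c # w) g = word_pairing (c # w) (\<lambda>u. g (b # u) - g (u @ [b]))"

text \<open>The left-normed commutator of the operators \<open>P a\<close> in the ring of additive
  maps.\<close>

fun word_op :: "('l \<Rightarrow> 'f \<Rightarrow> 'f) \<Rightarrow> 'l list \<Rightarrow> 'f \<Rightarrow> 'f::ab_group_add" where
  "word_op P [] h = 0"
| "word_op P [a] h = P a h"
| "word_op P (b # c # w) h = word_op P (c # w) (P b h) - P b (word_op P (c # w) h)"

lemma word_pairing_diff:
  "word_pairing w (\<lambda>u. g u - h u) = word_pairing w g - word_pairing w h"
proof (induction w arbitrary: g h rule: induct_list012)
  case (3 b c w)
  have "word_pairing (b # c # w) (\<lambda>u. g u - h u) =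
    word_pairing (c # w) (\<lambda>u. (g (b # u) - g (u @ [b])) - (h (b # u) - h (u @ [b])))"
    by (simp add: algebra_simps)
  then show ?case using 3 by simp
qed auto

text \<open>\<open>fold P\<close> lets the first letter act first, so words act as products in the
  opposite ring, in accordance with the sign convention of \<open>word_pairing\<close>. A relation
  between pairings thereby becomes a relation between operator commutators, for every choice of
  additive operators.\<close>

lemma word_pairing_fold:
  assumes "additive L" "\<And>b. additive (P b)"
  shows "word_pairing w (\<lambda>u. L (fold P u h)) = L (word_op P w h)"
  using assms(1)
proof (induction w arbitrary: L h rule: induct_list012)
  case 1
  then show ?case by (simp add: additive.zero)
next
  case (3 b c w)
  have L: "additive (L \<circ> P b)"
    using "3.prems" assms(2) by (auto simp: additive_def)
  have "word_pairing (b # c # w) (\<lambda>u. L (fold P u h)) =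
    word_pairing (c # w) (\<lambda>u. L (fold P u (P b h))) - word_pairing (c # w) (\<lambda>u. (L \<circ> P b) (fold P u h))"
    by (simp flip: word_pairing_diff)
  also have "\<dots> = L (word_op P (c # w) (P b h)) - (L \<circ> P b) (word_op P (c # w) h)"
    using "3.IH"(2)[OF "3.prems"] "3.IH"(2)[OF L] by simp
  finally show ?case using "3.prems" by (simp add: additive.diff)
qed simp

text \<open>The summands of the Leibniz rule for the derivation \<open>l \<mapsto> i l\<close> of
  the free associative ring.\<close>

fun bump :: "('l \<Rightarrow> 'l) \<Rightarrow> 'l list \<Rightarrow> 'l list list" where
  "bump i [] = []"
| "bump i (l # w) = (i l # w) # map ((#) l) (bump i w)"

lemma bump_nonempty: "v \<in> set (bump i w) \<Longrightarrow> length v = length w"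
  by (induction w arbitrary: v) auto

lemma additive_word_op:
  assumes "\<And>b. additive (P b)"
  shows "additive (word_op P w)"
proof (induction w rule: induct_list012)
  case (3 b c w)
  note a = additive.add[OF 3(2)] additive.add[OF assms]
  show ?case by (auto simp: additive_def a algebra_simps)
qed (auto simp: additive_def additive.add[OF assms])

text \<open>Commutation with \<open>D\<close> is a derivation of the operator ring, and by
  \<open>ED\<close> it maps \<open>E l\<close> to \<open>E (i l)\<close>.\<close>

lemma word_op_bump:
  assumes E: "\<And>l. additive (E l)" and D: "additive D"
    and ED: "\<And>l h. E l (D h) - D (E l h) = E (i l) h"
  shows "word_op E w (D h) - D (word_op E w h) = (\<Sum>v\<leftarrow>bump i w. word_op E v h)"
proof (induction w arbitrary: h rule: induct_list012)
  case 1
  show ?case using D by (simp add: additive.zero)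
next
  case 2
  show ?case using ED by simp
next
  case (3 b c w)
  let ?w = "c # w" and ?A = "word_op E (c # w)"
  note d = additive.diff[OF D] additive.diff[OF E] additive.diff[OF additive_word_op[of E, OF E]]
  have ED': "E l (D h) = D (E l h) + E (i l) h" for l h
    using ED[of l h] by (simp add: algebra_simps)
  have A: "?A (D h) = D (?A h) + (\<Sum>v\<leftarrow>bump i ?w. word_op E v h)" for h
    using "3.IH"(2)[of h] by (simp add: algebra_simps)
  have ne: "v \<noteq> []" if "v \<in> set (bump i ?w)" for v
    using bump_nonempty[OF that] by auto
  have cons: "word_op E (b # v) h = word_op E v (E b h) - E b (word_op E v h)" if "v \<in> set (bump i ?w)" for v
    using ne[OF that] by (cases v) auto
  have sumE: "E b (\<Sum>v\<leftarrow>vs. word_op E v h) = (\<Sum>v\<leftarrow>vs. E b (word_op E v h))" for vs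
    by (induction vs) (simp_all add: additive.zero[OF E] additive.add[OF E])
  have "(\<Sum>v\<leftarrow>bump i ?w. word_op E (b # v) h) =
     (\<Sum>v\<leftarrow>bump i ?w. word_op E v (E b h)) - E b (\<Sum>v\<leftarrow>bump i ?w. word_op E v h)"
    unfolding sumE using cons by (simp add: sum_list_subtractf[symmetric] cong: map_cong)
  moreover have "word_op E (b # ?w) (D h) - D (word_op E (b # ?w) h) =
     ?A (E b (D h)) - E b (?A (D h)) - (D (?A (E b h)) - D (E b (?A h)))"
    by (simp add: d)
  moreover have "?A (E b (D h)) = D (?A (E b h)) + (\<Sum>v\<leftarrow>bump i ?w. word_op E v (E b h)) + ?A (E (i b) h)"
    unfolding ED' by (simp add: additive.add[OF additive_word_op[of E, OF E]] A)
  moreover have "E b (?A (D h)) = D (E b (?A h)) + E (i b) (?A h) + E b (\<Sum>v\<leftarrow>bump i ?w. word_op E v h)"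
    unfolding A by (simp add: additive.add[OF E] ED')
  ultimately show ?case
    by (simp add: o_def algebra_simps del: bump.simps(2)) (simp add: o_def algebra_simps)
qed

text \<open>
  When a letter \<open>x\<close> is eliminated, \<open>Der a i\<close> stands for \<open>[a, x, \<dots>, x]\<close> with \<open>i\<close> entries \<open>x\<close>. The
  exponent of \<open>Base\<close> only serves to make \<open>incr\<close> a total injective function.
\<close>

datatype 'b letter = Base 'b nat | Der "'b letter" nat

fun incr :: "'b letter \<Rightarrow> 'b letter" where
  "incr (Base b i) = Base b (Suc i)"
| "incr (Der l i) = Der l (Suc i)"

definition bump_all :: "('l \<Rightarrow> 'l) \<Rightarrow> (bool \<times> 'l list) list \<Rightarrow> (bool \<times> 'l list) list" where
  "bump_all i xs = concat (map (\<lambda>(s, u). map (Pair s) (bump i u)) xs)"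

lemma bump_all_simps [simp]:
  "bump_all i [] = []"
  "bump_all i ((s, u) # xs) = map (Pair s) (bump i u) @ bump_all i xs"
  by (simp_all add: bump_all_def)

text \<open>The value at the word \<open>[x]\<close> is a dummy.\<close>

fun elim :: "'b letter \<Rightarrow> 'b letter list \<Rightarrow> (bool \<times> 'b letter list) list" where
  "elim x [] = []"
| "elim x [a] = (if a = x then [] else [(False, [Der a 0])])"
| "elim x (b # c # w) =
     (if c # w = [x] then (if b = x then [] else [(True, [Der b 1])])
      else if b = x then bump_all incr (elim x (c # w))
      else map (\<lambda>(s, u). (s, Der b 0 # u)) (elim x (c # w)))"

text \<open>Every occurrence of \<open>x\<close> is absorbed into the exponent of a new letter; the
  resulting drop in length drives the induction in \<open>word_prod_eq_one\<close>.\<close>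

lemma elim_length:
  "(s, u) \<in> set (elim x w) \<Longrightarrow> length u = length (filter (\<lambda>a. a \<noteq> x) w) \<and> u \<noteq> []"
proof (induction x w arbitrary: s u rule: elim.induct)
  case (3 x b c w)
  show ?case
  proof (cases "c # w = [x]")
    case False
    note IH = "3.IH"[OF False]
    show ?thesis
    proof (cases "b = x")
      case True
      then obtain v where "(s, v) \<in> set (elim x (c # w))" "u \<in> set (bump incr v)"
        using "3.prems" False by (auto simp: bump_all_def)
      then show ?thesis using IH[of s v] bump_nonempty[of u incr v] True by (auto simp del: elim.simps)
    next
      case b: False
      then obtain v where "(s, v) \<in> set (elim x (c # w))" "u = Der b 0 # v"
        using "3.prems" False by (auto simp del: elim.simps simp: elim.simps(3)[of x b c w])
      then show ?thesis using IH[of s v] b by (auto simp del: elim.simps)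
    qed
  qed (use "3.prems" in \<open>simp split: if_splits\<close>)
qed (auto split: if_splits)

definition signed_sum :: "('l list \<Rightarrow> 'f) \<Rightarrow> (bool \<times> 'l list) list \<Rightarrow> 'f::ab_group_add" where
  "signed_sum F xs = (\<Sum>(s, w)\<leftarrow>xs. if s then - F w else F w)"

lemma signed_sum_simps [simp]:
  "signed_sum F [] = 0"
  "signed_sum F ((s, w) # xs) = (if s then - F w else F w) + signed_sum F xs"
  "signed_sum F (xs @ ys) = signed_sum F xs + signed_sum F ys"
  by (simp_all add: signed_sum_def)

lemma signed_sum_Pair:
  "signed_sum F (map (Pair s) ws) = (if s then - (\<Sum>w\<leftarrow>ws. F w) else (\<Sum>w\<leftarrow>ws. F w))"
  by (induction ws) auto

lemma signed_sum_additive: "additive L \<Longrightarrow> L (signed_sum F xs) = signed_sum (\<lambda>w. L (F w)) xs"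
  by (induction xs) (auto simp: additive.zero additive.add additive.minus)

text \<open>Prepending \<open>x\<close> means commuting with \<open>D\<close>, hence
  \<open>word_op_bump\<close>; prepending another letter only renames it. The word
  \<open>[b, x]\<close> stands for the bracket of \<open>x\<close> with \<open>b\<close>, the
  negative of that of \<open>b\<close> with \<open>x\<close>, which is the origin of the sign
  \<open>True\<close> in \<open>elim\<close>.\<close>

lemma word_op_elim:
  fixes E :: "'b letter \<Rightarrow> 'f \<Rightarrow> 'f::ab_group_add"
  assumes E: "\<And>l. additive (E l)" and D: "additive D"
    and ED: "\<And>l h. E l (D h) - D (E l h) = E (incr l) h"
    and "w \<noteq> [x]"
  shows "word_op (\<lambda>b. if b = x then D else E (Der b 0)) w h = signed_sum (\<lambda>u. word_op E u h) (elim x w)"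
  using assms(4)
proof (induction x w arbitrary: h rule: elim.induct)
  case (3 x b c w)
  let ?P = "\<lambda>b. if b = x then D else E (Der b 0)"
  show ?case
  proof (cases "c # w = [x]")
    case True
    then show ?thesis using ED[of "Der b 0" h, symmetric] by simp
  next
    case False
    then have IH: "word_op ?P (c # w) h = signed_sum (\<lambda>u. word_op E u h) (elim x (c # w))" for h
      using 3 by blast
    show ?thesis
    proof (cases "b = x")
      case True
      have *: "signed_sum (\<lambda>u. word_op E u (D h)) xs - D (signed_sum (\<lambda>u. word_op E u h) xs)
        = signed_sum (\<lambda>u. word_op E u h) (bump_all incr xs)" for xs h
      proof (induction xs)
        case (Cons y xs)
        obtain s u where y: "y = (s, u)" by (cases y)
        show ?case
          using Cons word_op_bump[of E D incr u h, OF E D ED, symmetric]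
          by (simp add: y signed_sum_Pair additive.add[OF D] additive.minus[OF D] algebra_simps)
      qed (simp add: additive.zero[OF D])
      show ?thesis
        using True False * by (simp add: IH del: elim.simps) simp
    next
      case b: False
      have "(\<forall>(s, u) \<in> set xs. u \<noteq> []) \<Longrightarrow> signed_sum (\<lambda>u. word_op E u (E l h)) xs - E l (signed_sum (\<lambda>u. word_op E u h) xs)
        = signed_sum (\<lambda>u. word_op E u h) (map (\<lambda>(s, u). (s, l # u)) xs)" for xs h l
      proof (induction xs)
        case (Cons y xs)
        obtain s u where y: "y = (s, u)" by (cases y)
        then obtain a v where "u = a # v" using Cons.prems by (cases u) auto
        then show ?case
          using Cons by (auto simp: y additive.add[OF E] additive.minus[OF E] algebra_simps)
      qed (simp add: additive.zero[OF E])
      moreover have "\<forall>(s, u) \<in> set (elim x (c # w)). u \<noteq> []" using elim_length by blast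
      ultimately show ?thesis
        using b False by (simp add: IH del: elim.simps) auto
    qed
  qed
qed auto

text \<open>Shifts of functionals are the transpose of left multiplication in the free associative
  ring, so evaluation at \<open>[]\<close> recovers the whole pairing.\<close>

lemma word_pairing_shift:
  "word_op (\<lambda>l h v. h (l # v)) w h [] = word_pairing w (h :: 'l list \<Rightarrow> int)"
proof -
  let ?E = "\<lambda>l (h :: 'l list \<Rightarrow> int) v. h (l # v)"
  have "fold ?E u h v = h (u @ v)" for u v
    by (induction u arbitrary: h) auto
  moreover have "word_pairing w (\<lambda>u. fold ?E u h []) = word_op ?E w h []"
    using word_pairing_fold[of "\<lambda>h :: 'l list \<Rightarrow> int. h []" ?E w h] by (auto simp: additive_def plus_fun_def)
  ultimately show ?thesis by simp
qed

text \<open>A relation in the free associative ring holds for all additive operators. It is applied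
  to the shifts \<open>E l\<close> on functionals of the new letters and to an operator
  \<open>D\<close> whose commutator with \<open>E l\<close> is \<open>E (incr l)\<close>;
  \<open>word_op_elim\<close> then reads the outcome as the relation between the eliminated
  words.\<close>

lemma elim_pairing:
  assumes "\<And>g. signed_sum (\<lambda>w. word_pairing w g) xs = 0" and "\<And>s w. (s, w) \<in> set xs \<Longrightarrow> w \<noteq> [x]"
  shows "signed_sum (\<lambda>w. word_pairing w g) (concat (map (\<lambda>(s, w). map (\<lambda>(t, u). (s \<noteq> t, u)) (elim x w)) xs)) = 0"
proof -
  define E where "E = (\<lambda>l (h :: 'a letter list \<Rightarrow> int) v. h (l # v))"
  \<comment> \<open>The transpose of the derivation that raises one letter by
    \<open>incr\<close>.\<close>
  define D where "D = (\<lambda>(h :: 'a letter list \<Rightarrow> int) v. \<Sum>u\<leftarrow>bump incr v. h u)"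
  have E: "additive (E l)" for l by (auto simp: additive_def E_def plus_fun_def)
  have D: "additive D" by (auto simp: additive_def D_def plus_fun_def sum_list_addf)
  have ED: "E l (D h) - D (E l h) = E (incr l) h" for l h
    by (auto simp: E_def D_def o_def)
  let ?P = "\<lambda>b. if b = x then D else E (Der b 0)"
  have P: "additive (?P b)" for b using E D by auto
  have ev: "additive (\<lambda>h :: 'a letter list \<Rightarrow> int. h [])" by (auto simp: additive_def)
  have *: "word_pairing w (\<lambda>u. fold ?P u g []) = signed_sum (\<lambda>u. word_pairing u g) (elim x w)"
    if "w \<noteq> [x]" for w
  proof -
    have "word_pairing w (\<lambda>u. fold ?P u g []) = word_op ?P w g []"
      using word_pairing_fold[where P = ?P, OF ev P] .
    also have "\<dots> = signed_sum (\<lambda>u. word_op E u g []) (elim x w)"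
      unfolding word_op_elim[of E D w x g, OF E D ED that] using signed_sum_additive[OF ev] .
    finally show ?thesis by (simp add: E_def word_pairing_shift)
  qed
  have flip: "signed_sum F (map (\<lambda>(t, u). (s \<noteq> t, u)) ys) = (if s then - signed_sum F ys else signed_sum F ys)"
    for F :: "'a letter list \<Rightarrow> int" and s ys
    by (induction ys) auto
  have "signed_sum (\<lambda>w. word_pairing w g) (concat (map (\<lambda>(s, w). map (\<lambda>(t, u). (s \<noteq> t, u)) (elim x w)) ys))
    = signed_sum (\<lambda>w. word_pairing w (\<lambda>u. fold ?P u g [])) ys" if "set ys \<subseteq> set xs" for ys
    using that
  proof (induction ys)
    case (Cons y ys)
    obtain s w where y: "y = (s, w)" by (cases y)
    then have "w \<noteq> [x]" using assms(2) Cons.prems by auto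
    then show ?case using Cons *[of w] flip[of "\<lambda>w. word_pairing w g" s "elim x w"] by (simp add: y)
  qed simp
  then show ?thesis using assms(1) by simp
qed

lemma word_pairing_cong_mset:
  "(\<And>u. mset u = mset w \<Longrightarrow> g u = h u) \<Longrightarrow> word_pairing w g = word_pairing w h"
proof (induction w arbitrary: g h rule: induct_list012)
  case (2 a)
  show ?case using "2"[of "[a]"] by simp
next
  case (3 b c w)
  have "g (b # u) - g (u @ [b]) = h (b # u) - h (u @ [b])" if u: "mset u = mset (c # w)" for u
  proof -
    have "g (b # u) = h (b # u)" by (rule "3.prems") (simp add: u)
    moreover have "g (u @ [b]) = h (u @ [b])" by (rule "3.prems") (simp add: u)
    ultimately show ?thesis by (simp only:)
  qed
  then show ?case unfolding word_pairing.simps by (rule "3.IH"(2))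
qed simp

text \<open>Expanding a commutator only rearranges its letters, so a test functional restricted to
  words of content \<open>Q\<close> isolates the part of multidegree \<open>Q\<close>.\<close>

lemma signed_sum_filter_mset:
  assumes "\<And>g. signed_sum (\<lambda>w. word_pairing w g) xs = 0"
  shows "signed_sum (\<lambda>w. word_pairing w g) (filter (\<lambda>(s, w). mset w = Q) xs) = 0"
    "signed_sum (\<lambda>w. word_pairing w g) (filter (\<lambda>x. \<not> (\<lambda>(s, w). mset w = Q) x) xs) = 0"
proof -
  have zero: "word_pairing w (\<lambda>u. 0) = 0" for w :: "'a list"
    by (induction w rule: induct_list012) auto
  let ?h = "\<lambda>u. if mset u = Q then g u else 0"
  have 1: "word_pairing w ?h = (if mset w = Q then word_pairing w g else 0)" for w
    using word_pairing_cong_mset[of w ?h g] word_pairing_cong_mset[of w ?h "\<lambda>u. 0"] zero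
    by (cases "mset w = Q") simp_all
  have "signed_sum (\<lambda>w. word_pairing w ?h) xs = signed_sum (\<lambda>w. word_pairing w g) (filter (\<lambda>(s, w). mset w = Q) xs)"
    unfolding 1 by (induction xs) auto
  then show 2: "signed_sum (\<lambda>w. word_pairing w g) (filter (\<lambda>(s, w). mset w = Q) xs) = 0"
    using assms by simp
  have "signed_sum F xs = signed_sum F (filter P xs) + signed_sum F (filter (\<lambda>x. \<not> P x) xs)"
    for F :: "'a list \<Rightarrow> int" and P
    by (induction xs) auto
  from this[of "\<lambda>w. word_pairing w g" "\<lambda>(s, w). mset w = Q"]
  show "signed_sum (\<lambda>w. word_pairing w g) (filter (\<lambda>x. \<not> (\<lambda>(s, w). mset w = Q) x) xs) = 0"
    using assms 2 by simp
qed

section \<open>Bracketing with a fixed element as a derivation on words\<close>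

context weighted_letters
begin

lemma weight_bump:
  assumes "\<And>l. wt (i l) = wt l + p" "v \<in> set (bump i w)"
  shows "weight v = weight w + p \<and> v \<noteq> []"
  using assms(2) by (induction w arbitrary: v) (auto simp: assms(1))

lemma homogeneous_bump_all:
  assumes "\<And>l. wt (i l) = wt l + p" "homogeneous n xs"
  shows "homogeneous (n + p) (bump_all i xs)"
  using assms(2) weight_bump[OF assms(1)] by (fastforce simp: homogeneous_def bump_all_def)

text \<open>The group counterpart of \<open>word_op_bump\<close>: Jacobi distributes
  \<open>y\<close> over the outermost letter and the remaining commutator, where induction takes
  over.\<close>

lemma lnc_bump:
  assumes i: "\<And>l. f (i l) = gcomm (f l) y" "\<And>l. wt (i l) = wt l + p"
    and y: "y \<in> \<gamma> p" "p > 0" and "w \<noteq> []"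
  shows "lcong (Suc (weight w + p)) (gcomm (lnc f w) y) (word_prod f (map (Pair False) (bump i w)))"
  using assms(5)
proof (induction w)
  case (Cons b w)
  have yc: "y \<in> carrier G" using y lower_central_closed by blast
  show ?case
  proof (cases "w = []")
    case True
    then show ?thesis using yc by (simp add: signed_def i(1))
  next
    case False
    let ?n = "weight w" and ?vs = "map (Pair False) (bump i w)"
    have pos: "?n > 0" using False weight_pos by blast
    have hom: "homogeneous (?n + p) ?vs"
      using weight_bump[of i p] i(2) by (auto simp: homogeneous_def)
    have "lcong (Suc (weight (b # w) + p)) (gcomm (gcomm (lnc f w) (f b)) y)
        (gcomm (gcomm (lnc f w) y) (f b) \<otimes> gcomm (lnc f w) (gcomm (f b) y))"
      using pos y by (intro lcong_Jacobi[of ?n "wt b" p] lnc_weight letter wt_pos) auto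
    also have "lcong (Suc (weight (b # w) + p)) (gcomm (gcomm (lnc f w) y) (f b) \<otimes> gcomm (lnc f w) (gcomm (f b) y))
       (word_prod f (map (\<lambda>(s, w). (s, b # w)) ?vs) \<otimes> gcomm (lnc f w) (gcomm (f b) y))"
    proof (rule lcong_mult)
      have "lcong (Suc (?n + p + wt b)) (gcomm (gcomm (lnc f w) y) (f b)) (gcomm (word_prod f ?vs) (f b))"
        using pos y Cons.IH[OF False] by (intro lcong_gcomm_left[of "?n + p" "wt b"] letter wt_pos) auto
      also have "lcong (Suc (?n + p + wt b)) (gcomm (word_prod f ?vs) (f b)) (word_prod f (map (\<lambda>(s, w). (s, b # w)) ?vs))"
        using pos by (intro word_prod_gcomm hom) auto
      finally show "lcong (Suc (weight (b # w) + p)) (gcomm (gcomm (lnc f w) y) (f b)) (word_prod f (map (\<lambda>(s, w). (s, b # w)) ?vs))"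
        by (simp add: ac_simps)
    qed (use yc in auto)
    also have "lcong (Suc (weight (b # w) + p)) \<dots> (gcomm (lnc f w) (gcomm (f b) y) \<otimes> word_prod f (map (\<lambda>(s, w). (s, b # w)) ?vs))"
    proof (rule lcong_commute[of "weight (b # w) + p" "weight (b # w) + p"])
      have "homogeneous (?n + p + wt b) (map (\<lambda>(s, w). (s, b # w)) ?vs)"
        using hom by (auto simp: homogeneous_def)
      then show "word_prod f (map (\<lambda>(s, w). (s, b # w)) ?vs) \<in> \<gamma> (weight (b # w) + p)"
        using word_prod_lower_central by (fastforce simp: ac_simps)
      have "gcomm (lnc f w) (gcomm (f b) y) \<in> \<gamma> (?n + (wt b + p))"
        using pos y by (intro gcomm_lower_central lnc_weight letter wt_pos) auto
      then show "gcomm (lnc f w) (gcomm (f b) y) \<in> \<gamma> (weight (b # w) + p)"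
        by (simp add: ac_simps)
    qed (use y in auto)
    finally show ?thesis
      using False by (simp add: lnc_Cons i(1) signed_def o_def)
  qed
qed simp

lemma word_prod_bump_all:
  assumes i: "\<And>l. f (i l) = gcomm (f l) y" "\<And>l. wt (i l) = wt l + p"
    and y: "y \<in> \<gamma> p" "p > 0" and "n > 0" "homogeneous n xs"
  shows "lcong (Suc (n + p)) (gcomm (word_prod f xs) y) (word_prod f (bump_all i xs))"
  using assms(6)
proof (induction xs)
  case (Cons z xs)
  have yc: "y \<in> carrier G" using y lower_central_closed by blast
  obtain s w where z: "z = (s, w)" by (cases z)
  have h: "homogeneous n xs" "weight w = n" "w \<noteq> []" using Cons.prems z by auto
  let ?p = "word_prod f xs" and ?vs = "map (Pair False) (bump i w)"
  have l: "lnc f w \<in> \<gamma> n" using h(2) lnc_weight by blast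
  have p: "?p \<in> \<gamma> n" using h word_prod_lower_central by blast
  have vs: "homogeneous (n + p) ?vs"
    using weight_bump[of i p] i(2) h by (auto simp: homogeneous_def)
  have flip: "map (\<lambda>(t, w). (s \<noteq> t, w)) ?vs = map (Pair s) (bump i w)" by auto
  have "lcong (Suc (n + p)) (gcomm (signed s (lnc f w)) y) (signed s (gcomm (lnc f w) y))"
    using assms l by (intro lcong_gcomm_signed[of n p]) auto
  also have "lcong (Suc (n + p)) (signed s (gcomm (lnc f w) y)) (signed s (word_prod f ?vs))"
    using lnc_bump[of i y p w, OF i y h(3)] h(2) by (intro lcong_signed) simp
  also have "lcong (Suc (n + p)) (signed s (word_prod f ?vs)) (word_prod f (map (Pair s) (bump i w)))"
    using lcong_sym[OF word_prod_signed[OF _ vs, of s]] assms(5) unfolding flip by simp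
  finally have 1: "lcong (Suc (n + p)) (gcomm (signed s (lnc f w)) y) (word_prod f (map (Pair s) (bump i w)))" .
  have "lcong (Suc (n + p)) (gcomm (signed s (lnc f w) \<otimes> ?p) y) (gcomm (signed s (lnc f w)) y \<otimes> gcomm ?p y)"
    using assms l p by (intro lcong_gcomm_mult_left[of n p] signed_lower_central) auto
  also have "lcong (Suc (n + p)) (gcomm (signed s (lnc f w)) y \<otimes> gcomm ?p y)
     (word_prod f (map (Pair s) (bump i w)) \<otimes> word_prod f (bump_all i xs))"
    using h by (intro lcong_mult 1 Cons.IH)
  finally show ?case by (simp add: z word_prod_append)
qed (use y lower_central_closed in auto)

end

section \<open>Lazard elimination of a letter in a group\<close>

locale letter_elimination = weighted_letters G f wt
  for G (structure) and f :: "'l letter \<Rightarrow> 'a" and wt :: "'l letter \<Rightarrow> nat" +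
  fixes x :: "'l letter"
begin

fun derived :: "'l letter \<Rightarrow> 'a" where
  "derived (Base b i) = \<one>"
| "derived (Der a i) = ((\<lambda>g. gcomm g (f x)) ^^ i) (f a)"

text \<open>The dummy letters \<open>Base b i\<close> have value \<one>, which lies at every depth;
  their weights are merely positive and compatible with \<open>incr\<close>.\<close>

fun derived_wt :: "'l letter \<Rightarrow> nat" where
  "derived_wt (Base b i) = Suc (i * wt x)"
| "derived_wt (Der a i) = wt a + i * wt x"

lemma derived_incr: "derived (incr l) = gcomm (derived l) (f x)"
  by (cases l) auto

lemma derived_wt_incr: "derived_wt (incr l) = derived_wt l + wt x"
  by (cases l) auto

lemma weighted_letters_derived: "weighted_letters G derived derived_wt"
proof unfold_locales
  show "derived l \<in> \<gamma> (derived_wt l)" for l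
  proof (cases l)
    case (Der a i)
    have "((\<lambda>g. gcomm g (f x)) ^^ i) (f a) \<in> \<gamma> (wt a + i * wt x)"
    proof (induction i)
      case (Suc i)
      have "gcomm (((\<lambda>g. gcomm g (f x)) ^^ i) (f a)) (f x) \<in> \<gamma> ((wt a + i * wt x) + wt x)"
        using wt_pos by (intro gcomm_lower_central Suc letter) auto
      then show ?case by (simp add: ac_simps)
    qed (simp add: letter)
    then show ?thesis using Der by simp
  qed simp
  show "derived_wt l > 0" for l using wt_pos by (cases l) auto
qed

sublocale D: weighted_letters G derived derived_wt
  by (rule weighted_letters_derived)

lemma elim_homogeneous: "w \<noteq> [x] \<Longrightarrow> D.homogeneous (weight w) (elim x w)"
proof (induction w rule: induct_list012)
  case (3 b c w)
  show ?case
  proof (cases "c # w = [x]")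
    case False
    then have IH: "D.homogeneous (weight (c # w)) (elim x (c # w))" using 3(2) by blast
    show ?thesis
    proof (cases "b = x")
      case True
      have "D.homogeneous (weight (c # w) + wt x) (bump_all incr (elim x (c # w)))"
        by (rule D.homogeneous_bump_all[OF derived_wt_incr IH])
      then show ?thesis using True False by (auto simp: ac_simps)
    next
      case b: False
      show ?thesis using IH b False by (auto simp: D.homogeneous_def)
    qed
  qed auto
qed auto

text \<open>Follows the recursion of \<open>elim\<close> as \<open>word_op_elim\<close> does, with
  \<open>word_prod_bump_all\<close> as the Leibniz rule and \<open>inv_gcomm\<close> for the word
  \<open>[b, x]\<close>. Group commutators and operators are thus rewritten by the same symbolic
  procedure.\<close>

lemma lnc_elim:
  "w \<noteq> [x] \<Longrightarrow> lcong (Suc (weight w)) (lnc f w) (word_prod derived (elim x w))"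
proof (induction w rule: induct_list012)
  case (2 a)
  then show ?case by (simp add: signed_def)
next
  case (3 b c w)
  show ?case
  proof (cases "c # w = [x]")
    case True
    then show ?thesis by (auto simp: signed_def inv_gcomm)
  next
    case False
    let ?w = "c # w"
    have IH: "lcong (Suc (weight ?w)) (lnc f ?w) (word_prod derived (elim x ?w))" using False 3(2) by blast
    have hom: "D.homogeneous (weight ?w) (elim x ?w)" using elim_homogeneous False by blast
    have pos: "weight ?w > 0" by (rule weight_pos) simp
    have 1: "lcong (Suc (weight ?w + wt b)) (gcomm (lnc f ?w) (f b)) (gcomm (word_prod derived (elim x ?w)) (f b))"
      using pos by (intro lcong_gcomm_left[of "weight ?w" "wt b"] IH letter wt_pos) auto
    show ?thesis
    proof (cases "b = x")
      case True
      have "lcong (Suc (weight ?w + wt x)) (gcomm (word_prod derived (elim x ?w)) (f x)) (word_prod derived (bump_all incr (elim x ?w)))"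
        by (rule D.word_prod_bump_all[OF derived_incr derived_wt_incr letter wt_pos pos hom])
      then show ?thesis using True False 1 lcong_trans by (auto simp: ac_simps)
    next
      case b: False
      have "lcong (Suc (weight ?w + wt b)) (gcomm (word_prod derived (elim x ?w)) (f b))
        (word_prod derived (map (\<lambda>(s, u). (s, Der b 0 # u)) (elim x ?w)))"
        using D.word_prod_gcomm[OF hom pos, of "Der b 0"] by simp
      then show ?thesis using b False lcong_trans[OF 1] by (auto simp: ac_simps)
    qed
  qed
qed auto

definition elim_all :: "(bool \<times> 'l letter list) list \<Rightarrow> (bool \<times> 'l letter list) list" where
  "elim_all xs = concat (map (\<lambda>(s, w). map (\<lambda>(t, u). (s \<noteq> t, u)) (elim x w)) xs)"

lemma word_prod_elim_all:
  assumes "n > 0" "homogeneous n xs" "\<And>s w. (s, w) \<in> set xs \<Longrightarrow> w \<noteq> [x]"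
  shows "D.homogeneous n (elim_all xs) \<and> lcong (Suc n) (word_prod f xs) (word_prod derived (elim_all xs))"
  using assms(2,3)
proof (induction xs)
  case Nil
  show ?case by (simp add: elim_all_def)
next
  case (Cons z xs)
  obtain s w where z: "z = (s, w)" by (cases z)
  have h: "homogeneous n xs" "weight w = n" "w \<noteq> [x]" using Cons.prems z by auto
  let ?v = "map (\<lambda>(t, u). (s \<noteq> t, u)) (elim x w)"
  have e: "elim_all (z # xs) = ?v @ elim_all xs" by (simp add: elim_all_def z)
  have hom: "D.homogeneous n (elim x w)" using elim_homogeneous h by blast
  then have "D.homogeneous n ?v" by (auto simp: D.homogeneous_def)
  have "lcong (Suc n) (signed s (lnc f w)) (signed s (word_prod derived (elim x w)))"
    using lnc_elim[OF h(3)] h(2) by (intro lcong_signed) simp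
  also have "lcong (Suc n) \<dots> (word_prod derived ?v)"
    by (rule lcong_sym[OF D.word_prod_signed[OF assms(1) hom]])
  finally have "lcong (Suc n) (signed s (lnc f w) \<otimes> word_prod f xs) (word_prod derived ?v \<otimes> word_prod derived (elim_all xs))"
    using Cons.IH[OF h(1)] Cons.prems(2) by (intro lcong_mult) auto
  moreover have "D.homogeneous n (elim_all xs)" using Cons.IH[OF h(1)] Cons.prems(2) by auto
  ultimately show ?case
    unfolding e D.word_prod_append using \<open>D.homogeneous n ?v\<close> by (simp add: z)
qed

end

context group
begin

text \<open>
  The linear relations between left-normed commutators of letters that hold in the free
  associative ring hold in every group. This is Lazard elimination: after separating the
  multidegrees, a letter \<open>x\<close> occurring in all the words is removed by passing to the letters
  \<open>[a, x, \<dots>, x]\<close>, which makes the words shorter.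
\<close>

theorem word_prod_eq_one:
  fixes f :: "'l letter \<Rightarrow> 'a"
  assumes "weighted_letters G f wt" "weighted_letters.homogeneous wt n xs" "n > 0"
    and "\<And>s w. (s, w) \<in> set xs \<Longrightarrow> length w = m"
    and "\<And>g. signed_sum (\<lambda>w. word_pairing w g) xs = 0"
  shows "word_prod f xs \<in> \<gamma> (Suc n)"
  using assms
proof (induction m arbitrary: f wt xs rule: less_induct)
  case (less m)
  interpret weighted_letters G f wt by fact
  note shorter_IH = less.IH
  \<comment> \<open>For fixed word length, an induction on the number of factors splits off
    multidegrees until a single one is left.\<close>
  show ?case
    using less.prems(2,4,5)
  proof (induction "length xs" arbitrary: xs rule: less_induct)
    case (less xs)
    note outer = less.prems and inner = less.hyps
    show ?case
    proof (cases xs)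
      case (Cons z zs)
      obtain t v where z: "z = (t, v)" by (cases z)
      let ?P = "\<lambda>(s, w). mset w = mset v"
      note filt = signed_sum_filter_mset[OF outer(3), where Q = "mset v"]
      show ?thesis
      proof (cases "filter (\<lambda>x. \<not> ?P x) xs = []")
        case False
        have ne: "filter ?P xs \<noteq> []" using Cons z by simp
        have len: "length (filter ?P xs) + length (filter (\<lambda>x. \<not> ?P x) xs) = length xs"
          by (rule sum_length_filter_compl)
        have lt: "length (filter ?P xs) < length xs" "length (filter (\<lambda>x. \<not> ?P x) xs) < length xs"
          using len False ne by (metis add_cancel_right_right add_cancel_left_left le_add1 le_add2 length_0_conv nat_less_le)+
        have "word_prod f (filter ?P xs) \<in> \<gamma> (Suc n)"
          by (rule inner[OF lt(1) homogeneous_filter[OF outer(1)] _ filt(1)]) (use outer(2) in auto)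
        moreover have "word_prod f (filter (\<lambda>x. \<not> ?P x) xs) \<in> \<gamma> (Suc n)"
          by (rule inner[OF lt(2) homogeneous_filter[OF outer(1)] _ filt(2)]) (use outer(2) in auto)
        ultimately show ?thesis
          using word_prod_filter[OF assms(3) outer(1), of ?P]
          by (meson lcong_lower_central lcong_sym lower_central_mult order_refl)
      next
        case True
        then have content: "mset w = mset v" if "(s, w) \<in> set xs" for s w
          using that by (auto simp: filter_empty_conv)
        have v: "v \<noteq> []" "length v = m"
          using outer(1,2) Cons z by (auto simp: homogeneous_def)
        show ?thesis
        proof (cases "m = 1")
          case True
          then obtain a where a: "v = [a]" using v by (cases v) auto
          have w: "w = [a]" if "(s, w) \<in> set xs" for s w
            using content[OF that] a by simp
          have pow: "f a [^] (k - 1) = inv (f a) \<otimes> f a [^] k" "f a [^] (1 + k) = f a \<otimes> f a [^] k" for k :: int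
            using int_pow_mult[of "f a" "- 1" k] int_pow_mult[of "f a" 1 k]
            by (simp_all add: int_pow_neg int_pow_1)
          \<comment> \<open>All words are \<open>[a]\<close> here, and pairing with the constant
            functional 1 counts them with sign.\<close>
          have "word_prod f ys = f a [^] signed_sum (\<lambda>w. word_pairing w (\<lambda>_. 1)) ys"
            if "set ys \<subseteq> set xs" for ys
            using that
          proof (induction ys)
            case (Cons y ys)
            obtain s w' where y: "y = (s, w')" by (cases y)
            then have "w' = [a]" using w Cons.prems by auto
            then show ?case
              using Cons y by (auto simp: signed_def pow)
          qed simp
          then show ?thesis using outer(3) by simp
        next
          case False
          \<comment> \<open>All words have the same letters with multiplicity, so any letter of
            \<open>v\<close> occurs in each of them. As \<open>m \<noteq> 1\<close>, the word
            \<open>[x]\<close>, on which \<open>elim\<close> has a dummy value, does not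
            arise.\<close>
          define x where "x = hd v"
          interpret letter_elimination G f wt x ..
          have x: "x \<in> set v" using v by (simp add: x_def)
          have neq: "w \<noteq> [x]" if "(s, w) \<in> set xs" for s w
            using outer(2)[OF that] False by auto
          have elim_all: "D.homogeneous n (elim_all xs) \<and> lcong (Suc n) (word_prod f xs) (word_prod derived (elim_all xs))"
            using neq by (intro word_prod_elim_all[OF assms(3) outer(1)]) blast
          have shorter: "length u = length (filter (\<lambda>a. a \<noteq> x) v)" if su: "(s, u) \<in> set (elim_all xs)" for s u
          proof -
            obtain s' w t where *: "(s', w) \<in> set xs" "(t, u) \<in> set (elim x w)"
              using su by (auto simp: elim_all_def)
            have "length u = size (filter_mset (\<lambda>a. a \<noteq> x) (mset w))"
              using elim_length[OF *(2)] by (simp flip: mset_filter)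
            then show ?thesis using content[OF *(1)] by (simp flip: mset_filter)
          qed
          have "length (filter (\<lambda>a. a \<noteq> x) v) < m"
            using length_filter_less[of x v "\<lambda>a. a \<noteq> x"] x v by auto
          then have "word_prod derived (elim_all xs) \<in> \<gamma> (Suc n)"
          proof (rule shorter_IH)
            show "weighted_letters G derived derived_wt" by (rule weighted_letters_derived)
            show "D.homogeneous n (elim_all xs)"
              using elim_all ..
            show "signed_sum (\<lambda>w. word_pairing w g) (elim_all xs) = 0" for g
              unfolding elim_all_def using neq by (intro elim_pairing[OF outer(3)]) blast
          qed (use shorter assms(3) in auto)
          then show ?thesis
            using elim_all lcong_lower_central lcong_sym by blast
        qed
      qed
    qed simp
  qed
qed

end

section \<open>The Magnus representation\<close>

text \<open>Composition with the precedence of a product: \<open>\<circ>\<close> binds more weakly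
  than \<open>+\<close> and \<open>-\<close>.\<close>

abbreviation (input) comp_tight :: "('b \<Rightarrow> 'c) \<Rightarrow> ('a \<Rightarrow> 'b) \<Rightarrow> 'a \<Rightarrow> 'c" (infixl "\<cdot>" 70) where
  "f \<cdot> g \<equiv> f \<circ> g"

definition vanishes :: "nat \<Rightarrow> ('b list \<Rightarrow> int) \<Rightarrow> bool" where
  "vanishes m h \<longleftrightarrow> (\<forall>v. length v \<ge> m \<longrightarrow> h v = 0)"

type_synonym 'b operator = "('b list \<Rightarrow> int) \<Rightarrow> ('b list \<Rightarrow> int)"

text \<open>Functionals are dual to the free associative ring, so lowering the degree by
  \<open>n\<close> is the transpose of multiplying into the \<open>n\<close>-th power of the
  augmentation ideal. In particular, a functional that vanishes from length \<open>n\<close> on is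
  killed.\<close>

definition lowers :: "nat \<Rightarrow> 'b operator \<Rightarrow> bool" where
  "lowers n A \<longleftrightarrow> additive A \<and> (\<forall>m h. vanishes m h \<longrightarrow> vanishes (m - n) (A h))"

lemma lowers_additive: "lowers n A \<Longrightarrow> additive A"
  by (simp add: lowers_def)

lemma vanishes_mono: "vanishes m h \<Longrightarrow> m \<le> n \<Longrightarrow> vanishes n h"
  by (auto simp: vanishes_def)

lemma lowers_mono: "lowers n A \<Longrightarrow> k \<le> n \<Longrightarrow> lowers k A"
  unfolding lowers_def by (meson diff_le_mono2 vanishes_mono)

lemma lowers_zero: "lowers n 0"
  by (auto simp: lowers_def additive_def vanishes_def)

lemma lowers_zero' [simp]: "lowers n (\<lambda>h v. 0)"
  using lowers_zero by (simp add: zero_fun_def)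

lemma lowers_id: "lowers 0 id"
  by (auto simp: lowers_def additive_def)

lemma lowers_plus: "lowers n A \<Longrightarrow> lowers n B \<Longrightarrow> lowers n (A + B)"
  by (auto simp: lowers_def additive_def vanishes_def algebra_simps)

lemma lowers_uminus: "lowers n A \<Longrightarrow> lowers n (- A)"
  by (auto simp: lowers_def additive_def vanishes_def)

lemma lowers_minus: "lowers n A \<Longrightarrow> lowers n B \<Longrightarrow> lowers n (A - B)"
  using lowers_plus[OF _ lowers_uminus, of n A B] by simp

lemma lowers_comp:
  assumes "lowers i A" "lowers j B" "n \<le> i + j" shows "lowers n (A \<cdot> B)"
proof (rule lowers_mono[OF _ assms(3)])
  show "lowers (i + j) (A \<cdot> B)"
    unfolding lowers_def
  proof (intro conjI allI impI)
    show "additive (A \<cdot> B)"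
      using assms by (simp add: lowers_def additive_def)
    fix m h assume "vanishes m (h :: 'a list \<Rightarrow> int)"
    then have "vanishes (m - j - i) (A (B h))" using assms unfolding lowers_def by blast
    then show "vanishes (m - (i + j)) ((A \<cdot> B) h)" by (simp add: add.commute)
  qed
qed

lemma comp_plus_left: "(A + B) \<cdot> C = A \<cdot> C + B \<cdot> C"
  by (auto simp: fun_eq_iff)

lemma comp_minus_left: "(A - B) \<cdot> C = A \<cdot> C - B \<cdot> C"
  by (auto simp: fun_eq_iff)

lemma comp_plus_right: "additive A \<Longrightarrow> A \<cdot> (B + C) = A \<cdot> B + A \<cdot> C"
  by (auto simp: fun_eq_iff additive.add)

lemma comp_minus_right: "additive A \<Longrightarrow> A \<cdot> (B - C) = A \<cdot> B - A \<cdot> C"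
  by (auto simp: fun_eq_iff additive.diff)

definition inverse_ops :: "'b operator \<Rightarrow> 'b operator \<Rightarrow> bool" where
  "inverse_ops A A' \<longleftrightarrow> A \<cdot> A' = id \<and> A' \<cdot> A = id \<and> lowers 1 (A - id) \<and> lowers 1 (A' - id)"

definition unipotent_group :: "(('b list \<Rightarrow> int) \<Rightarrow> ('b list \<Rightarrow> int)) monoid" where
  "unipotent_group = \<lparr>carrier = {A. \<exists>A'. inverse_ops A A'}, monoid.mult = (\<circ>), one = id\<rparr>"

lemma lowers_0_of_unipotent: "lowers 1 (A - id) \<Longrightarrow> lowers 0 A"
  using lowers_plus[of 0 "A - id" id] lowers_mono[of 1 "A - id" 0] lowers_id by simp

lemma inverse_ops_comp:
  assumes "inverse_ops A A'" "inverse_ops B B'"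
  shows "inverse_ops (A \<cdot> B) (B' \<cdot> A')"
proof -
  have *: "lowers 1 (A \<cdot> B - id)" if "lowers 1 (A - id)" "lowers 1 (B - id)" for A B :: "'a operator"
  proof -
    have *: "A \<cdot> B - id = (A - id) \<cdot> B + (B - id)"
      by (auto simp: fun_eq_iff)
    show ?thesis
      unfolding * by (rule lowers_plus[OF lowers_comp[OF that(1) lowers_0_of_unipotent[OF that(2)]] that(2)]) simp
  qed
  have inv: "A (A' h) = h" "A' (A h) = h" "B (B' h) = h" "B' (B h) = h" for h
    using assms unfolding inverse_ops_def by (metis comp_apply id_apply)+
  have "A \<cdot> B \<cdot> (B' \<cdot> A') = id" "B' \<cdot> A' \<cdot> (A \<cdot> B) = id"
    by (rule ext, simp add: inv)+
  then show ?thesis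
    using assms * unfolding inverse_ops_def by blast
qed

lemma group_unipotent: "group (unipotent_group :: 'b operator monoid)"
proof (rule groupI)
  fix A :: "'b operator" assume "A \<in> carrier unipotent_group"
  then obtain A' where "inverse_ops A A'" by (auto simp: unipotent_group_def)
  then show "\<exists>B\<in>carrier unipotent_group. B \<otimes>\<^bsub>unipotent_group\<^esub> A = \<one>\<^bsub>unipotent_group\<^esub>"
    by (intro bexI[of _ A']) (auto simp: unipotent_group_def inverse_ops_def)
next
  have "inverse_ops id (id :: 'b operator)"
    using lowers_zero by (simp add: inverse_ops_def)
  then show "\<one>\<^bsub>unipotent_group\<^esub> \<in> carrier (unipotent_group :: 'b operator monoid)"
    by (auto simp: unipotent_group_def)
next
  fix A B :: "'b operator" assume "A \<in> carrier unipotent_group" "B \<in> carrier unipotent_group"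
  then show "A \<otimes>\<^bsub>unipotent_group\<^esub> B \<in> carrier unipotent_group"
    using inverse_ops_comp by (fastforce simp: unipotent_group_def)
qed (auto simp: unipotent_group_def comp_assoc)

text \<open>The truncation at length \<open>c\<close> makes \<open>id + shift_op c b\<close> invertible.\<close>

definition shift_op :: "nat \<Rightarrow> 'b \<Rightarrow> 'b operator" where
  "shift_op c b h = (\<lambda>v. if length v < c then h (b # v) else 0)"

lemma lowers_shift: "lowers 1 (shift_op c b)"
  by (auto simp: lowers_def additive_def shift_op_def vanishes_def fun_eq_iff)

text \<open>Partial sums of the geometric series for the inverse of
  \<open>id + shift_op c b\<close>.\<close>

primrec shift_inv :: "nat \<Rightarrow> 'b \<Rightarrow> nat \<Rightarrow> 'b operator" where
  "shift_inv c b 0 = id"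
| "shift_inv c b (Suc i) = id - shift_op c b \<cdot> shift_inv c b i"

lemma shift_unipotent: "inverse_ops (id + shift_op c b) (shift_inv c b c)"
proof -
  let ?E = "shift_op c b" and ?N = "shift_inv c b"
  note E = lowers_shift[of c b]
  have low: "lowers 1 (?N i - id)" for i
  proof (induction i)
    case (Suc i)
    have "lowers 1 (- (?E \<cdot> ?N i))"
      by (intro lowers_uminus lowers_comp[OF E lowers_0_of_unipotent[OF Suc]]) simp
    moreover have "?N (Suc i) - id = - (?E \<cdot> ?N i)" by simp
    ultimately show ?case by (simp only:)
  qed (simp add: lowers_zero)
  have "?N i (?E h) = ?E (?N i h)" for i h
  proof (induction i)
    case (Suc i)
    have "?N (Suc i) (?E h) = ?E h - ?E (?N i (?E h))" by (simp add: fun_eq_iff)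
    also have "\<dots> = ?E (h - ?E (?N i h))"
      unfolding Suc by (rule additive.diff[symmetric, OF lowers_additive[OF E]])
    also have "h - ?E (?N i h) = ?N (Suc i) h" by (simp add: fun_eq_iff)
    finally show ?case .
  qed simp
  then have comm: "?N i \<cdot> ?E = ?E \<cdot> ?N i" for i
    by (intro ext) simp
  \<comment> \<open>Up to sign the difference is the power of \<open>?E\<close> with exponent
    \<open>i + 1\<close>; at \<open>v\<close> it evaluates \<open>h\<close> at a word of length
    \<open>length v + i + 1\<close>, which the truncation cuts off beyond \<open>c\<close>.\<close>
  have "(?N (Suc i) - ?N i) h v = 0" if "length v + i \<ge> c" for i h v
    using that
  proof (induction i arbitrary: v)
    case (Suc i)
    have "?N (Suc (Suc i)) - ?N (Suc i) = - (?E \<cdot> (?N (Suc i) - ?N i))"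
      by (simp add: comp_minus_right[OF lowers_additive[OF E]])
    then have "(?N (Suc (Suc i)) - ?N (Suc i)) h v = - ?E ((?N (Suc i) - ?N i) h) v"
      by (simp only: fun_Compl_def comp_apply uminus_apply)
    then show ?case using Suc.IH[of "b # v"] Suc.prems by (simp add: shift_op_def)
  qed (simp add: shift_op_def)
  then have "?N (Suc c) = ?N c" by (auto simp: fun_eq_iff)
  then have 1: "?N c + ?E \<cdot> ?N c = id" by simp (metis diff_add_cancel)
  have "(id + ?E) \<cdot> ?N c = id" using 1 by (simp add: comp_plus_left)
  moreover have "?N c \<cdot> (id + ?E) = id"
    using 1 low[of c] by (simp add: comp_plus_right lowers_additive[OF lowers_0_of_unipotent] comm)
  ultimately show ?thesis using E low by (simp add: inverse_ops_def)
qed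

text \<open>The identities cancel in \<open>A B - B A = a b - b a\<close>, and \<open>A' B'\<close>
  is the inverse of \<open>B A\<close>.\<close>

lemma unipotent_commutator:
  fixes A :: "'b operator"
  assumes "inverse_ops A A'" "inverse_ops B B'"
  defines "a \<equiv> A - id" and "b \<equiv> B - id"
  shows "A \<cdot> B \<cdot> A' \<cdot> B' - id = (a \<cdot> b - b \<cdot> a) \<cdot> (A' \<cdot> B')"
proof -
  have add: "additive A" "additive B"
    using assms lowers_0_of_unipotent lowers_additive unfolding inverse_ops_def by blast+
  have "A \<cdot> B = B \<cdot> A + (a \<cdot> b - b \<cdot> a)"
    by (auto simp: a_def b_def fun_eq_iff additive.diff[OF add(1)] additive.diff[OF add(2)])
  then have "A \<cdot> B \<cdot> (A' \<cdot> B') = B \<cdot> A \<cdot> (A' \<cdot> B') + (a \<cdot> b - b \<cdot> a) \<cdot> (A' \<cdot> B')"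
    by (simp only: comp_plus_left)
  moreover have "B \<cdot> A \<cdot> (A' \<cdot> B') = id"
    using inverse_ops_comp[OF assms(2,1)] unfolding inverse_ops_def by blast
  ultimately show ?thesis by (simp add: comp_assoc)
qed

lemma lowers_commutator:
  fixes A :: "'b operator"
  assumes "inverse_ops A A'" "inverse_ops B B'" "lowers i (A - id)" "lowers j (B - id)"
  shows "lowers (i + j) (A \<cdot> B \<cdot> A' \<cdot> B' - id)"
proof -
  have "lowers (i + j) ((A - id) \<cdot> (B - id) - (B - id) \<cdot> (A - id))"
    using lowers_minus[OF lowers_comp[OF assms(3,4) order_refl] lowers_comp[OF assms(4,3)]] by simp
  moreover have "lowers 0 (A' \<cdot> B')"
    using inverse_ops_comp[OF assms(2,1)] lowers_0_of_unipotent unfolding inverse_ops_def by blast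
  ultimately show ?thesis
    unfolding unipotent_commutator[OF assms(1,2)] by (rule lowers_comp) simp
qed

text \<open>By \<open>unipotent_commutator\<close> the commutator minus \<open>id\<close> is
  \<open>?C\<close> times \<open>id + U\<close>. As \<open>U\<close> lowers degrees by 1, only the
  bracket of the leading parts survives in degree \<open>i + j\<close>.\<close>

lemma lead_commutator:
  fixes A :: "'b operator"
  assumes "inverse_ops A A'" "inverse_ops B B'" "lowers i a" "lowers j b"
    and "lowers (Suc i) (A - id - a)" "lowers (Suc j) (B - id - b)"
  shows "lowers (Suc (i + j)) (A \<cdot> B \<cdot> A' \<cdot> B' - id - (a \<cdot> b - b \<cdot> a))"
proof -
  define a' where "a' = A - id - a"
  define b' where "b' = B - id - b"
  define U where "U = A' \<cdot> B' - id"
  have ab: "A - id = a + a'" "B - id = b + b'" by (auto simp: a'_def b'_def)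
  have ab': "lowers (Suc i) a'" "lowers (Suc j) b'" using assms by (auto simp: a'_def b'_def)
  have low: "lowers i (A - id)" "lowers j (B - id)"
    unfolding ab using assms ab' by (auto intro!: lowers_plus intro: lowers_mono)
  have U: "lowers 1 U"
    using inverse_ops_comp[OF assms(2,1)] by (simp add: U_def inverse_ops_def)
  let ?C = "(A - id) \<cdot> (B - id) - (B - id) \<cdot> (A - id)"
  have C: "lowers (i + j) ?C"
    using lowers_minus[OF lowers_comp[OF low order_refl] lowers_comp[OF low(2,1)]] by simp
  have "A \<cdot> B \<cdot> A' \<cdot> B' - id = ?C \<cdot> (id + U)"
    unfolding unipotent_commutator[OF assms(1,2)] by (simp add: U_def)
  also have "\<dots> = ?C + ?C \<cdot> U"
  proof -
    show ?thesis using comp_plus_right[OF lowers_additive[OF C], of id U] by simp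
  qed
  finally have 1: "A \<cdot> B \<cdot> A' \<cdot> B' - id - (a \<cdot> b - b \<cdot> a) = (?C - (a \<cdot> b - b \<cdot> a)) + ?C \<cdot> U"
    by simp
  have add: "additive a" "additive b" "additive a'" "additive b'"
    using assms ab' lowers_additive by blast+
  have 2: "?C - (a \<cdot> b - b \<cdot> a) = (a \<cdot> b' + a' \<cdot> b + a' \<cdot> b') - (b \<cdot> a' + b' \<cdot> a + b' \<cdot> a')"
    unfolding ab using add by (simp add: comp_plus_left comp_plus_right)
  show ?thesis
    unfolding 1 2
  proof (intro lowers_plus lowers_minus)
    show "lowers (Suc (i + j)) (?C \<cdot> U)"
      using lowers_comp[OF C U] by simp
  qed (use assms ab' in \<open>auto intro: lowers_comp[of i _ "Suc j"] lowers_comp[of "Suc i" _ j] lowers_comp[of "Suc i" _ "Suc j"]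
      lowers_comp[of j _ "Suc i"] lowers_comp[of "Suc j" _ i] lowers_comp[of "Suc j" _ "Suc i"]\<close>)
qed

section \<open>The Magnus homomorphism and the depth of an element\<close>

locale magnus = generated_group G B x
  for G (structure) and B :: "'x set" and x +
  fixes c :: nat and \<mu> :: "'a \<Rightarrow> 'x operator"
  assumes mu_hom: "\<mu> \<in> hom G unipotent_group"
    and mu_gen: "\<And>b. b \<in> B \<Longrightarrow> \<mu> (x b) = id + shift_op c b"
begin

sublocale mu: group_hom G unipotent_group \<mu>
  by (intro group_hom.intro group_unipotent group_axioms group_hom_axioms.intro mu_hom)

declare mu.hom_mult [simp del] mu.hom_inv [simp del] mu.hom_one [simp del]

lemma mu_mult: "g \<in> carrier G \<Longrightarrow> h \<in> carrier G \<Longrightarrow> \<mu> (g \<otimes> h) = \<mu> g \<cdot> \<mu> h"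
  using mu.hom_mult by (simp add: unipotent_group_def)

lemma mu_one: "\<mu> \<one> = id"
  using mu.hom_one by (simp add: unipotent_group_def)

lemma mu_inverse: "g \<in> carrier G \<Longrightarrow> inverse_ops (\<mu> g) (\<mu> (inv g))"
proof -
  assume g: "g \<in> carrier G"
  have "lowers 1 (\<mu> h - id)" if "h \<in> carrier G" for h
    using mu.hom_closed[OF that] by (auto simp: unipotent_group_def inverse_ops_def)
  then show ?thesis
    using g mu_mult[of g "inv g"] mu_mult[of "inv g" g] by (simp add: inverse_ops_def mu_one)
qed

lemma mu_gcomm:
  "g \<in> carrier G \<Longrightarrow> h \<in> carrier G \<Longrightarrow> \<mu> (gcomm g h) = \<mu> g \<cdot> \<mu> h \<cdot> \<mu> (inv g) \<cdot> \<mu> (inv h)"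
  by (simp add: gcomm_def mu_mult)

lemma mu_lowers: "g \<in> carrier G \<Longrightarrow> lowers 1 (\<mu> g - id)" "g \<in> carrier G \<Longrightarrow> lowers 0 (\<mu> g)"
  using mu_inverse lowers_0_of_unipotent by (auto simp: inverse_ops_def)

lemma mu_lead_mult:
  assumes "g \<in> carrier G" "h \<in> carrier G" "n > 0" "lowers n a" "lowers n b"
    "lowers (Suc n) (\<mu> g - id - a)" "lowers (Suc n) (\<mu> h - id - b)"
  shows "lowers (Suc n) (\<mu> (g \<otimes> h) - id - (a + b))"
proof -
  define b' where "b' = \<mu> h - id - b"
  have "lowers n (\<mu> g - id)"
    using lowers_plus[OF assms(4) lowers_mono[OF assms(6), of n]] by simp
  moreover have "lowers n (\<mu> h - id)"
    using lowers_plus[OF assms(5) lowers_mono[OF assms(7), of n]] by simp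
  moreover have *: "\<mu> (g \<otimes> h) - id - (a + b) = (\<mu> g - id - a) + (\<mu> h - id - b) + (\<mu> g - id) \<cdot> (\<mu> h - id)"
    using mu_mult[OF assms(1,2)] lowers_additive[OF mu_lowers(2)[OF assms(1)]]
    by (simp add: comp_minus_left comp_minus_right)
  ultimately show ?thesis
    unfolding * using assms by (intro lowers_plus lowers_comp[of n _ n]) auto
qed

lemma mu_lead_inv:
  assumes "g \<in> carrier G" "n > 0" "lowers n a" "lowers (Suc n) (\<mu> g - id - a)"
  shows "lowers (Suc n) (\<mu> (inv g) - id - (- a))"
proof -
  have g: "lowers n (\<mu> g - id)"
    using lowers_plus[OF assms(3) lowers_mono[OF assms(4), of n]] by simp
  have "(\<mu> g - id) \<cdot> (\<mu> (inv g) - id) = id - \<mu> g - \<mu> (inv g) + id"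
    using mu_inverse[OF assms(1)] lowers_additive[OF mu_lowers(2)[OF assms(1)]]
    by (simp add: comp_minus_left comp_minus_right inverse_ops_def)
  then have *: "\<mu> (inv g) - id - (- a) = - (\<mu> g - id - a) - (\<mu> g - id) \<cdot> (\<mu> (inv g) - id)"
    by (simp add: algebra_simps)
  show ?thesis
    unfolding * by (rule lowers_minus[OF lowers_uminus[OF assms(4)] lowers_comp[OF g mu_lowers(1)]]) (use assms in auto)
qed

text \<open>The elements with \<open>lowers n (\<mu> g - id)\<close> form a subgroup, and
  commutators add degrees. This is the easy half of Magnus' theorem; the other half rests on
  \<open>word_prod_eq_one\<close>.\<close>

lemma mu_lower_central: "n > 0 \<Longrightarrow> g \<in> \<gamma> n \<Longrightarrow> lowers n (\<mu> g - id)"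
proof (induction n arbitrary: g rule: nat_induct_non_zero)
  case (Suc n)
  let ?H = "{g \<in> carrier G. lowers (Suc n) (\<mu> g - id)}"
  have "subgroup ?H G"
  proof
    fix g h assume "g \<in> ?H" "h \<in> ?H"
    then show "g \<otimes> h \<in> ?H"
      using mu_lead_mult[OF _ _ Suc.hyps lowers_zero lowers_zero, of g h] by simp
  next
    fix g assume "g \<in> ?H"
    then show "inv g \<in> ?H"
      using mu_lead_inv[OF _ Suc.hyps lowers_zero, of g] by simp
  qed (use lowers_zero mu_one in auto)
  moreover have "gcomm u h \<in> ?H" if u: "u \<in> \<gamma> n" and h: "h \<in> carrier G" for u h
    using lowers_commutator[OF mu_inverse mu_inverse Suc.IH[OF u] mu_lowers(1)[OF h]] u h lower_central_closed
    by (auto simp: mu_gcomm)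
  ultimately have "\<gamma> (Suc n) \<subseteq> ?H"
    using Suc.hyps by (intro lower_central_least) auto
  then show ?case using Suc.prems by blast
qed (use mu_lowers in auto)

lemma lowers_word_op: "w \<noteq> [] \<Longrightarrow> lowers (length w) (word_op (shift_op c) w)"
proof (induction w rule: induct_list012)
  case (2 a)
  then show ?case using lowers_shift[of c a] by (simp add: fun_eq_iff[symmetric])
next
  case (3 b a w)
  let ?A = "word_op (shift_op c) (a # w)"
  have *: "word_op (shift_op c) (b # a # w) = ?A \<cdot> shift_op c b - shift_op c b \<cdot> ?A"
    by (auto simp: fun_eq_iff)
  show ?case
    unfolding * using 3(2)
    by (intro lowers_minus lowers_comp[OF _ lowers_shift] lowers_comp[OF lowers_shift]) auto
qed simp

lemma mu_lnc:
  "w \<noteq> [] \<Longrightarrow> set w \<subseteq> B \<Longrightarrow> lowers (Suc (length w)) (\<mu> (lnc x w) - id - word_op (shift_op c) w)"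
proof (induction w rule: induct_list012)
  case (2 a)
  have "word_op (shift_op c) [a] = shift_op c a" by (auto simp: fun_eq_iff)
  then show ?case using mu_gen[of a] 2 lowers_zero by simp
next
  case (3 b a w)
  let ?A = "word_op (shift_op c) (a # w)"
  have *: "word_op (shift_op c) (b # a # w) = ?A \<cdot> shift_op c b - shift_op c b \<cdot> ?A"
    by (auto simp: fun_eq_iff)
  have "lowers (Suc (length (a # w) + 1)) (\<mu> (lnc x (a # w)) \<cdot> \<mu> (x b) \<cdot> \<mu> (inv (lnc x (a # w))) \<cdot> \<mu> (inv (x b)) - id
     - (?A \<cdot> shift_op c b - shift_op c b \<cdot> ?A))"
  proof (rule lead_commutator[OF mu_inverse mu_inverse lowers_word_op lowers_shift])
    show "lowers (Suc (length (a # w))) (\<mu> (lnc x (a # w)) - id - ?A)"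
      by (rule 3(2)) (use 3(4) in auto)
    show "lowers (Suc 1) (\<mu> (x b) - id - shift_op c b)"
      using mu_gen[of b] 3 lowers_zero by simp
  qed auto
  moreover have "\<mu> (lnc x (b # a # w)) = \<mu> (lnc x (a # w)) \<cdot> \<mu> (x b) \<cdot> \<mu> (inv (lnc x (a # w))) \<cdot> \<mu> (inv (x b))"
    by (simp add: mu_gcomm)
  ultimately show ?case unfolding * by (simp only: length_Cons add_Suc_right add_0_right One_nat_def)
qed simp

lemma mu_word_prod:
  "words n xs \<Longrightarrow> n > 0 \<Longrightarrow> lowers n (signed_sum (word_op (shift_op c)) xs) \<and>
     lowers (Suc n) (\<mu> (word_prod x xs) - id - signed_sum (word_op (shift_op c)) xs)"
proof (induction xs)
  case (Cons y xs)
  obtain s w where y: "y = (s, w)" by (cases y)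
  have w: "length w = n" "set w \<subseteq> B" "w \<noteq> []" using Cons.prems y by auto
  let ?a = "word_op (shift_op c) w"
  have a: "lowers n ?a" using lowers_word_op w by blast
  then have sa: "lowers n (if s then - ?a else ?a)" using lowers_uminus by auto
  have l: "lowers (Suc n) (\<mu> (lnc x w) - id - ?a)" using mu_lnc w by blast
  have sl: "lowers (Suc n) (\<mu> (signed s (lnc x w)) - id - (if s then - ?a else ?a))"
    using mu_lead_inv[OF lnc_closed Cons.prems(2) a l] l by (cases s) (simp_all only: signed_def if_True if_False)
  have IH: "lowers n (signed_sum (word_op (shift_op c)) xs)"
    "lowers (Suc n) (\<mu> (word_prod x xs) - id - signed_sum (word_op (shift_op c)) xs)"
    using Cons.IH[OF _ Cons.prems(2)] Cons.prems(1) unfolding y words_simps by blast+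
  show ?case
    unfolding y signed_sum_simps word_prod_simps
    by (intro conjI lowers_plus[OF sa IH(1)] mu_lead_mult[OF _ _ Cons.prems(2) sa IH(1) sl IH(2)]) auto
qed (simp add: lowers_zero mu_one)

text \<open>By \<open>mu_word_prod\<close> the leading part of the product is its Lie element of
  degree \<open>n\<close>, which has to vanish if the product lies deeper. For
  \<open>n \<le> c\<close> the truncation of the shifts is not felt.\<close>

lemma word_pairing_eq_zero:
  assumes "words n xs" "n > 0" "n \<le> c" "word_prod x xs \<in> \<gamma> (Suc n)"
  shows "signed_sum (\<lambda>w. word_pairing w g) xs = 0"
proof -
  \<comment> \<open>Cutting \<open>g\<close> off above length \<open>n\<close> gives a functional
    that every operator lowering the degree by \<open>n + 1\<close> kills; words of length
    \<open>n\<close> do not see the cut.\<close>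
  let ?S = "signed_sum (word_op (shift_op c)) xs" and ?h = "\<lambda>u. if length u \<le> n then g u else 0"
  have "lowers (Suc n) ((\<mu> (word_prod x xs) - id) - (\<mu> (word_prod x xs) - id - ?S))"
    using lowers_minus[OF mu_lower_central[OF _ assms(4)] conjunct2[OF mu_word_prod[OF assms(1,2)]]] by simp
  then have "lowers (Suc n) ?S" by simp
  moreover have "vanishes (Suc n) ?h" by (auto simp: vanishes_def)
  ultimately have "vanishes (Suc n - Suc n) (?S ?h)" unfolding lowers_def by blast
  then have "?S ?h [] = 0" by (simp add: vanishes_def)
  moreover have "additive (\<lambda>A :: 'x operator. A ?h [])" by (simp add: additive_def)
  ultimately have 0: "signed_sum (\<lambda>w. word_op (shift_op c) w ?h []) xs = 0"
    using signed_sum_additive[of "\<lambda>A :: 'x operator. A ?h []" "word_op (shift_op c)" xs] by simp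
  have "word_op (shift_op c) w ?h [] = word_pairing w g" if "length w = n" for w
  proof -
    have fold: "length u + length v \<le> c \<Longrightarrow> fold (shift_op c) u h v = h (u @ v)" for u v h
      by (induction u arbitrary: h) (auto simp: shift_op_def)
    have "word_op (shift_op c) w ?h [] = word_pairing w (\<lambda>u. fold (shift_op c) u ?h [])"
      by (rule word_pairing_fold[symmetric, of "\<lambda>h. h []"]) (simp add: additive_def, rule lowers_additive[OF lowers_shift])
    also have "\<dots> = word_pairing w g"
    proof (rule word_pairing_cong_mset)
      fix u assume "mset u = mset w"
      then have "length u = n" using that by (metis size_mset)
      then show "fold (shift_op c) u ?h [] = g u" using fold[of u "[]"] assms(3) by simp
    qed
    finally show ?thesis .
  qed
  then have "signed_sum (\<lambda>w. word_op (shift_op c) w ?h []) ys = signed_sum (\<lambda>w. word_pairing w g) ys"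
    if "words n ys" for ys
    using that by (induction ys) auto
  then show ?thesis using 0 assms(1) by simp
qed

text \<open>Modulo \<gamma> (k + 1) the element \<open>z\<close> involves finitely many letters, so
  some generator \<open>b\<close> is foreign to it. Bracketing with a foreign letter loses nothing:
  the coefficients of the words ending in \<open>b\<close> are those of \<open>z\<close> up to sign.
  Hence the Lie element of \<open>z\<close> vanishes and \<open>word_prod_eq_one\<close>
  applies.\<close>

lemma commuting_lower_central_Suc:
  assumes "infinite B" "0 < k" "k < c" "z \<in> \<gamma> k"
    and comm: "\<And>b. b \<in> B \<Longrightarrow> gcomm z (x b) \<in> \<gamma> (k + 2)"
  shows "z \<in> \<gamma> (Suc k)"
proof -
  obtain xs where xs: "words k xs" "lcong (Suc k) z (word_prod x xs)"
    using lower_central_words[OF assms(2,4)] by blast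
  have "finite (\<Union>(s, w)\<in>set xs. set w)" by auto
  then obtain b where b: "b \<in> B" "b \<notin> (\<Union>(s, w)\<in>set xs. set w)"
    using assms(1) by (meson finite_subset subsetI)
  let ?ys = "map (\<lambda>(s, w). (s, b # w)) xs"
  have ys: "words (Suc k) ?ys" using xs(1) b(1) by (fastforce simp: words_def)
  have "lcong (k + 2) (gcomm z (x b)) (gcomm (word_prod x xs) (x b))"
    using xs assms(2) by (intro lcong_gcomm_left[of k 1]) auto
  also have "lcong (k + 2) (gcomm (word_prod x xs) (x b)) (word_prod x ?ys)"
    using word_prod_gcomm[OF words_homogeneous[OF xs(1) assms(2)] assms(2), of b] by simp
  finally have "word_prod x ?ys \<in> \<gamma> (Suc (Suc k))"
    using comm[OF b(1)] lcong_lower_central[of "k + 2" _ _ "k + 2"] by simp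
  then have 0: "signed_sum (\<lambda>w. word_pairing w g) ?ys = 0" for g
    using assms(3) by (intro word_pairing_eq_zero[OF ys]) auto
  have pair: "signed_sum (\<lambda>w. word_pairing w g) xs = 0" for g
  proof -
    \<comment> \<open>Expanding \<open>b # w\<close> gives terms \<open>b u\<close> and
      \<open>- u b\<close>; only the latter end in \<open>b\<close>, whence the sign in
      \<open>?g\<close>.\<close>
    let ?g = "\<lambda>v. if v \<noteq> [] \<and> last v = b then - g (butlast v) else 0"
    have *: "word_pairing (b # w) ?g = word_pairing w g" if "w \<noteq> []" "b \<notin> set w" for w
    proof -
      have "word_pairing (b # w) ?g = word_pairing w (\<lambda>u. ?g (b # u) - ?g (u @ [b]))"
        using that(1) by (cases w) simp_all
      also have "\<dots> = word_pairing w g"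
      proof (rule word_pairing_cong_mset)
        fix u assume u: "mset u = mset w"
        then have "u \<noteq> []" "set u = set w" using that(1) mset_eq_setD by auto
        then have "last (b # u) \<noteq> b" using that(2) by (metis last_ConsR last_in_set)
        then show "?g (b # u) - ?g (u @ [b]) = g u" by simp
      qed
      finally show ?thesis .
    qed
    have "signed_sum (\<lambda>w. word_pairing w ?g) (map (\<lambda>(s, w). (s, b # w)) zs) = signed_sum (\<lambda>w. word_pairing w g) zs"
      if "set zs \<subseteq> set xs" for zs
      using that
    proof (induction zs)
      case (Cons y zs)
      obtain s w where y: "y = (s, w)" by (cases y)
      then have "w \<noteq> []" "b \<notin> set w"
        using Cons.prems xs(1) assms(2) b(2) by (auto simp: words_def)
      then have "word_pairing (b # w) ?g = word_pairing w g" by (rule *)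
      then show ?case using Cons unfolding y by (simp del: word_pairing.simps)
    qed simp
    then show ?thesis using 0[of ?g] by simp
  qed
  \<comment> \<open>\<open>word_prod_eq_one\<close> speaks of the type \<open>letter\<close>, so the
    generators are renamed to \<open>Base b 0\<close>; at all other letters any group element will
    do.\<close>
  define f where "f = (\<lambda>l. case l of Base b i \<Rightarrow> x b | Der l i \<Rightarrow> \<one>)"
  interpret L: weighted_letters G f "\<lambda>_. Suc 0"
    by unfold_locales (auto simp: f_def split: letter.split)
  let ?\<phi> = "\<lambda>b. Base b 0"
  let ?zs = "map (\<lambda>(s, w). (s, map ?\<phi> w)) xs"
  have lnc: "lnc f (map ?\<phi> w) = lnc x w" for w
    by (induction w rule: induct_list012) (auto simp: f_def)
  have pmap: "word_pairing (map ?\<phi> w) g = word_pairing w (\<lambda>u. g (map ?\<phi> u))" for w and g :: "'x letter list \<Rightarrow> int"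
    by (induction w arbitrary: g rule: induct_list012) auto
  have smap: "signed_sum F (map (\<lambda>(s, w). (s, map ?\<phi> w)) ys) = signed_sum (\<lambda>w. F (map ?\<phi> w)) ys"
    for F :: "'x letter list \<Rightarrow> int" and ys
    by (induction ys) auto
  have "word_prod f ?zs \<in> \<gamma> (Suc k)"
  proof (rule word_prod_eq_one[where m = k])
    show "weighted_letters G f (\<lambda>_. Suc 0)" ..
    show "L.homogeneous k ?zs"
      using xs(1) assms(2) by (fastforce simp: L.homogeneous_def words_def sum_list_triv)
    show "length w = k" if "(s, w) \<in> set ?zs" for s w
      using that xs(1) by (fastforce simp: words_def)
    show "signed_sum (\<lambda>w. word_pairing w g) ?zs = 0" for g
      unfolding smap pmap by (rule pair)
  qed (use assms in auto)
  moreover have "word_prod f (map (\<lambda>(s, w). (s, map ?\<phi> w)) ys) = word_prod x ys" for ys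
    by (induction ys) (auto simp: lnc)
  ultimately show ?thesis using xs(2) lcong_lower_central lcong_sym by (metis order_refl)
qed

lemma commuting_lower_central:
  assumes "infinite B" "z \<in> carrier G" "\<And>b. b \<in> B \<Longrightarrow> gcomm z (x b) \<in> \<gamma> (Suc c)"
  shows "z \<in> \<gamma> c"
proof -
  have "k \<le> c \<Longrightarrow> z \<in> \<gamma> k" for k
  proof (induction k)
    case (Suc k)
    show ?case
    proof (cases "k = 0")
      case False
      then show ?thesis
        using Suc assms(3) lower_centralD[of _ "Suc c" "k + 2"]
        by (intro commuting_lower_central_Suc assms(1)) auto
    qed (simp add: assms(2))
  qed (simp add: assms(2))
  then show ?thesis by simp
qed

end

text \<open>\<open>generated_group\<close> asks for \<open>x b\<close> in the carrier for every
  \<open>b\<close>; off the basis the neutral element \<open>[]\<close> serves.\<close>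

lemma generated_free_group:
  "generated_group (free_group B) B (\<lambda>b. if b \<in> B then [(False, b)] else [])"
  (is "generated_group ?F B ?x")
proof -
  interpret F: group ?F by (rule group_free_group)
  have x: "?x b \<in> carrier ?F" for b by (auto simp: free_group_def reduced_def)
  have "w \<in> generate ?F (?x ` B)" if "w \<in> carrier ?F" for w
    using that
  proof (induction w)
    case Nil
    then show ?case using generate.one[of ?F] by (simp add: free_group_def)
  next
    case (Cons l w)
    have w: "w \<in> carrier ?F" "snd l \<in> B"
      using Cons.prems by (auto simp: free_group_def reduced_Cons)
    have "l # w = [l] \<otimes>\<^bsub>?F\<^esub> w"
      using Cons.prems by (cases w) (auto simp: free_group_def reduced_Cons)
    moreover have "[l] \<in> generate ?F (?x ` B)"
    proof (cases l)
      case (Pair s b)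
      have b: "b \<in> B" using w(2) Pair by simp
      have pos: "[(False, b)] \<in> generate ?F (?x ` B)"
        using b by (intro generate.incl) (auto intro!: image_eqI[of _ _ b])
      have "[(True, b)] \<otimes>\<^bsub>?F\<^esub> ?x b = \<one>\<^bsub>?F\<^esub>" "[(True, b)] \<in> carrier ?F"
        using b by (auto simp: free_group_def flip_letter_def reduced_def)
      then have "inv\<^bsub>?F\<^esub> ?x b = [(True, b)]" by (intro F.inv_equality x)
      then have "[(True, b)] \<in> generate ?F (?x ` B)"
        using generate.inv[of "?x b" "?x ` B" ?F] b by simp
      then show ?thesis using pos Pair by (cases s) auto
    qed
    ultimately show ?case using generate.eng[OF _ Cons.IH[OF w(1)], of "[l]"] by (simp only:)
  qed
  then show ?thesis
    using x by unfold_locales auto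
qed

text \<open>The centre of the free group modulo \<gamma> (c + 1), lifted to the free group. The
  universal property supplies the Magnus homomorphism, truncated at the same
  \<open>c\<close>.\<close>

theorem free_group_commuting_lower_central:
  assumes "infinite B" "z \<in> carrier (free_group B)"
    and "\<And>b. b \<in> B \<Longrightarrow> group.gcomm (free_group B) z [(False, b)] \<in> lower_central (free_group B) (Suc c)"
  shows "z \<in> lower_central (free_group B) c"
proof -
  let ?F = "free_group B" and ?x = "\<lambda>b. if b \<in> B then [(False, b)] else []"
  interpret F: group ?F by (rule group_free_group)
  interpret U: group "unipotent_group :: 'a operator monoid" by (rule group_unipotent)
  have "(\<lambda>b. id + shift_op c b) \<in> B \<rightarrow> carrier unipotent_group"
    proof
    show "id + shift_op c b \<in> carrier unipotent_group" for b :: 'a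
      unfolding unipotent_group_def using shift_unipotent[of c b] by (simp only: monoid.simps partial_object.simps) blast
  qed
  from U.free_group_universal[OF this] obtain \<mu> where
    "\<mu> \<in> hom ?F unipotent_group" "\<And>b. b \<in> B \<Longrightarrow> \<mu> [(False, b)] = id + shift_op c b" by auto
  then interpret magnus ?F B ?x c \<mu>
    by (intro magnus.intro generated_free_group magnus_axioms.intro) auto
  show ?thesis using assms by (intro commuting_lower_central) auto
qed

section \<open>Free nilpotent groups\<close>

context group_hom
begin

lemma image_commutator_subgroup:
  assumes "A \<subseteq> carrier G" "K \<subseteq> carrier G"
  shows "h ` commutator_subgroup G A K = commutator_subgroup H (h ` A) (h ` K)"
proof -
  let ?S = "\<Union>a\<in>A. \<Union>k\<in>K. {a \<otimes> k \<otimes> inv a \<otimes> inv k}"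
  have "?S \<subseteq> carrier G" using assms by (auto simp: subset_iff)
  moreover have "h (a \<otimes> k \<otimes> inv a \<otimes> inv k) = h a \<otimes>\<^bsub>H\<^esub> h k \<otimes>\<^bsub>H\<^esub> inv\<^bsub>H\<^esub> (h a) \<otimes>\<^bsub>H\<^esub> inv\<^bsub>H\<^esub> (h k)"
    if "a \<in> A" "k \<in> K" for a k
    using that assms by (simp add: subset_iff)
  then have "h ` ?S = (\<Union>a\<in>h ` A. \<Union>k\<in>h ` K. {a \<otimes>\<^bsub>H\<^esub> k \<otimes>\<^bsub>H\<^esub> inv\<^bsub>H\<^esub> a \<otimes>\<^bsub>H\<^esub> inv\<^bsub>H\<^esub> k})"
    by (simp add: image_UN)
  ultimately show ?thesis
    unfolding commutator_subgroup_def using generate_img[of ?S] by simp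
qed

lemma image_lower_central: "h ` lower_central G n \<subseteq> lower_central H n"
proof (induction n)
  case (Suc n)
  show ?case
  proof (cases n)
    case (Suc k)
    have "h ` lower_central G (Suc n) = commutator_subgroup H (h ` lower_central G n) (h ` carrier G)"
      using image_commutator_subgroup[OF G.lower_central_subset order_refl] Suc by simp
    also have "\<dots> \<subseteq> commutator_subgroup H (lower_central H n) (carrier H)"
      unfolding commutator_subgroup_def using Suc.IH by (intro mono_generate) fastforce
    finally show ?thesis using Suc by simp
  qed auto
qed auto

lemma image_lower_central_surj:
  assumes "h ` carrier G = carrier H"
  shows "h ` lower_central G n = lower_central H n"
proof (induction n)
  case (Suc n)
  then show ?case
    by (cases n) (simp_all add: image_commutator_subgroup G.lower_central_subset assms)
qed (simp add: assms)

end

text \<open>Relative freeness enters as the extension of maps from the basis, and Magnus' theorem as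
  \<open>central\<close>.\<close>

locale free_nilpotent = generated_group G B x
  for G :: "('a, 'm) monoid_scheme" (structure) and B :: "'x set" and x +
  fixes c :: nat
  assumes class_ge_2: "c \<ge> 2"
    and infinite_basis: "infinite B"
    and nilpotent: "\<gamma> (Suc c) = {\<one>}"
    and extension: "\<And>f. (\<And>b. b \<in> B \<Longrightarrow> f b \<in> carrier G) \<Longrightarrow> \<exists>h \<in> hom G G. \<forall>b\<in>B. h (x b) = f b"
    and central: "\<And>z. z \<in> carrier G \<Longrightarrow> (\<And>g. g \<in> carrier G \<Longrightarrow> z \<otimes> g = g \<otimes> z) \<Longrightarrow> z \<in> \<gamma> c"

theorem free_nilpotent_group_free_nilpotent:
  fixes N :: "('a, 'm) monoid_scheme" and B :: "'b set"
  assumes "c \<ge> 2" "infinite B" "free_nilpotent_group B c N"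
  shows "\<exists>x. free_nilpotent N B x c"
proof -
  let ?F = "free_group B" and ?y = "\<lambda>b. if b \<in> B then [(False, b)] else []"
  let ?L = "lower_central (free_group B) (c + 1)"
  interpret N: group N using assms(3) by (simp add: free_nilpotent_group_def)
  interpret F: generated_group ?F B ?y by (rule generated_free_group)
  interpret L: normal ?L ?F by (rule F.normal_lower_central)
  obtain \<phi> where \<phi>: "\<phi> \<in> Group.iso N (?F Mod ?L)"
    using assms(3) by (auto simp: free_nilpotent_group_def is_iso_def)
  define \<psi> where "\<psi> = inv_into (carrier N) \<phi>"
  have \<psi>: "\<psi> \<in> hom (?F Mod ?L) N" "bij_betw \<psi> (carrier (?F Mod ?L)) (carrier N)"
    using N.iso_set_sym[OF \<phi>] by (auto simp: \<psi>_def Group.iso_def)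
  define p where "p = \<psi> \<circ> (\<lambda>w. ?L #>\<^bsub>?F\<^esub> w)"
  have "p \<in> hom ?F N"
    unfolding p_def by (rule Group.hom_compose[OF L.r_coset_hom_Mod \<psi>(1)])
  then interpret p: group_hom ?F N p by unfold_locales
  have surj: "p ` carrier ?F = carrier N"
    using \<psi>(2) unfolding p_def by (simp only: image_comp[symmetric] bij_betw_def carrier_FactGroup)
  have ker: "w \<in> ?L" if "w \<in> carrier ?F" "p w = \<one>\<^bsub>N\<^esub>" for w
  proof -
    have "p w = p \<one>\<^bsub>?F\<^esub>" using that by simp
    then have "?L #>\<^bsub>?F\<^esub> w = ?L #>\<^bsub>?F\<^esub> \<one>\<^bsub>?F\<^esub>"
      using \<psi>(2) that(1) F.one_closed by (auto simp: p_def bij_betw_def carrier_FactGroup dest: inj_onD)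
    then show ?thesis
      using that(1) F.rcos_self[OF that(1) L.subgroup_axioms] F.coset_mult_one[OF L.subset] by simp
  qed
  have "p ` ?L = lower_central N (Suc c)"
    using p.image_lower_central_surj[OF surj, of "Suc c"] by simp
  moreover have "p ` ?L = {\<one>\<^bsub>N\<^esub>}"
  proof -
    have "p w = \<one>\<^bsub>N\<^esub>" if "w \<in> ?L" for w
    proof -
      have "?L #>\<^bsub>?F\<^esub> w = ?L #>\<^bsub>?F\<^esub> \<one>\<^bsub>?F\<^esub>"
        using that F.coset_mult_one[OF L.subset] F.coset_join2[OF _ L.subgroup_axioms that] L.subset by auto
      then have "p w = p \<one>\<^bsub>?F\<^esub>" by (simp add: p_def)
      then show ?thesis by simp
    qed
    moreover have "\<one>\<^bsub>N\<^esub> \<in> p ` ?L" using imageI[OF L.one_closed, of p] unfolding p.hom_one .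
    ultimately show ?thesis by auto
  qed
  ultimately have nil: "lower_central N (Suc c) = {\<one>\<^bsub>N\<^esub>}" by simp
  let ?x = "\<lambda>b. p (?y b)"
  have "free_nilpotent N B ?x c"
  proof unfold_locales
    show "?x b \<in> carrier N" for b using F.gen_closed[of b] p.hom_closed by blast
    show "carrier N \<subseteq> generate N (?x ` B)"
    proof -
      have "carrier N \<subseteq> p ` generate ?F (?y ` B)" using surj F.generating by blast
      also have "\<dots> = generate N (p ` ?y ` B)"
        using p.generate_img[of "?y ` B"] F.gen_closed by blast
      finally show ?thesis by (simp only: image_image)
    qed
    show "\<exists>h\<in>hom N N. \<forall>b\<in>B. h (?x b) = f b" if f: "\<And>b. b \<in> B \<Longrightarrow> f b \<in> carrier N" for f
    proof -
      obtain k where k: "k \<in> hom ?F N" "\<And>b. b \<in> B \<Longrightarrow> k [(False, b)] = f b"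
        using N.free_group_universal[of f B] f by auto
      interpret k: group_hom ?F N k by unfold_locales (rule k(1))
      \<comment> \<open>\<open>k\<close> is pushed down along \<open>p\<close> by choosing
        preimages. Two preimages differ by an element of \<gamma> (c + 1), which \<open>k\<close>
        sends into \<gamma> (c + 1) of \<open>N\<close>, that is, to the neutral element.\<close>
      define h where "h = (\<lambda>g. k (SOME w. w \<in> carrier ?F \<and> p w = g))"
      have h: "h (p w) = k w" if w: "w \<in> carrier ?F" for w
      proof -
        define v where "v = (SOME v. v \<in> carrier ?F \<and> p v = p w)"
        have v: "v \<in> carrier ?F" "p v = p w"
          using someI[of "\<lambda>v. v \<in> carrier ?F \<and> p v = p w" w] w by (auto simp: v_def)
        then have "inv\<^bsub>?F\<^esub> w \<otimes>\<^bsub>?F\<^esub> v \<in> ?L" using w by (intro ker) auto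
        then have "k (inv\<^bsub>?F\<^esub> w \<otimes>\<^bsub>?F\<^esub> v) \<in> lower_central N (Suc c)"
          using k.image_lower_central[of "Suc c"] by auto
        then have "inv\<^bsub>N\<^esub> (k w) \<otimes>\<^bsub>N\<^esub> k v = \<one>\<^bsub>N\<^esub>" using w v nil by simp
        then have "k v = k w"
          using w v by (metis N.inv_solve_left N.r_one N.one_closed k.hom_closed)
        then show ?thesis by (simp add: h_def v_def)
      qed
      have "h \<in> hom N N"
      proof (rule homI)
        fix g assume "g \<in> carrier N"
        then obtain w where "w \<in> carrier ?F" "g = p w" using surj by blast
        then show "h g \<in> carrier N" using h by simp
      next
        fix g g' assume "g \<in> carrier N" "g' \<in> carrier N"
        then obtain w w' where w: "w \<in> carrier ?F" "g = p w" "w' \<in> carrier ?F" "g' = p w'" using surj by blast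
        then have "h (g \<otimes>\<^bsub>N\<^esub> g') = h (p (w \<otimes>\<^bsub>?F\<^esub> w'))" by simp
        also have "\<dots> = k w \<otimes>\<^bsub>N\<^esub> k w'" using w by (subst h) auto
        finally show "h (g \<otimes>\<^bsub>N\<^esub> g') = h g \<otimes>\<^bsub>N\<^esub> h g'" using w h by simp
      qed
      moreover have "h (?x b) = f b" if "b \<in> B" for b
        using that k(2) h[of "?y b"] F.gen_closed[of b] by simp
      ultimately show ?thesis by blast
    qed
    show "z \<in> lower_central N c" if z: "z \<in> carrier N" "\<And>g. g \<in> carrier N \<Longrightarrow> z \<otimes>\<^bsub>N\<^esub> g = g \<otimes>\<^bsub>N\<^esub> z" for z
    proof -
      obtain w where w: "w \<in> carrier ?F" "z = p w" using z(1) surj by blast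
      have "F.gcomm w [(False, b)] \<in> lower_central ?F (Suc c)" if "b \<in> B" for b
      proof -
        have y: "[(False, b)] \<in> carrier ?F" using F.gen_closed[of b] that by simp
        have "p (F.gcomm w [(False, b)]) = z \<otimes>\<^bsub>N\<^esub> p [(False, b)] \<otimes>\<^bsub>N\<^esub> inv\<^bsub>N\<^esub> z \<otimes>\<^bsub>N\<^esub> inv\<^bsub>N\<^esub> (p [(False, b)])"
          using w y by (simp add: F.gcomm_def)
        also have "\<dots> = \<one>\<^bsub>N\<^esub>"
          using z y by (simp add: N.group_word_simps)
        finally show ?thesis using ker[of "F.gcomm w [(False, b)]"] w y by simp
      qed
      then have "w \<in> lower_central ?F c"
        using free_group_commuting_lower_central[OF assms(2) w(1)] by blast
      then show ?thesis using w(2) p.image_lower_central by blast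
    qed
  qed (use assms nil in auto)
  then show ?thesis by blast
qed

section \<open>Automorphisms acting trivially modulo the lower central series\<close>

lemma carrier_AutoGroup [simp]: "carrier (AutoGroup G) = auto G"
  by (simp add: AutoGroup_def)

lemma mult_AutoGroup [simp]:
  "\<alpha> \<in> auto G \<Longrightarrow> \<beta> \<in> auto G \<Longrightarrow> \<alpha> \<otimes>\<^bsub>AutoGroup G\<^esub> \<beta> = compose (carrier G) \<alpha> \<beta>"
  by (simp add: AutoGroup_def BijGroup_def auto_def)

context group
begin

lemma auto_group_hom: "\<alpha> \<in> auto G \<Longrightarrow> group_hom G G \<alpha>"
  by (simp add: auto_def group_hom_def group_hom_axioms_def)

lemma auto_closed [simp]: "\<alpha> \<in> auto G \<Longrightarrow> g \<in> carrier G \<Longrightarrow> \<alpha> g \<in> carrier G"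
  using group_hom.hom_closed[OF auto_group_hom] .

lemma auto_mult: "\<alpha> \<in> auto G \<Longrightarrow> g \<in> carrier G \<Longrightarrow> h \<in> carrier G \<Longrightarrow> \<alpha> (g \<otimes> h) = \<alpha> g \<otimes> \<alpha> h"
  using group_hom.hom_mult[OF auto_group_hom] .

lemma auto_inv: "\<alpha> \<in> auto G \<Longrightarrow> g \<in> carrier G \<Longrightarrow> \<alpha> (inv g) = inv (\<alpha> g)"
  using group_hom.hom_inv[OF auto_group_hom] .

lemma auto_one [simp]: "\<alpha> \<in> auto G \<Longrightarrow> \<alpha> \<one> = \<one>"
  using group_hom.hom_one[OF auto_group_hom] .

lemma hom_gcomm:
  assumes "h \<in> hom G G" "g \<in> carrier G" "k \<in> carrier G"
  shows "h (gcomm g k) = gcomm (h g) (h k)"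
proof -
  interpret h: group_hom G G h by unfold_locales fact
  show ?thesis using assms(2,3) by (simp add: gcomm_def)
qed

lemma auto_gcomm:
  "\<alpha> \<in> auto G \<Longrightarrow> g \<in> carrier G \<Longrightarrow> k \<in> carrier G \<Longrightarrow> \<alpha> (gcomm g k) = gcomm (\<alpha> g) (\<alpha> k)"
  by (rule hom_gcomm) (simp add: auto_def)

lemma auto_surj: "\<alpha> \<in> auto G \<Longrightarrow> \<alpha> ` carrier G = carrier G"
  by (simp add: auto_def Bij_def bij_betw_def)

lemma auto_eqI:
  "\<alpha> \<in> auto G \<Longrightarrow> \<beta> \<in> auto G \<Longrightarrow> (\<And>g. g \<in> carrier G \<Longrightarrow> \<alpha> g = \<beta> g) \<Longrightarrow> \<alpha> = \<beta>"
  by (rule extensionalityI[of _ "carrier G"]) (auto simp: auto_def Bij_def)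

lemma auto_lower_central: "\<alpha> \<in> auto G \<Longrightarrow> g \<in> \<gamma> n \<Longrightarrow> \<alpha> g \<in> \<gamma> n"
  using auto_image_lower_central by blast

abbreviation (input) cmp :: "('a \<Rightarrow> 'a) \<Rightarrow> ('a \<Rightarrow> 'a) \<Rightarrow> 'a \<Rightarrow> 'a" where
  "cmp \<equiv> compose (carrier G)"

lemma auto_compose: "\<alpha> \<in> auto G \<Longrightarrow> \<beta> \<in> auto G \<Longrightarrow> cmp \<alpha> \<beta> \<in> auto G"
  using monoid.m_closed[OF group.is_monoid[OF AutoGroup], of \<alpha> \<beta>] by simp

lemma auto_division:
  assumes "\<alpha> \<in> auto G" "\<beta> \<in> auto G"
  obtains \<kappa> where "\<kappa> \<in> auto G" "cmp \<alpha> \<kappa> = \<beta>"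
proof
  interpret A: group "AutoGroup G" by (rule AutoGroup)
  let ?\<kappa> = "inv\<^bsub>AutoGroup G\<^esub> \<alpha> \<otimes>\<^bsub>AutoGroup G\<^esub> \<beta>"
  show \<kappa>: "?\<kappa> \<in> auto G" using assms A.m_closed A.inv_closed by simp
  have "\<alpha> \<otimes>\<^bsub>AutoGroup G\<^esub> ?\<kappa> = \<beta>"
    using assms A.m_assoc[of \<alpha> "inv\<^bsub>AutoGroup G\<^esub> \<alpha>" \<beta>] A.inv_closed[of \<alpha>] A.r_inv[of \<alpha>] A.l_one[of \<beta>]
    by (simp del: mult_AutoGroup)
  then show "cmp \<alpha> ?\<kappa> = \<beta>" using assms \<kappa> by (simp only: mult_AutoGroup)
qed

text \<open>Indexed by the depth gained: for positive \<open>k\<close> and \<open>n\<close>,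
  elements of \<open>IA k\<close> change an element of \<gamma> n by a factor in \<gamma> (n + k),
  see \<open>IA_shift\<close>. So \<open>IA 1\<close> is the usual group
  \<open>IA(N)\<close>.\<close>

definition IA :: "nat \<Rightarrow> ('a \<Rightarrow> 'a) set" where
  "IA k = {\<alpha> \<in> auto G. \<forall>g\<in>carrier G. lcong (Suc k) g (\<alpha> g)}"

lemma IA_auto: "\<alpha> \<in> IA k \<Longrightarrow> \<alpha> \<in> auto G"
  by (simp add: IA_def)

lemma IA_lcong: "\<alpha> \<in> IA k \<Longrightarrow> g \<in> carrier G \<Longrightarrow> lcong (Suc k) g (\<alpha> g)"
  by (simp add: IA_def)

lemma IA_mono: "\<alpha> \<in> IA k \<Longrightarrow> j \<le> k \<Longrightarrow> \<alpha> \<in> IA j"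
  by (auto simp: IA_def intro: lcong_mono)

lemma IA_compose: "\<alpha> \<in> IA k \<Longrightarrow> \<beta> \<in> IA k \<Longrightarrow> cmp \<alpha> \<beta> \<in> IA k"
  using lcong_trans by (fastforce simp: IA_def auto_compose compose_eq)

lemma IA2_eq_IA: "IA2 G \<subseteq> IA 2"
proof
  fix \<alpha> assume "\<alpha> \<in> IA2 G"
  then have \<alpha>: "\<alpha> \<in> auto G" "induced_aut G (\<gamma> 3) \<alpha> = \<one>\<^bsub>AutoGroup (G Mod \<gamma> 3)\<^esub>"
    by (auto simp: IA2_def kernel_def)
  interpret L: normal "\<gamma> 3" G by (rule normal_lower_central)
  have "lcong 3 g (\<alpha> g)" if g: "g \<in> carrier G" for g
  proof -
    have "\<gamma> 3 #> g \<in> carrier (G Mod \<gamma> 3)"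
      using g by (auto simp: carrier_FactGroup)
    then have "\<gamma> 3 #> \<alpha> g = \<gamma> 3 #> g"
      using induced_aut_coset[OF \<alpha>(1) g, of 3] \<alpha>(2) by (simp add: AutoGroup_def BijGroup_def)
    then have "\<alpha> g \<in> \<gamma> 3 #> g"
      using rcos_self[OF auto_closed[OF \<alpha>(1) g] L.subgroup_axioms] by simp
    then obtain h where h: "h \<in> \<gamma> 3" "\<alpha> g = h \<otimes> g" by (auto simp: r_coset_def)
    then have "inv g \<otimes> \<alpha> g = inv g \<otimes> h \<otimes> g" using g lower_central_closed by (simp add: m_assoc)
    then show ?thesis using lower_central_conj'[OF g h(1)] g \<alpha>(1) by (simp add: lcong_def)
  qed
  then show "\<alpha> \<in> IA 2" using \<alpha>(1) by (simp add: IA_def numeral_3_eq_3 numeral_2_eq_2)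
qed

text \<open>Both entries of a bracket \<open>[u, g]\<close> change by factors that lie
  \<open>k\<close> steps deeper. Endomorphisms are allowed because \<open>unipotent_hom_auto\<close>
  needs this before bijectivity is known.\<close>

lemma IA_lower_central:
  assumes "\<alpha> \<in> hom G G" "\<And>g. g \<in> carrier G \<Longrightarrow> lcong (Suc k) g (\<alpha> g)" "k > 0" "n > 0" "g \<in> \<gamma> n"
  shows "lcong (n + k) g (\<alpha> g)"
  using assms(4,5)
proof (induction n arbitrary: g rule: nat_induct_non_zero)
  case 1
  then show ?case using assms(2) by simp
next
  case (Suc n)
  interpret a: group_hom G G \<alpha> by unfold_locales fact
  let ?H = "{g \<in> carrier G. lcong (Suc n + k) g (\<alpha> g)}"
  have "subgroup ?H G"
    by unfold_locales (auto intro: lcong_mult lcong_inv)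
  moreover have "gcomm u g \<in> ?H" if u: "u \<in> \<gamma> n" and g: "g \<in> carrier G" for u g
  proof -
    have uc: "u \<in> carrier G" using u lower_central_closed by blast
    obtain i where i: "n + k = Suc i" "i > 0" using Suc.hyps assms(3) by (cases "n + k") auto
    have au: "lcong (n + k) u (\<alpha> u)" by (rule Suc.IH[OF u])
    then have "\<alpha> u \<in> \<gamma> n" using u lcong_lower_central by simp
    have "lcong (Suc n + k) (gcomm u g) (gcomm (\<alpha> u) g)"
      using au i g by (intro lcong_gcomm_left[of i 1]) auto
    also have "lcong (Suc n + k) (gcomm (\<alpha> u) g) (gcomm (\<alpha> u) (\<alpha> g))"
      using assms(2)[OF g] assms(3) Suc.hyps \<open>\<alpha> u \<in> \<gamma> n\<close>
      by (intro lcong_gcomm_right[of k n]) auto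
    finally show ?thesis using hom_gcomm[OF assms(1) uc g] uc g by simp
  qed
  ultimately have "\<gamma> (Suc n) \<subseteq> ?H"
    using Suc.hyps by (intro lower_central_least) auto
  then show ?case using Suc.prems by blast
qed

lemma IA_shift: "\<alpha> \<in> IA k \<Longrightarrow> k > 0 \<Longrightarrow> n > 0 \<Longrightarrow> g \<in> \<gamma> n \<Longrightarrow> lcong (n + k) g (\<alpha> g)"
  by (rule IA_lower_central) (auto simp: IA_def auto_def)

end

context generated_group
begin

lemma lcong_generators:
  assumes "h \<in> hom G G" "\<And>b. b \<in> B \<Longrightarrow> lcong n (x b) (h (x b))" "g \<in> carrier G"
  shows "lcong n g (h g)"
proof -
  interpret h: group_hom G G h by unfold_locales fact
  have "subgroup {g \<in> carrier G. lcong n g (h g)} G"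
    by unfold_locales (auto intro: lcong_mult lcong_inv)
  then have "g \<in> {g \<in> carrier G. lcong n g (h g)}"
    by (rule generating_induct) (use assms in auto)
  then show ?thesis by simp
qed

lemma IA_generators:
  "\<alpha> \<in> auto G \<Longrightarrow> (\<And>b. b \<in> B \<Longrightarrow> lcong (Suc k) (x b) (\<alpha> (x b))) \<Longrightarrow> \<alpha> \<in> IA k"
  using lcong_generators[of \<alpha> "Suc k"] by (simp add: IA_def auto_def)

end

context free_nilpotent
begin

lemma lcong_class: "lcong (Suc c) g h \<Longrightarrow> g = h"
  using nilpotent by (auto simp: lcong_def dest: inv_equality) (metis inv_inv inv_solve_left r_one one_closed)

lemma IA_class: "\<alpha> \<in> IA k \<Longrightarrow> k \<ge> c \<Longrightarrow> g \<in> carrier G \<Longrightarrow> \<alpha> g = g"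
  using lcong_class IA_lcong lcong_mono by (metis Suc_le_mono)

text \<open>An element of the kernel sinks through all terms of the series. For surjectivity, start
  at \<gamma> (c + 1) and go up: \<open>g\<close> differs from \<open>h g\<close> by a deeper
  factor, which is already a value of \<open>h\<close>.\<close>

lemma unipotent_hom_auto:
  assumes h: "h \<in> hom G G" "\<And>g. g \<in> carrier G \<Longrightarrow> lcong 2 g (h g)"
  shows "restrict h (carrier G) \<in> auto G"
proof -
  interpret h: group_hom G G h by unfold_locales fact
  have shift: "lcong (Suc n) g (h g)" if "n > 0" "g \<in> \<gamma> n" for n g
    using IA_lower_central[of h 1 n g] h that by (simp add: numeral_2_eq_2)
  have "g = \<one>" if g: "g \<in> carrier G" "h g = \<one>" for g
  proof -
    have "g \<in> \<gamma> (Suc n)" for n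
    proof (induction n)
      case (Suc n)
      then show ?case using shift[of "Suc n" g] g by (simp add: lcong_one_iff')
    qed (use g in simp)
    then show ?thesis using nilpotent by blast
  qed
  then have inj: "inj_on h (carrier G)"
    by (simp add: h.inj_on_one_iff)
  have "\<gamma> (Suc c - j) \<subseteq> h ` carrier G" if "j \<le> c" for j
    using that
  proof (induction j)
    case 0
    have "h \<one> \<in> h ` carrier G" by (rule imageI) simp
    then show ?case using nilpotent by simp
  next
    case (Suc j)
    show ?case
    proof
      fix g assume g: "g \<in> \<gamma> (Suc c - Suc j)"
      have gc: "g \<in> carrier G" using g lower_central_closed by blast
      have "lcong (Suc c - j) g (h g)"
        using shift[OF _ g] Suc.prems by (simp add: Suc_diff_le)
      then have "inv g \<otimes> h g \<in> h ` carrier G" using Suc by (auto simp: lcong_def)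
      then obtain e where e: "e \<in> carrier G" "inv g \<otimes> h g = h e" by auto
      have "g = h g \<otimes> inv (h e)" unfolding e(2)[symmetric] using gc by (simp add: group_word_simps)
      also have "\<dots> = h (g \<otimes> inv e)" using gc e by simp
      finally show "g \<in> h ` carrier G" using gc e by blast
    qed
  qed
  from this[of c] have "carrier G \<subseteq> h ` carrier G" by simp
  then have "bij_betw h (carrier G) (carrier G)"
    using inj by (auto simp: bij_betw_def)
  moreover have "restrict h (carrier G) \<in> hom G G" by (auto simp: hom_def)
  ultimately show ?thesis by (simp add: auto_def Bij_def)
qed

text \<open>The family \<open>w\<close> is arbitrary, so infinitely many generators can be moved at
  once; the argument along the tree depends on this.\<close>

lemma IA_realize:
  assumes "k > 0" "\<And>b. b \<in> B \<Longrightarrow> w b \<in> \<gamma> (Suc k)"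
  obtains \<alpha> where "\<alpha> \<in> IA k" "\<And>b. b \<in> B \<Longrightarrow> \<alpha> (x b) = x b \<otimes> w b"
proof -
  obtain h where h: "h \<in> hom G G" "\<And>b. b \<in> B \<Longrightarrow> h (x b) = x b \<otimes> w b"
    using extension[of "\<lambda>b. x b \<otimes> w b"] assms(2) lower_central_closed by (metis gen_closed m_closed)
  have cong: "lcong (Suc k) (x b) (h (x b))" if "b \<in> B" for b
    using that h(2) assms(2) by (simp add: lcong_mult_right)
  have "lcong (Suc k) g (h g)" if "g \<in> carrier G" for g
    using lcong_generators[OF h(1) cong that] .
  then have "restrict h (carrier G) \<in> auto G"
    using assms(1) by (intro unipotent_hom_auto h(1) lcong_mono[of "Suc k" _ _ 2]) auto
  moreover from this have "restrict h (carrier G) \<in> IA k"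
    using cong by (intro IA_generators) auto
  ultimately show thesis using h(2) that by simp
qed

end

section \<open>The defect of an automorphism under \<Delta>\<close>

locale inn_fixing = free_nilpotent G B x c
  for G :: "('a, 'm) monoid_scheme" (structure) and B :: "'x set" and x c +
  fixes \<Delta> :: "('a \<Rightarrow> 'a) \<Rightarrow> ('a \<Rightarrow> 'a)"
  assumes Delta: "\<Delta> \<in> auto (AutoGroup G)"
    and fixes_Inn: "\<And>\<tau>. \<tau> \<in> Inn G \<Longrightarrow> \<Delta> \<tau> = \<tau>"
begin

lemma Delta_auto [simp]: "\<alpha> \<in> auto G \<Longrightarrow> \<Delta> \<alpha> \<in> auto G"
  using Delta group.auto_closed[OF AutoGroup] by fastforce

lemma Delta_compose:
  "\<alpha> \<in> auto G \<Longrightarrow> \<beta> \<in> auto G \<Longrightarrow> \<Delta> (cmp \<alpha> \<beta>) = cmp (\<Delta> \<alpha>) (\<Delta> \<beta>)"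
  using group.auto_mult[OF AutoGroup Delta, of \<alpha> \<beta>] by simp

definition defect :: "('a \<Rightarrow> 'a) \<Rightarrow> 'a \<Rightarrow> 'a" where
  "defect \<alpha> g = inv (\<alpha> g) \<otimes> \<Delta> \<alpha> g"

text \<open>
  \<open>\<alpha>\<close> carries conjugation by \<open>g\<close> to conjugation by \<open>\<alpha> g\<close>, and \<open>\<Delta>\<close> fixes both, so \<open>\<Delta> \<alpha> g\<close> and
  \<open>\<alpha> g\<close> induce the same inner automorphism.
\<close>

lemma defect_central:
  assumes \<alpha>: "\<alpha> \<in> auto G" and g: "g \<in> carrier G"
  shows "defect \<alpha> g \<in> \<gamma> c"
proof -
  let ?t = "\<lambda>g. \<lambda>y\<in>carrier G. g \<otimes> y \<otimes> inv g"
  have t: "?t g \<in> auto G" "\<Delta> (?t g) = ?t g" if "g \<in> carrier G" for g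
    using inner_in_auto[OF that] fixes_Inn[of "?t g"] that by (auto simp: Inn_def)
  have "cmp \<alpha> (?t g) = cmp (?t (\<alpha> g)) \<alpha>"
    by (rule auto_eqI) (use \<alpha> g t in \<open>auto intro!: auto_compose simp: compose_eq auto_mult auto_inv\<close>)
  then have eq: "cmp (\<Delta> \<alpha>) (?t g) = cmp (?t (\<alpha> g)) (\<Delta> \<alpha>)"
    using Delta_compose[OF \<alpha> t(1)[OF g]] Delta_compose[OF t(1) \<alpha>, of "\<alpha> g"] t \<alpha> g by simp
  have *: "\<Delta> \<alpha> g \<otimes> \<Delta> \<alpha> y \<otimes> inv (\<Delta> \<alpha> g) = \<alpha> g \<otimes> \<Delta> \<alpha> y \<otimes> inv (\<alpha> g)" if "y \<in> carrier G" for y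
    using fun_cong[OF eq, of y] that g \<alpha> by (simp add: compose_eq auto_mult auto_inv)
  show ?thesis
  proof (rule central)
    show "defect \<alpha> g \<in> carrier G" using \<alpha> g by (simp add: defect_def)
    fix z assume "z \<in> carrier G"
    then obtain y where y: "y \<in> carrier G" "z = \<Delta> \<alpha> y"
      using auto_surj[of "\<Delta> \<alpha>"] \<alpha> by (metis Delta_auto imageE)
    let ?p = "\<alpha> g" and ?q = "\<Delta> \<alpha> g"
    have cl: "?p \<in> carrier G" "?q \<in> carrier G" "z \<in> carrier G" using \<alpha> g y by auto
    have "inv ?p \<otimes> (?q \<otimes> z \<otimes> inv ?q) \<otimes> ?q = inv ?p \<otimes> (?p \<otimes> z \<otimes> inv ?p) \<otimes> ?q"
      using *[OF y(1)] y(2) by simp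
    then show "defect \<alpha> g \<otimes> z = z \<otimes> defect \<alpha> g"
      using cl by (simp add: defect_def group_word_simps)
  qed
qed

lemma Delta_eq: "\<alpha> \<in> auto G \<Longrightarrow> g \<in> carrier G \<Longrightarrow> \<Delta> \<alpha> g = \<alpha> g \<otimes> defect \<alpha> g"
  by (simp add: defect_def group_word_simps)

text \<open>Commutators do not see central factors, and defects are central.\<close>

lemma Delta_lower_central_2:
  assumes \<alpha>: "\<alpha> \<in> auto G" and e: "e \<in> \<gamma> 2"
  shows "\<Delta> \<alpha> e = \<alpha> e"
proof -
  let ?H = "{e \<in> carrier G. \<Delta> \<alpha> e = \<alpha> e}"
  have "subgroup ?H G"
    by unfold_locales (simp_all add: \<alpha> auto_mult auto_inv subset_iff)
  moreover have "gcomm u g \<in> ?H" if u: "u \<in> \<gamma> 1" and g: "g \<in> carrier G" for u g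
  proof -
    have uc: "u \<in> carrier G" using u by simp
    have cong: "lcong c (\<Delta> \<alpha> y) (\<alpha> y)" if "y \<in> carrier G" for y
      unfolding Delta_eq[OF \<alpha> that]
      by (rule lcong_sym[OF lcong_mult_right[OF auto_closed[OF \<alpha> that] defect_central[OF \<alpha> that]]])
    obtain i where i: "c = Suc i" "i > 0" using class_ge_2 by (intro that[of "c - 1"]) auto
    have "lcong (Suc c) (gcomm (\<Delta> \<alpha> u) (\<Delta> \<alpha> g)) (gcomm (\<alpha> u) (\<Delta> \<alpha> g))"
      using cong[OF uc] i g \<alpha> by (intro lcong_gcomm_left[of i 1]) auto
    also have "lcong (Suc c) (gcomm (\<alpha> u) (\<Delta> \<alpha> g)) (gcomm (\<alpha> u) (\<alpha> g))"
      using cong[OF g] i uc \<alpha> by (intro lcong_gcomm_right[of i 1]) auto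
    finally have "gcomm (\<Delta> \<alpha> u) (\<Delta> \<alpha> g) = gcomm (\<alpha> u) (\<alpha> g)" by (rule lcong_class)
    then show ?thesis using uc g \<alpha> by (simp add: auto_gcomm)
  qed
  ultimately have "\<gamma> (Suc 1) \<subseteq> ?H"
    by (intro lower_central_least) auto
  then show ?thesis using e by (auto simp: numeral_2_eq_2)
qed

lemma IA_lower_central_class: "\<alpha> \<in> IA 1 \<Longrightarrow> z \<in> \<gamma> c \<Longrightarrow> \<alpha> z = z"
  using lcong_class[of z "\<alpha> z"] IA_shift[of \<alpha> 1 c z] class_ge_2 by simp

lemma class_commute: "z \<in> \<gamma> c \<Longrightarrow> g \<in> carrier G \<Longrightarrow> z \<otimes> g = g \<otimes> z"
  using lcong_class[OF lcong_commute[of c 1 z g "Suc c"]] class_ge_2 by simp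

text \<open>\<open>g\<close> and \<open>\<beta> g\<close> differ by an element of \<gamma> 2, where
  \<open>\<Delta> \<alpha>\<close> agrees with \<alpha>; and \<alpha> fixes the defect of \<beta>,
  since \<open>IA 1\<close> acts trivially on \<gamma> c.\<close>

lemma defect_compose:
  assumes \<alpha>: "\<alpha> \<in> IA 1" and \<beta>: "\<beta> \<in> IA 1" and g: "g \<in> carrier G"
  shows "defect (cmp \<alpha> \<beta>) g = defect \<alpha> g \<otimes> defect \<beta> g"
proof -
  note au = IA_auto[OF \<alpha>] IA_auto[OF \<beta>]
  note da = defect_central[OF au(1) g] and db = defect_central[OF au(2) g]
  have cl: "defect \<alpha> g \<in> carrier G" "defect \<beta> g \<in> carrier G" using da db lower_central_closed by blast+
  define e where "e = inv g \<otimes> \<beta> g"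
  have e: "e \<in> \<gamma> 2" "\<beta> g = g \<otimes> e" "e \<in> carrier G"
    using IA_lcong[OF \<beta> g] g au by (auto simp: e_def lcong_def numeral_2_eq_2 group_word_simps)
  have "defect \<beta> g \<in> \<gamma> 2" using lower_centralD[OF db class_ge_2] .
  then have "\<Delta> \<alpha> (defect \<beta> g) = defect \<beta> g"
    using Delta_lower_central_2[OF au(1)] IA_lower_central_class[OF \<alpha> db] by simp
  then have "\<Delta> \<alpha> (\<Delta> \<beta> g) = \<Delta> \<alpha> (g \<otimes> e) \<otimes> defect \<beta> g"
    using g e au cl by (simp add: Delta_eq[OF au(2) g] auto_mult)
  also have "\<Delta> \<alpha> (g \<otimes> e) = \<alpha> g \<otimes> defect \<alpha> g \<otimes> \<alpha> e"
    using g e au by (simp add: auto_mult Delta_eq[OF au(1) g] Delta_lower_central_2)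
  also have "\<dots> = \<alpha> (g \<otimes> e) \<otimes> defect \<alpha> g"
    using g e au cl class_commute[OF da, of "\<alpha> e"] by (simp add: auto_mult m_assoc)
  finally have "\<Delta> \<alpha> (\<Delta> \<beta> g) = \<alpha> (\<beta> g) \<otimes> (defect \<alpha> g \<otimes> defect \<beta> g)"
    using g e au cl by (simp add: m_assoc)
  then show ?thesis
    using g au cl by (simp add: defect_def[of "compose _ _ _"] Delta_compose compose_eq group_word_simps)
qed

lemma fixed_iff:
  assumes "\<alpha> \<in> auto G"
  shows "\<Delta> \<alpha> = \<alpha> \<longleftrightarrow> (\<forall>g\<in>carrier G. defect \<alpha> g = \<one>)"
proof
  show "\<forall>g\<in>carrier G. defect \<alpha> g = \<one>" if "\<Delta> \<alpha> = \<alpha>"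
    using assms that by (simp add: defect_def)
  show "\<Delta> \<alpha> = \<alpha>" if "\<forall>g\<in>carrier G. defect \<alpha> g = \<one>"
    by (rule auto_eqI) (simp_all add: assms that Delta_eq)
qed

lemma defect_closed [simp]: "\<alpha> \<in> IA 1 \<Longrightarrow> g \<in> carrier G \<Longrightarrow> defect \<alpha> g \<in> carrier G"
  using defect_central[OF IA_auto] lower_central_closed by blast

lemma fixed_cancel:
  assumes "\<alpha> \<in> IA 1" "\<beta> \<in> IA 1" "\<Delta> \<alpha> = \<alpha>"
  shows "\<Delta> (cmp \<alpha> \<beta>) = cmp \<alpha> \<beta> \<longleftrightarrow> \<Delta> \<beta> = \<beta>"
proof -
  have "defect (cmp \<alpha> \<beta>) g = defect \<beta> g" if "g \<in> carrier G" for g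
    using assms that fixed_iff[OF IA_auto[OF assms(1)]] by (simp add: defect_compose)
  then show ?thesis
    using assms(1,2) by (simp add: fixed_iff IA_auto auto_compose)
qed

lemma fixed_cancel':
  assumes "\<alpha> \<in> IA 1" "\<beta> \<in> IA 1" "\<Delta> \<beta> = \<beta>"
  shows "\<Delta> (cmp \<alpha> \<beta>) = cmp \<alpha> \<beta> \<longleftrightarrow> \<Delta> \<alpha> = \<alpha>"
proof -
  have "defect (cmp \<alpha> \<beta>) g = defect \<alpha> g" if "g \<in> carrier G" for g
    using assms that fixed_iff[OF IA_auto[OF assms(2)]] by (simp add: defect_compose)
  then show ?thesis
    using assms(1,2) by (simp add: fixed_iff IA_auto auto_compose)
qed

lemma commutator_fixed:
  assumes "\<alpha> \<in> IA 1" "\<beta> \<in> IA 1" "\<kappa> \<in> IA 1"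
    and eq: "cmp \<alpha> \<beta> = cmp (cmp \<beta> \<alpha>) \<kappa>"
  shows "\<Delta> \<kappa> = \<kappa>"
proof -
  have "defect \<kappa> g = \<one>" if g: "g \<in> carrier G" for g
  proof -
    have cl: "defect \<alpha> g \<in> carrier G" "defect \<beta> g \<in> carrier G" "defect \<kappa> g \<in> carrier G"
      using assms(1-3) g by simp_all
    have "defect \<alpha> g \<otimes> defect \<beta> g = defect \<beta> g \<otimes> defect \<alpha> g \<otimes> defect \<kappa> g"
      using arg_cong[OF eq, of "\<lambda>\<beta>. defect \<beta> g"] assms(1-3) g by (simp add: defect_compose IA_compose)
    moreover have "defect \<alpha> g \<otimes> defect \<beta> g = defect \<beta> g \<otimes> defect \<alpha> g"
      using class_commute[OF defect_central[OF IA_auto[OF assms(1)] g]] cl by simp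
    ultimately show ?thesis using cl by simp
  qed
  then show ?thesis using IA_auto[OF assms(3)] by (simp add: fixed_iff)
qed

end

section \<open>Commutators starting in a given set of generators\<close>

context generated_group
begin

text \<open>
  Modulo \<open>\<gamma> (Suc m)\<close>, the element is a product of left-normed commutators of length \<open>m\<close> with first
  entry from \<open>S\<close> and all others from \<open>C\<close>.
\<close>

inductive span_from :: "'x set \<Rightarrow> 'x set \<Rightarrow> nat \<Rightarrow> 'a \<Rightarrow> bool" for S C where
  base: "y \<in> S \<Longrightarrow> span_from S C (Suc 0) (x y)"
| high: "m > 0 \<Longrightarrow> g \<in> \<gamma> (Suc m) \<Longrightarrow> span_from S C m g"
| mult: "span_from S C m g \<Longrightarrow> span_from S C m h \<Longrightarrow> span_from S C m (g \<otimes> h)"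
| inv: "span_from S C m g \<Longrightarrow> span_from S C m (inv g)"
| bracket: "span_from S C m u \<Longrightarrow> b \<in> C \<Longrightarrow> span_from S C (Suc m) (gcomm u (x b))"

lemma span_from_lower_central: "span_from S C m g \<Longrightarrow> m > 0 \<and> g \<in> \<gamma> m"
proof (induction rule: span_from.induct)
  case (high m g)
  then show ?case using lower_centralD[of g "Suc m" m] by simp
next
  case (bracket m u b)
  then show ?case using gcomm_lower_central_Suc by simp
qed (auto intro: lower_central_mult lower_central_inv)

lemma span_from_pos: "span_from S C m g \<Longrightarrow> m > 0"
  using span_from_lower_central by blast

lemma span_from_closed: "span_from S C m g \<Longrightarrow> g \<in> carrier G"
  using span_from_lower_central lower_central_closed by blast

lemma span_from_one: "m > 0 \<Longrightarrow> span_from S C m \<one>"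
  by (rule span_from.high) auto

lemma span_from_cong:
  assumes "lcong (Suc m) g h" "span_from S C m g"
  shows "span_from S C m h"
proof -
  have "span_from S C m (g \<otimes> (inv g \<otimes> h))"
    by (rule span_from.mult[OF assms(2) span_from.high[OF span_from_pos[OF assms(2)]]]) (use assms(1) in \<open>simp add: lcong_def\<close>)
  then show ?thesis using assms(1) by (simp add: lcong_def group_word_simps)
qed

text \<open>Jacobi turns \<open>[[u, x b], q]\<close> into \<open>[[u, q], x b]\<close> and
  \<open>[u, [x b, q]]\<close>, and \<open>[x b, q]\<close> again has its first entry in
  \<open>S\<close>.\<close>

lemma span_from_gcomm:
  assumes "span_from C C i u" "span_from S C j q"
  shows "span_from S C (i + j) (gcomm u q)"
  using assms
proof (induction arbitrary: j q rule: span_from.induct)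
  case (base y)
  have "span_from S C (Suc j) (inv (gcomm q (x y)))"
    by (rule span_from.inv[OF span_from.bracket[OF base(2,1)]])
  then show ?case using span_from_closed[OF base(2)] by (simp add: inv_gcomm)
next
  case (high m g)
  have "gcomm g q \<in> \<gamma> (Suc m + j)"
    using high span_from_lower_central[OF high(3)] by (intro gcomm_lower_central) auto
  then show ?case using high by (intro span_from.high) auto
next
  case (mult m g h)
  have "lcong (Suc (m + j)) (gcomm (g \<otimes> h) q) (gcomm g q \<otimes> gcomm h q)"
    using span_from_lower_central[OF mult(1)] span_from_lower_central[OF mult(2)] span_from_lower_central[OF mult(5)]
    by (intro lcong_gcomm_mult_left[of m j]) auto
  then show ?case by (rule span_from_cong[OF lcong_sym span_from.mult[OF mult(3,4)[OF mult(5)]]])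
next
  case (inv m g)
  have "lcong (Suc (m + j)) (gcomm (inv g) q) (inv (gcomm g q))"
    using span_from_lower_central[OF inv(1)] span_from_lower_central[OF inv(3)]
    by (intro lcong_gcomm_inv_left[of m j]) auto
  then show ?case by (rule span_from_cong[OF lcong_sym span_from.inv[OF inv(2)[OF inv(3)]]])
next
  case (bracket m u b)
  note u = span_from_lower_central[OF bracket(1)] and q = span_from_lower_central[OF bracket(4)]
  have "lcong (Suc (Suc m + j)) (gcomm (gcomm u (x b)) q) (gcomm (gcomm u q) (x b) \<otimes> gcomm u (gcomm (x b) q))"
    using u q by (intro lcong_Jacobi[of m 1 j]) auto
  then have cong: "lcong (Suc (Suc m + j)) (gcomm (gcomm u q) (x b) \<otimes> gcomm u (gcomm (x b) q)) (gcomm (gcomm u (x b)) q)"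
    by (rule lcong_sym)
  have "span_from S C (Suc j) (inv (gcomm q (x b)))" by (rule span_from.inv[OF span_from.bracket[OF bracket(4,2)]])
  then have "span_from S C (Suc j) (gcomm (x b) q)" using span_from_closed[OF bracket(4)] by (simp add: inv_gcomm)
  from bracket(3)[OF this] have "span_from S C (Suc m + j) (gcomm u (gcomm (x b) q))" by simp
  moreover have "span_from S C (Suc m + j) (gcomm (gcomm u q) (x b))"
    using span_from.bracket[OF bracket(3)[OF bracket(4)] bracket(2)] by simp
  ultimately show ?case by (intro span_from_cong[OF cong] span_from.mult)
qed

text \<open>To leading order \<alpha> acts on left-normed commutators by a derivation, each summand
  replacing one entry by its increment. At the first entry this gives words starting in
  \<open>S'\<close>. At a later one it gives \<open>[u, q]\<close> with \<open>u\<close> starting in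
  \<open>S\<close> and \<open>q\<close> in \<open>S'\<close>: if \<open>S = C\<close> this has the
  required form by \<open>span_from_gcomm\<close>, and if \<alpha> fixes the letters of
  \<open>C\<close> it disappears.\<close>

lemma span_from_increment:
  assumes \<alpha>: "\<alpha> \<in> IA 1"
    and S: "\<And>y. y \<in> S \<Longrightarrow> span_from S' C 2 (inv (x y) \<otimes> \<alpha> (x y))"
    and C: "\<And>b. b \<in> C \<Longrightarrow> span_from S' C 2 (inv (x b) \<otimes> \<alpha> (x b))"
    and disj: "S = C \<or> (\<forall>b\<in>C. \<alpha> (x b) = x b)"
    and "span_from S C m u"
  shows "span_from S' C (Suc m) (inv u \<otimes> \<alpha> u)"
  using assms(5)
proof (induction rule: span_from.induct)
  note au = IA_auto[OF \<alpha>]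
  {
    case (base y)
    then show ?case using S by (simp add: numeral_2_eq_2)
  next
    case (high m g)
    then show ?case
      using IA_shift[OF \<alpha>, of "Suc m" g] by (intro span_from.high) (auto simp: lcong_def)
  next
    case (mult m g h)
    note g = span_from_lower_central[OF mult(3)] and h = span_from_lower_central[OF mult(4)]
    have c: "g \<in> carrier G" "h \<in> carrier G" using mult(1,2) span_from_closed by blast+
    have "lcong (Suc (Suc m)) (inv h \<otimes> (inv g \<otimes> \<alpha> g) \<otimes> inv (inv h) \<otimes> (inv h \<otimes> \<alpha> h))
       (inv g \<otimes> \<alpha> g \<otimes> (inv h \<otimes> \<alpha> h))"
      using g c au by (intro lcong_mult[OF lcong_conj[of "Suc m"]]) auto
    then have "lcong (Suc (Suc m)) (inv (g \<otimes> h) \<otimes> \<alpha> (g \<otimes> h)) (inv g \<otimes> \<alpha> g \<otimes> (inv h \<otimes> \<alpha> h))"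
      using c au by (simp add: auto_mult group_word_simps)
    then show ?case by (rule span_from_cong[OF lcong_sym span_from.mult[OF mult(3,4)]])
  next
    case (inv m g)
    note g = span_from_lower_central[OF inv(2)]
    have c: "g \<in> carrier G" using inv(1) span_from_closed by blast
    have "lcong (Suc (Suc m)) (g \<otimes> inv (inv g \<otimes> \<alpha> g) \<otimes> inv g) (inv (inv g \<otimes> \<alpha> g))"
      using g c by (intro lcong_conj[of "Suc m"] lower_central_inv) auto
    then have "lcong (Suc (Suc m)) (inv (inv g) \<otimes> \<alpha> (inv g)) (inv (inv g \<otimes> \<alpha> g))"
      using c au by (simp add: auto_inv group_word_simps)
    then show ?case by (rule span_from_cong[OF lcong_sym span_from.inv[OF inv(2)]])
  next
    case (bracket m u b)
    define v where "v = inv u \<otimes> \<alpha> u"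
    define q where "q = inv (x b) \<otimes> \<alpha> (x b)"
    have m: "m > 0" and u: "u \<in> \<gamma> m" and uc: "u \<in> carrier G"
      using span_from_lower_central[OF bracket(1)] span_from_closed[OF bracket(1)] by auto
    have v: "span_from S' C (Suc m) v" "v \<in> \<gamma> (Suc m)" "v \<in> carrier G" "\<alpha> u = u \<otimes> v"
      using bracket(3) span_from_lower_central[OF bracket(3)] uc au by (auto simp: v_def group_word_simps)
    have q: "span_from S' C 2 q" "q \<in> \<gamma> 2" "q \<in> carrier G" "\<alpha> (x b) = x b \<otimes> q"
      using C[OF bracket(2)] span_from_lower_central[OF C[OF bracket(2)]] au by (auto simp: q_def group_word_simps)
    have uq: "gcomm u q \<in> \<gamma> (Suc (Suc m))"
      using gcomm_lower_central[OF m _ u q(2)] by simp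
    have vx: "gcomm v (x b) \<in> \<gamma> (Suc (Suc m))"
      using gcomm_lower_central_Suc[OF _ v(2)] by simp
    have ux: "gcomm u (x b) \<in> \<gamma> (Suc m)"
      using gcomm_lower_central_Suc[OF m u] by simp
    \<comment> \<open>With \<open>v\<close> and \<open>q\<close> the increments of \<open>u\<close>
      and \<open>x b\<close>, the bracket consists of \<open>[u, x b]\<close>,
      \<open>[v, x b]\<close>, \<open>[u, q]\<close> and the negligible
      \<open>[v, q]\<close>.\<close>
    have "gcomm (\<alpha> u) (\<alpha> (x b)) = (u \<otimes> gcomm v (x b \<otimes> q) \<otimes> inv u) \<otimes> (gcomm u (x b) \<otimes> (x b \<otimes> gcomm u q \<otimes> inv (x b)))"
      unfolding v(4) q(4) using uc v(3) q(3) gcomm_mult_left[of u v "x b \<otimes> q"] gcomm_mult_right[of "x b" q u] by simp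
    also have "lcong (Suc (Suc (Suc m))) \<dots> (gcomm v (x b) \<otimes> (gcomm u (x b) \<otimes> gcomm u q))"
    proof (rule lcong_mult)
      have 1: "lcong (Suc (Suc (Suc m))) (gcomm v (x b)) (gcomm v (x b \<otimes> q))"
        using v(2) q(2) by (intro lcong_gcomm_right[of 1 "Suc m"] lcong_mult_right) (auto simp: numeral_2_eq_2)
      have "gcomm v (x b \<otimes> q) \<in> \<gamma> (Suc (Suc m))" by (rule lcong_lower_central[OF 1 _ vx]) simp
      then have "lcong (Suc (Suc (Suc m))) (u \<otimes> gcomm v (x b \<otimes> q) \<otimes> inv u) (gcomm v (x b \<otimes> q))"
        using uc by (intro lcong_conj[of "Suc (Suc m)"]) auto
      then show "lcong (Suc (Suc (Suc m))) (u \<otimes> gcomm v (x b \<otimes> q) \<otimes> inv u) (gcomm v (x b))"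
        using 1 lcong_sym lcong_trans by blast
      show "lcong (Suc (Suc (Suc m))) (gcomm u (x b) \<otimes> (x b \<otimes> gcomm u q \<otimes> inv (x b))) (gcomm u (x b) \<otimes> gcomm u q)"
        using uq uc by (intro lcong_mult[OF lcong_refl] lcong_conj[of "Suc (Suc m)"]) auto
    qed
    also have "lcong (Suc (Suc (Suc m))) \<dots> (gcomm u (x b) \<otimes> (gcomm v (x b) \<otimes> gcomm u q))"
    proof -
      have "lcong (Suc (Suc (Suc m))) (gcomm v (x b) \<otimes> gcomm u (x b) \<otimes> gcomm u q) (gcomm u (x b) \<otimes> gcomm v (x b) \<otimes> gcomm u q)"
        using vx ux uc q by (intro lcong_mult[OF lcong_commute[of "Suc (Suc m)" "Suc m"]]) auto
      then show ?thesis using uc v(3) q(3) by (simp add: m_assoc)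
    qed
    finally have eq: "lcong (Suc (Suc (Suc m))) (\<alpha> (gcomm u (x b)))
        (gcomm u (x b) \<otimes> (gcomm v (x b) \<otimes> gcomm u q))"
      unfolding auto_gcomm[OF au uc gen_closed] .
    have "inv (gcomm u (x b)) \<in> carrier G" using uc by simp
    from lcong_mult[OF lcong_refl[OF this] eq]
    have "lcong (Suc (Suc (Suc m))) (inv (gcomm u (x b)) \<otimes> \<alpha> (gcomm u (x b))) (gcomm v (x b) \<otimes> gcomm u q)"
      using group_word_simps(1)[of "gcomm u (x b)" "gcomm v (x b) \<otimes> gcomm u q"] uc v(3) q(3)
      by (simp only: gcomm_closed gen_closed m_closed)
    note cong = lcong_sym[OF this]
    have "span_from S' C (Suc (Suc m)) (gcomm u q)"
      using disj
    proof
      assume "S = C"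
      then show ?thesis using span_from_gcomm[OF _ q(1), of m u] bracket(1) by (simp add: numeral_2_eq_2)
    next
      assume "\<forall>b\<in>C. \<alpha> (x b) = x b"
      then have "q = \<one>" using bracket(2) by (simp add: q_def)
      then show ?thesis using uc by (simp add: span_from_one)
    qed
    then show ?case
      by (intro span_from_cong[OF cong] span_from.mult span_from.bracket v(1) bracket(2))
  }
qed

text \<open>Factors in \<gamma> (m + 1) move only within \<gamma> (m + 2), so at this precision the
  letters decide. It serves to compare an automorphism acting on many levels of the tree with one
  acting on a single level.\<close>

lemma span_from_agree:
  assumes \<alpha>: "\<alpha> \<in> IA 1" and \<beta>: "\<beta> \<in> IA 1"
    and S: "\<And>y. y \<in> S \<Longrightarrow> \<alpha> (x y) = \<beta> (x y)" and C: "\<And>b. b \<in> C \<Longrightarrow> \<alpha> (x b) = \<beta> (x b)"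
    and "span_from S C m u"
  shows "lcong (Suc (Suc m)) (\<alpha> u) (\<beta> u)"
  using assms(5)
proof (induction rule: span_from.induct)
  note au = IA_auto[OF \<alpha>] IA_auto[OF \<beta>]
  {
    case (base y)
    then show ?case using S au by simp
  next
    case (high m g)
    then have "lcong (Suc m + 1) g (\<alpha> g)" "lcong (Suc m + 1) g (\<beta> g)"
      by (intro IA_shift[OF \<alpha>] IA_shift[OF \<beta>]; simp)+
    from lcong_trans[OF lcong_sym[OF this(1)] this(2)] show ?case by simp
  next
    case (mult m g h)
    then show ?case using lcong_mult au by (simp add: auto_mult span_from_closed[OF mult(1)] span_from_closed[OF mult(2)])
  next
    case (inv m g)
    then show ?case using lcong_inv au by (simp add: auto_inv span_from_closed[OF inv(1)])
  next
    case (bracket m u b)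
    have "lcong (Suc (Suc (Suc m))) (gcomm (\<alpha> u) (\<alpha> (x b))) (gcomm (\<beta> u) (\<alpha> (x b)))"
      using bracket(3) au by (intro lcong_gcomm_left[of "Suc m" 1]) auto
    then show ?case
      using C[OF bracket(2)] au span_from_closed[OF bracket(1)] by (simp add: auto_gcomm)
  }
qed

fun brackets :: "('a \<times> 'x) list \<Rightarrow> 'a" where
  "brackets [] = \<one>"
| "brackets ((u, b) # l) = gcomm u (x b) \<otimes> brackets l"

lemma brackets_closed: "\<forall>p\<in>set l. fst p \<in> carrier G \<Longrightarrow> brackets l \<in> carrier G"
  by (induction l rule: brackets.induct) auto

lemma brackets_append:
  "\<forall>p\<in>set (l @ l'). fst p \<in> carrier G \<Longrightarrow> brackets (l @ l') = brackets l \<otimes> brackets l'"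
  by (induction l rule: brackets.induct) (auto simp: m_assoc brackets_closed)

lemma brackets_lower_central:
  "m > 0 \<Longrightarrow> \<forall>p\<in>set l. fst p \<in> \<gamma> m \<Longrightarrow> brackets l \<in> \<gamma> (Suc m)"
  by (induction l rule: brackets.induct) (auto intro!: lower_central_mult gcomm_lower_central_Suc)

lemma brackets_inv:
  assumes "m > 0" "\<forall>p\<in>set l. fst p \<in> \<gamma> m"
  shows "lcong (Suc (Suc m)) (brackets (map (\<lambda>(u, b). (inv u, b)) l)) (inv (brackets l))"
  using assms(2)
proof (induction l rule: brackets.induct)
  case (2 u b l)
  let ?r = "brackets (map (\<lambda>(u, b). (inv u, b)) l)"
  have u: "u \<in> \<gamma> m" and l: "\<forall>p\<in>set l. fst p \<in> \<gamma> m"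
    using "2.prems" by auto
  have r: "brackets l \<in> \<gamma> (Suc m)" using assms(1) l by (intro brackets_lower_central)
  have c: "u \<in> carrier G" "brackets l \<in> carrier G" using u r lower_central_closed by blast+
  have g: "gcomm u (x b) \<in> \<gamma> (Suc m)" using gcomm_lower_central_Suc[OF assms(1) u] by simp
  have "lcong (Suc (Suc m)) (gcomm (inv u) (x b) \<otimes> ?r) (inv (gcomm u (x b)) \<otimes> inv (brackets l))"
    using assms(1) u l by (intro lcong_mult lcong_gcomm_inv_left[of m 1] "2.IH") auto
  also have "lcong (Suc (Suc m)) \<dots> (inv (brackets l) \<otimes> inv (gcomm u (x b)))"
    using g r by (intro lcong_commute[of "Suc m" "Suc m"] lower_central_inv) auto
  finally show ?case using c by (simp add: inv_mult_group)
qed simp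

text \<open>The equation \<open>n = Suc m\<close> is kept apart so that rule induction finds a
  variable index; \<open>m > 0\<close> excludes the case \<open>base\<close>.\<close>

lemma span_from_brackets:
  assumes "span_from S C n g" "n = Suc m" "m > 0"
  shows "\<exists>l. (\<forall>(u, b)\<in>set l. span_from S C m u \<and> b \<in> C) \<and> lcong (Suc (Suc m)) g (brackets l)"
  using assms
proof (induction rule: span_from.induct)
  case (high n g)
  then show ?case by (intro exI[of _ "[]"]) (simp add: lcong_one_iff')
next
  case (mult n g h)
  then obtain l l' where l: "\<forall>(u, b)\<in>set l. span_from S C m u \<and> b \<in> C" "lcong (Suc (Suc m)) g (brackets l)"
    "\<forall>(u, b)\<in>set l'. span_from S C m u \<and> b \<in> C" "lcong (Suc (Suc m)) h (brackets l')" by blast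
  then have "brackets (l @ l') = brackets l \<otimes> brackets l'"
    using span_from_closed by (intro brackets_append) fastforce
  then show ?case using l by (intro exI[of _ "l @ l'"]) (auto simp: lcong_mult)
next
  case (inv n g)
  then obtain l where l: "\<forall>(u, b)\<in>set l. span_from S C m u \<and> b \<in> C" "lcong (Suc (Suc m)) g (brackets l)" by blast
  have "lcong (Suc (Suc m)) (brackets (map (\<lambda>(u, b). (inv u, b)) l)) (inv (brackets l))"
    using l(1) span_from_lower_central inv.prems(2) by (intro brackets_inv) fastforce+
  then have "lcong (Suc (Suc m)) (inv g) (brackets (map (\<lambda>(u, b). (inv u, b)) l))"
    using lcong_inv[OF l(2)] lcong_sym lcong_trans by blast
  moreover have "\<forall>(u, b)\<in>set (map (\<lambda>(u, b). (inv u, b)) l). span_from S C m u \<and> b \<in> C"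
    using l(1) span_from.inv by fastforce
  ultimately show ?case by blast
next
  case (bracket n u b)
  then show ?case
    using span_from_closed by (intro exI[of _ "[(u, b)]"]) auto
qed auto

lemma span_from_lnc: "w \<noteq> [] \<Longrightarrow> set w \<subseteq> C \<Longrightarrow> span_from C C (length w) (lnc x w)"
  by (induction w rule: induct_list012) (auto intro: span_from.base span_from.bracket)

lemma span_from_word_prod:
  "m > 0 \<Longrightarrow> \<forall>p\<in>set xs. length (snd p) = m \<and> set (snd p) \<subseteq> C \<Longrightarrow> span_from C C m (word_prod x xs)"
proof (induction xs)
  case (Cons y xs)
  obtain s w where y: "y = (s, w)" by (cases y)
  have "length w = m \<and> set w \<subseteq> C" using Cons.prems(2) y by simp
  then have "span_from C C m (lnc x w)" using Cons.prems(1) span_from_lnc[of w C] by auto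
  then have "span_from C C m (signed s (lnc x w))" by (simp add: signed_def span_from.inv)
  then show ?case using Cons y by (auto intro!: span_from.mult)
qed (simp add: span_from_one)

end

section \<open>Descending induction along the filtration\<close>

context group
begin

lemma auto_lcong_cancel:
  assumes \<alpha>: "\<alpha> \<in> auto G" and c: "g \<in> carrier G" "h \<in> carrier G" and "lcong n (\<alpha> g) (\<alpha> h)"
  shows "lcong n g h"
proof -
  have "\<alpha> (inv g \<otimes> h) \<in> \<alpha> ` \<gamma> n"
    using assms auto_image_lower_central[OF \<alpha>] by (simp add: lcong_def auto_mult auto_inv)
  moreover have "inj_on \<alpha> (carrier G)" using \<alpha> by (simp add: auto_def Bij_def bij_betw_def)
  ultimately have "inv g \<otimes> h \<in> \<gamma> n"
    using c lower_central_subset inj_on_image_mem_iff[of \<alpha> "carrier G" "inv g \<otimes> h" "\<gamma> n"] by simp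
  then show ?thesis using c by (simp add: lcong_def)
qed

end

section \<open>One step of the descent: IA k modulo IA (k + 1)\<close>

locale filtration_step = inn_fixing G B x c \<Delta>
  for G :: "('a, 'm) monoid_scheme" (structure) and B :: "'x set" and x c \<Delta> +
  fixes k :: nat
  assumes k: "k \<ge> 2" and next_fixed: "\<And>\<alpha>. \<alpha> \<in> IA (Suc k) \<Longrightarrow> \<Delta> \<alpha> = \<alpha>"
begin

abbreviation close :: "'a \<Rightarrow> 'a \<Rightarrow> bool" where
  "close \<equiv> lcong (Suc (Suc k))"

text \<open>Changes of \<open>w\<close> within \<gamma> (k + 2) are harmless because
  \<open>next_fixed\<close> covers \<open>IA (Suc k)\<close>; so a single fixed representative in
  \<open>IA k\<close> settles all of them, see \<open>good_of_fixed\<close>.\<close>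

definition good :: "('x \<Rightarrow> 'a) \<Rightarrow> bool" where
  "good w \<longleftrightarrow> (\<forall>\<alpha>\<in>IA 1. (\<forall>b\<in>B. close (\<alpha> (x b)) (x b \<otimes> w b)) \<longrightarrow> \<Delta> \<alpha> = \<alpha>)"

definition deep :: "('x \<Rightarrow> 'a) \<Rightarrow> bool" where
  "deep w \<longleftrightarrow> (\<forall>b\<in>B. w b \<in> \<gamma> (Suc k))"

lemma deepD: "deep w \<Longrightarrow> b \<in> B \<Longrightarrow> w b \<in> \<gamma> (Suc k)"
  by (simp add: deep_def)

lemma deep_closed: "deep w \<Longrightarrow> b \<in> B \<Longrightarrow> w b \<in> carrier G"
  using deepD lower_central_closed by blast

lemma good_cong:
  assumes "good w" "\<And>b. b \<in> B \<Longrightarrow> close (w b) (w' b)"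
  shows "good w'"
  unfolding good_def
proof (intro ballI impI)
  fix \<alpha> assume \<alpha>: "\<alpha> \<in> IA 1" "\<forall>b\<in>B. close (\<alpha> (x b)) (x b \<otimes> w' b)"
  have "close (\<alpha> (x b)) (x b \<otimes> w b)" if "b \<in> B" for b
  proof -
    have "close (x b \<otimes> w' b) (x b \<otimes> w b)"
      by (rule lcong_mult[OF lcong_refl lcong_sym[OF assms(2)[OF that]]]) simp
    then show ?thesis using \<alpha>(2) that lcong_trans by blast
  qed
  then show "\<Delta> \<alpha> = \<alpha>" using \<alpha>(1) assms(1) unfolding good_def by blast
qed

lemma close_to_deep_IA:
  assumes "\<alpha> \<in> IA 1" "deep w" "\<And>b. b \<in> B \<Longrightarrow> close (\<alpha> (x b)) (x b \<otimes> w b)"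
  shows "\<alpha> \<in> IA k"
proof (rule IA_generators[OF IA_auto[OF assms(1)]])
  fix b assume b: "b \<in> B"
  have "lcong (Suc k) (x b) (x b \<otimes> w b)" using deepD[OF assms(2) b] by (simp add: lcong_mult_right)
  moreover have "lcong (Suc k) (x b \<otimes> w b) (\<alpha> (x b))"
    using lcong_sym[OF lcong_mono[OF assms(3)[OF b], of "Suc k"]] by simp
  ultimately show "lcong (Suc k) (x b) (\<alpha> (x b))" by (rule lcong_trans)
qed

text \<open>The quotient of two automorphisms with the same leading terms lies in
  \<open>IA (Suc k)\<close>.\<close>

lemma good_of_fixed:
  assumes \<alpha>: "\<alpha> \<in> IA k" "\<Delta> \<alpha> = \<alpha>" and w: "\<And>b. b \<in> B \<Longrightarrow> close (\<alpha> (x b)) (x b \<otimes> w b)"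
  shows "good w"
  unfolding good_def
proof (intro ballI impI)
  fix \<beta> assume \<beta>: "\<beta> \<in> IA 1" "\<forall>b\<in>B. close (\<beta> (x b)) (x b \<otimes> w b)"
  note au = IA_auto[OF \<alpha>(1)] IA_auto[OF \<beta>(1)]
  obtain \<kappa> where \<kappa>: "\<kappa> \<in> auto G" "cmp \<alpha> \<kappa> = \<beta>" by (rule auto_division[OF au])
  have "close (x b) (\<kappa> (x b))" if b: "b \<in> B" for b
  proof (rule auto_lcong_cancel[OF au(1)])
    have "\<alpha> (\<kappa> (x b)) = \<beta> (x b)" using \<kappa>(2) by (auto simp: compose_eq)
    then show "close (\<alpha> (x b)) (\<alpha> (\<kappa> (x b)))"
      using lcong_trans[OF w[OF b] lcong_sym] \<beta>(2) b by simp
  qed (use \<kappa> in auto)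
  then have "\<kappa> \<in> IA (Suc k)" by (rule IA_generators[OF \<kappa>(1)])
  then have "\<Delta> \<kappa> = \<kappa>" "\<kappa> \<in> IA 1" using next_fixed IA_mono by auto
  moreover have "\<alpha> \<in> IA 1" using IA_mono[OF \<alpha>(1)] k by simp
  ultimately show "\<Delta> \<beta> = \<beta>" using fixed_cancel[of \<alpha> \<kappa>] \<alpha>(2) \<kappa>(2) by simp
qed

lemma realize:
  assumes "deep w"
  obtains \<alpha> where "\<alpha> \<in> IA k" "\<alpha> \<in> IA 1" "\<And>b. b \<in> B \<Longrightarrow> \<alpha> (x b) = x b \<otimes> w b"
proof -
  obtain \<alpha> where "\<alpha> \<in> IA k" "\<And>b. b \<in> B \<Longrightarrow> \<alpha> (x b) = x b \<otimes> w b"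
    by (rule IA_realize[of k w]) (use k deepD[OF assms] in auto)
  then show thesis using that IA_mono[of \<alpha> k 1] k by auto
qed

lemma good_one: "good (\<lambda>b. \<one>)"
  unfolding good_def
proof (intro ballI impI)
  fix \<alpha> assume \<alpha>: "\<alpha> \<in> IA 1" "\<forall>b\<in>B. close (\<alpha> (x b)) (x b \<otimes> \<one>)"
  have "close (x b) (\<alpha> (x b))" if "b \<in> B" for b
    using lcong_sym[of "Suc (Suc k)" "\<alpha> (x b)" "x b"] \<alpha>(2) that by simp
  then show "\<Delta> \<alpha> = \<alpha>" by (intro next_fixed IA_generators[OF IA_auto[OF \<alpha>(1)]])
qed

lemma compose_lcong:
  assumes \<alpha>: "\<alpha> \<in> IA k" "\<And>b. b \<in> B \<Longrightarrow> \<alpha> (x b) = x b \<otimes> w b"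
    and \<beta>: "\<And>b. b \<in> B \<Longrightarrow> \<beta> (x b) = x b \<otimes> w' b" and w: "deep w" "deep w'" and b: "b \<in> B"
  shows "close (cmp \<alpha> \<beta> (x b)) (x b \<otimes> (w b \<otimes> w' b))"
proof -
  have c: "w b \<in> carrier G" "w' b \<in> carrier G" using w b deep_closed by blast+
  have shift: "lcong (Suc k + k) (w' b) (\<alpha> (w' b))"
    using IA_shift[OF \<alpha>(1) _ _ deepD[OF w(2) b]] k by simp
  then have "close (\<alpha> (w' b)) (w' b)" 
    using lcong_sym[OF lcong_mono[OF shift, of "Suc (Suc k)"]] k by simp
  then have "close (x b \<otimes> w b \<otimes> \<alpha> (w' b)) (x b \<otimes> w b \<otimes> w' b)"
    using c by (intro lcong_mult[OF lcong_refl]) auto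
  then show ?thesis
    using IA_auto[OF \<alpha>(1)] \<alpha>(2)[OF b] \<beta>[OF b] c by (simp add: compose_eq auto_mult m_assoc)
qed

text \<open>Composition multiplies leading terms. With \<open>good_inv\<close>, the good deep
  families form a group under pointwise multiplication.\<close>

lemma good_mult:
  assumes "good w" "good w'" "deep w" "deep w'"
  shows "good (\<lambda>b. w b \<otimes> w' b)"
proof -
  obtain \<alpha> where \<alpha>: "\<alpha> \<in> IA k" "\<alpha> \<in> IA 1" "\<And>b. b \<in> B \<Longrightarrow> \<alpha> (x b) = x b \<otimes> w b" using realize[OF assms(3)] by blast
  obtain \<beta> where \<beta>: "\<beta> \<in> IA k" "\<beta> \<in> IA 1" "\<And>b. b \<in> B \<Longrightarrow> \<beta> (x b) = x b \<otimes> w' b" using realize[OF assms(4)] by blast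
  have "\<Delta> \<alpha> = \<alpha>" "\<Delta> \<beta> = \<beta>"
    using assms \<alpha> \<beta> deep_closed unfolding good_def by auto
  then show ?thesis
    using fixed_cancel[OF \<alpha>(2) \<beta>(2)]
    by (intro good_of_fixed[OF IA_compose[OF \<alpha>(1) \<beta>(1)]] compose_lcong[OF \<alpha>(1,3) \<beta>(3) assms(3,4)]) auto
qed

lemma good_inv:
  assumes "good w" "deep w"
  shows "good (\<lambda>b. inv (w b))"
proof -
  have d: "deep (\<lambda>b. inv (w b))" using assms(2) by (simp add: deep_def lower_central_inv)
  obtain \<alpha> where \<alpha>: "\<alpha> \<in> IA k" "\<alpha> \<in> IA 1" "\<And>b. b \<in> B \<Longrightarrow> \<alpha> (x b) = x b \<otimes> inv (w b)" using realize[OF d] by blast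
  obtain \<beta> where \<beta>: "\<beta> \<in> IA k" "\<beta> \<in> IA 1" "\<And>b. b \<in> B \<Longrightarrow> \<beta> (x b) = x b \<otimes> w b" using realize[OF assms(2)] by blast
  have "\<Delta> \<beta> = \<beta>"
    using assms \<beta> deep_closed unfolding good_def by auto
  moreover have "\<Delta> (cmp \<alpha> \<beta>) = cmp \<alpha> \<beta>"
  proof -
    have "close (cmp \<alpha> \<beta> (x b)) (x b \<otimes> \<one>)" if "b \<in> B" for b
      using compose_lcong[OF \<alpha>(1,3) \<beta>(3) d assms(2) that] deep_closed[OF assms(2) that] by simp
    then show ?thesis
      using good_one IA_compose[OF \<alpha>(2) \<beta>(2)] unfolding good_def by blast
  qed
  ultimately have "\<Delta> \<alpha> = \<alpha>" using fixed_cancel'[OF \<alpha>(2) \<beta>(2)] by blast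
  then show ?thesis using \<alpha>(3) deep_closed[OF assms(2)] by (intro good_of_fixed[OF \<alpha>(1)]) auto
qed

text \<open>\<open>w\<close> is the leading term of the commutator \<kappa> with
  \<open>K L = L K \<kappa>\<close>. By \<open>commutator_fixed\<close> it is fixed, and it lies in
  \<open>IA k\<close> because \<open>w\<close> is deep.\<close>

lemma good_commutator:
  assumes K: "K \<in> IA 1" and L: "L \<in> IA 1" and w: "deep w"
    and eq: "\<And>b. b \<in> B \<Longrightarrow> close (K (L (x b))) (L (K (x b)) \<otimes> w b)"
  shows "good w"
proof -
  note au = IA_auto[OF K] IA_auto[OF L]
  let ?M = "cmp L K"
  have M: "?M \<in> IA 1" by (rule IA_compose[OF L K])
  obtain \<kappa> where \<kappa>: "\<kappa> \<in> auto G" "cmp ?M \<kappa> = cmp K L"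
    by (rule auto_division[OF IA_auto[OF M] auto_compose[OF au]])
  have cong: "close (\<kappa> (x b)) (x b \<otimes> w b)" if b: "b \<in> B" for b
  proof (rule auto_lcong_cancel[OF IA_auto[OF M]])
    have wc: "w b \<in> carrier G" by (rule deep_closed[OF w b])
    have "close (?M (w b)) (w b)"
      using lcong_sym[OF IA_shift[OF M _ _ deepD[OF w b]]] by simp
    then have "close (L (K (x b)) \<otimes> w b) (L (K (x b)) \<otimes> ?M (w b))"
      using au by (intro lcong_mult[OF lcong_refl lcong_sym]) auto
    then have "close (K (L (x b))) (L (K (x b)) \<otimes> ?M (w b))"
      using eq[OF b] lcong_trans by blast
    moreover have "?M (\<kappa> (x b)) = K (L (x b))"
      using fun_cong[OF \<kappa>(2), of "x b"] by (simp add: compose_eq)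
    moreover have "?M (x b \<otimes> w b) = L (K (x b)) \<otimes> ?M (w b)"
      using au wc by (simp add: compose_eq auto_mult)
    ultimately show "close (?M (\<kappa> (x b))) (?M (x b \<otimes> w b))" by simp
  qed (use \<kappa> b deep_closed[OF w b] in auto)
  have "\<kappa> \<in> IA 1"
  proof (rule IA_generators[OF \<kappa>(1)])
    fix b assume b: "b \<in> B"
    have "lcong (Suc 1) (x b) (x b \<otimes> w b)"
      using deepD[OF w b] lower_centralD[of "w b" "Suc k" "Suc 1"] k by (intro lcong_mult_right) auto
    moreover have "lcong (Suc 1) (x b \<otimes> w b) (\<kappa> (x b))"
      using lcong_sym[OF lcong_mono[OF cong[OF b], of "Suc 1"]] by simp
    ultimately show "lcong (Suc 1) (x b) (\<kappa> (x b))" by (rule lcong_trans)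
  qed
  then show ?thesis
    using good_of_fixed[OF close_to_deep_IA[OF _ w cong]] commutator_fixed[OF K L _ \<kappa>(2)[symmetric]] cong by blast
qed

end

section \<open>The forest of spare generators\<close>

locale generator_tree = filtration_step G B x c \<Delta> k
  for G :: "('a, 'm) monoid_scheme" (structure) and B :: "'x set" and x c \<Delta> k +
  fixes ch :: "'x \<Rightarrow> nat \<Rightarrow> 'x"
  assumes ch_closed: "\<And>d i. d \<in> B \<Longrightarrow> ch d i \<in> B"
    and ch_inj: "\<And>d i d' i'. d \<in> B \<Longrightarrow> d' \<in> B \<Longrightarrow> ch d i = ch d' i' \<Longrightarrow> d = d' \<and> i = i'"
begin

text \<open>The levels are disjoint but need not exhaust the basis, as a generator may have an
  infinite line of ancestors; the families built below are \<one> there.\<close>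

primrec lev :: "nat \<Rightarrow> 'x set" where
  "lev 0 = {b \<in> B. \<forall>d\<in>B. \<forall>i. b \<noteq> ch d i}"
| "lev (Suc n) = {ch d i |d i. d \<in> lev n}"

abbreviation roots :: "'x set" where
  "roots \<equiv> lev 0"

lemma lev_subset: "lev n \<subseteq> B"
  by (induction n) (auto simp: ch_closed subset_iff)

lemma lev_basis: "d \<in> lev n \<Longrightarrow> d \<in> B"
  using lev_subset by blast

lemma lev_unique: "d \<in> lev m \<Longrightarrow> d \<in> lev n \<Longrightarrow> m = n"
proof (induction m arbitrary: d n)
  case 0
  show ?case
  proof (cases n)
    case (Suc l)
    then show ?thesis using 0 lev_basis by auto
  qed simp
next
  case (Suc m)
  then obtain e i where e: "e \<in> lev m" "d = ch e i" by auto
  show ?case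
  proof (cases n)
    case 0
    then show ?thesis using Suc.prems(2) e lev_basis by auto
  next
    case (Suc l)
    then obtain e' i' where e': "e' \<in> lev l" "d = ch e' i'" using Suc.prems(2) by auto
    then have "e = e'" using e ch_inj[OF lev_basis lev_basis] by blast
    then show ?thesis using Suc.IH[OF e(1)] e'(1) Suc by simp
  qed
qed

declare lev.simps(1) [simp del] lower_central.simps(3) [simp del]

lemma IA_realize_1:
  assumes "\<And>b. p b \<in> \<gamma> (Suc 1)"
  shows "\<exists>\<alpha>. \<alpha> \<in> IA 1 \<and> (\<forall>b\<in>B. \<alpha> (x b) = x b \<otimes> p b)"
proof (rule IA_realize[of 1 p])
  show "\<exists>\<alpha>. \<alpha> \<in> IA 1 \<and> (\<forall>b\<in>B. \<alpha> (x b) = x b \<otimes> p b)"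
    if "\<alpha> \<in> IA 1" "\<And>b. b \<in> B \<Longrightarrow> \<alpha> (x b) = x b \<otimes> p b" for \<alpha>
    using that by blast
qed (use assms in auto)

definition parent :: "'x \<Rightarrow> 'x" where
  "parent e = (SOME d. d \<in> B \<and> (\<exists>i. e = ch d i))"

definition index :: "'x \<Rightarrow> nat" where
  "index e = (SOME i. e = ch (parent e) i)"

lemma parent_ch: "d \<in> B \<Longrightarrow> parent (ch d i) = d"
  unfolding parent_def by (rule some_equality) (use ch_inj in blast)+

lemma index_ch: "d \<in> B \<Longrightarrow> index (ch d i) = i"
  unfolding index_def parent_ch by (rule some_equality) (use ch_inj in blast)+

text \<open>A choice fixed once, so that \<open>push\<close> and \<open>pull\<close> refer to the
  same factorization.\<close>

definition factors :: "nat \<Rightarrow> 'a \<Rightarrow> ('a \<times> 'x) list" where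
  "factors n t = (SOME l. (\<forall>(u, b)\<in>set l. span_from (lev n) roots k u \<and> b \<in> roots) \<and>
     close t (brackets l))"

lemma factors:
  assumes "span_from (lev n) roots (Suc k) t"
  shows "\<forall>(u, b)\<in>set (factors n t). span_from (lev n) roots k u \<and> b \<in> roots"
    and "close t (brackets (factors n t))"
  using someI_ex[OF span_from_brackets[OF assms refl]] k unfolding factors_def by auto

fun child_prod :: "'x \<Rightarrow> nat \<Rightarrow> ('a \<times> 'x) list \<Rightarrow> 'a" where
  "child_prod d i [] = \<one>"
| "child_prod d i ((u, b) # l) = gcomm (x (ch d i)) (x b) \<otimes> child_prod d (Suc i) l"

text \<open>
  If \<open>t d\<close> is the product of the brackets \<open>[u\<^sub>i, x b\<^sub>i]\<close>, then \<open>push\<close> multiplies \<open>x d\<close> by the product of the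
  \<open>[x (ch d i), x b\<^sub>i]\<close> and \<open>pull\<close> multiplies \<open>x (ch d i)\<close> by \<open>u\<^sub>i\<close>. Their commutator trades \<open>t\<close> on level
  \<open>n\<close> for the action of \<open>push\<close> on \<open>pull\<close> on level \<open>n + 1\<close>.
\<close>

definition push :: "nat \<Rightarrow> ('x \<Rightarrow> 'a) \<Rightarrow> 'x \<Rightarrow> 'a" where
  "push n t d = child_prod d 0 (factors n (t d))"

definition pull :: "nat \<Rightarrow> ('x \<Rightarrow> 'a) \<Rightarrow> 'x \<Rightarrow> 'a" where
  "pull n t e = (let l = factors n (t (parent e)) in
     if index e < length l then fst (l ! index e) else \<one>)"

text \<open>Moves a single level, so that \<open>target\<close> can be defined by recursion on
  levels; \<open>good_levels\<close> compares it with one automorphism for all levels.\<close>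

definition push_aut :: "nat \<Rightarrow> ('x \<Rightarrow> 'a) \<Rightarrow> 'a \<Rightarrow> 'a" where
  "push_aut n t = (SOME \<alpha>. \<alpha> \<in> IA 1 \<and> (\<forall>b\<in>B. \<alpha> (x b) = x b \<otimes> (if b \<in> lev n then push n t b else \<one>)))"

text \<open>The error that has arrived on level \<open>n\<close> after \<open>n\<close>
  trades.\<close>

primrec target :: "('x \<Rightarrow> 'a) \<Rightarrow> nat \<Rightarrow> 'x \<Rightarrow> 'a" where
  "target w 0 = (\<lambda>b. if b \<in> roots then w b else \<one>)"
| "target w (Suc n) = (\<lambda>e. if e \<in> lev (Suc n)
     then inv (pull n (target w n) e) \<otimes> push_aut n (target w n) (pull n (target w n) e) else \<one>)"

definition level_ok :: "nat \<Rightarrow> ('x \<Rightarrow> 'a) \<Rightarrow> bool" where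
  "level_ok n t \<longleftrightarrow> (\<forall>d\<in>lev n. span_from (lev n) roots (Suc k) (t d))"

lemma child_prod_lam:
  "d \<in> lev n \<Longrightarrow> \<forall>(u, b)\<in>set l. b \<in> roots \<Longrightarrow> span_from (lev (Suc n)) roots 2 (child_prod d i l)"
proof (induction d i l rule: child_prod.induct)
  case (2 d i u b l)
  have "ch d i \<in> lev (Suc n)" using 2(2) by auto
  then have "span_from (lev (Suc n)) roots (Suc (Suc 0)) (gcomm (x (ch d i)) (x b))"
    by (intro span_from.bracket span_from.base) (use 2 in auto)
  then show ?case using 2 by (auto intro!: span_from.mult simp: numeral_2_eq_2)
qed (simp add: span_from_one)

lemma push_lam:
  assumes "level_ok n t" "d \<in> lev n" shows "span_from (lev (Suc n)) roots 2 (push n t d)"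
  unfolding push_def
proof (rule child_prod_lam[OF assms(2)])
  show "\<forall>(u, b)\<in>set (factors n (t d)). b \<in> roots"
    using factors(1)[of n "t d"] assms by (auto simp: level_ok_def)
qed

lemma pull_lam:
  assumes "level_ok n t" "e \<in> lev (Suc n)" shows "span_from (lev n) roots k (pull n t e)"
proof -
  obtain d i where d: "d \<in> lev n" "e = ch d i" using assms(2) by auto
  have p: "parent e = d" "index e = i" using d parent_ch index_ch lev_basis by auto
  show ?thesis
  proof (cases "i < length (factors n (t d))")
    case True
    have "factors n (t d) ! i \<in> set (factors n (t d))" using True by simp
    then have "span_from (lev n) roots k (fst (factors n (t d) ! i))"
      using factors(1)[of n "t d"] assms(1) d(1) by (fastforce simp: level_ok_def split: prod.splits)
    then show ?thesis using True by (simp add: pull_def p)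
  next
    case False
    then show ?thesis using k by (simp add: pull_def p span_from_one)
  qed
qed

lemma push_aut:
  assumes "level_ok n t"
  shows "push_aut n t \<in> IA 1"
    and "\<And>b. b \<in> B \<Longrightarrow> push_aut n t (x b) = x b \<otimes> (if b \<in> lev n then push n t b else \<one>)"
proof -
  have "(if b \<in> lev n then push n t b else \<one>) \<in> \<gamma> (Suc 1)" for b
    using span_from_lower_central[OF push_lam[OF assms, of b]] by (auto simp: numeral_2_eq_2)
  from IA_realize_1[of "\<lambda>b. if b \<in> lev n then push n t b else \<one>", OF this]
  have "\<exists>\<alpha>. \<alpha> \<in> IA 1 \<and> (\<forall>b\<in>B. \<alpha> (x b) = x b \<otimes> (if b \<in> lev n then push n t b else \<one>))" .
  from someI_ex[OF this] show "push_aut n t \<in> IA 1"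
    "\<And>b. b \<in> B \<Longrightarrow> push_aut n t (x b) = x b \<otimes> (if b \<in> lev n then push n t b else \<one>)"
    unfolding push_aut_def by auto
qed

text \<open>\<open>pull\<close> consists of words starting on level \<open>n\<close>, and
  \<open>push\<close> turns their first entry into brackets starting on level \<open>n + 1\<close>.
  So all later letters remain roots, and the next trade is possible.\<close>

lemma level_ok_Suc:
  assumes "level_ok n (target w n)"
  shows "level_ok (Suc n) (target w (Suc n))"
  unfolding level_ok_def
proof
  fix e assume e: "e \<in> lev (Suc n)"
  let ?t = "target w n"
  note \<alpha> = push_aut[OF assms]
  have inc: "inv (x b) \<otimes> push_aut n ?t (x b) = (if b \<in> lev n then push n ?t b else \<one>)" if "b \<in> B" for b
    using \<alpha>(2)[OF that] span_from_closed[OF push_lam[OF assms, of b]] by (auto simp: group_word_simps)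
  have "span_from (lev (Suc n)) roots (Suc k) (inv (pull n ?t e) \<otimes> push_aut n ?t (pull n ?t e))"
  proof (rule span_from_increment[OF \<alpha>(1) _ _ _ pull_lam[OF assms e]])
    show "span_from (lev (Suc n)) roots 2 (inv (x y) \<otimes> push_aut n ?t (x y))" if "y \<in> lev n" for y
      using inc[OF lev_basis[OF that]] push_lam[OF assms that] that by simp
    show "span_from (lev (Suc n)) roots 2 (inv (x b) \<otimes> push_aut n ?t (x b))" if "b \<in> roots" for b
      unfolding inc[OF lev_basis[OF that]] using push_lam[OF assms, of b] by (simp add: span_from_one)
    \<comment> \<open>On level 0 the first entries are roots themselves; on higher levels
      \<open>push\<close> leaves the roots alone.\<close>
    show "lev n = roots \<or> (\<forall>b\<in>roots. push_aut n ?t (x b) = x b)"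
    proof (cases n)
      case (Suc l)
      have "push_aut n ?t (x b) = x b" if "b \<in> roots" for b
        using \<alpha>(2)[OF lev_basis[OF that]] lev_unique[OF that, of n] Suc by (auto split: if_splits)
      then show ?thesis by blast
    qed simp
  qed
  then show "span_from (lev (Suc n)) roots (Suc k) (target w (Suc n) e)" using e by simp
qed

definition admissible :: "('x \<Rightarrow> 'a) \<Rightarrow> bool" where
  "admissible w \<longleftrightarrow> (\<forall>b\<in>roots. span_from roots roots (Suc k) (w b))"

lemma level_ok_target: "admissible w \<Longrightarrow> level_ok n (target w n)"
proof (induction n)
  case 0
  then show ?case by (simp add: level_ok_def admissible_def)
next
  case (Suc n)
  then show ?case using level_ok_Suc by blast
qed

definition level_of :: "'x \<Rightarrow> nat" where
  "level_of b = (SOME n. b \<in> lev n)"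

lemma level_of: "b \<in> lev n \<Longrightarrow> level_of b = n"
  unfolding level_of_def using lev_unique by blast

definition on_levels :: "nat set \<Rightarrow> (nat \<Rightarrow> 'x \<Rightarrow> 'a) \<Rightarrow> 'x \<Rightarrow> 'a" where
  "on_levels I t b = (if b \<in> (\<Union>n\<in>I. lev n) then t (level_of b) b else \<one>)"

lemma on_levels_in: "b \<in> lev n \<Longrightarrow> n \<in> I \<Longrightarrow> on_levels I t b = t n b"
  by (auto simp: on_levels_def level_of)

lemma on_levels_out: "(\<And>n. n \<in> I \<Longrightarrow> b \<notin> lev n) \<Longrightarrow> on_levels I t b = \<one>"
  by (auto simp: on_levels_def)

lemma on_levels_lower_central:
  assumes "\<And>n b. n \<in> I \<Longrightarrow> b \<in> lev n \<Longrightarrow> t n b \<in> \<gamma> m"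
  shows "on_levels I t b \<in> \<gamma> m"
  using assms by (auto simp: on_levels_def level_of)

text \<open>\<open>[y u, x b]\<close> is \<open>[u, x b] [y, x b]\<close> up to conjugation, and
  \<open>[u, x b]\<close> is central modulo \<gamma> (k + 2), so these factors can be collected on
  the right.\<close>

lemma child_prod_image:
  assumes L: "L \<in> IA 1" and fix_roots: "\<And>b. b \<in> roots \<Longrightarrow> L (x b) = x b"
    and d: "d \<in> B" and l: "\<forall>(u, b)\<in>set l. u \<in> \<gamma> k \<and> b \<in> roots"
    and ch: "\<And>j. j < length l \<Longrightarrow> L (x (ch d (i + j))) = x (ch d (i + j)) \<otimes> fst (l ! j)"
  shows "close (L (child_prod d i l)) (child_prod d i l \<otimes> brackets l)"
  using l ch
proof (induction l arbitrary: i)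
  case Nil
  then show ?case using IA_auto[OF L] by simp
next
  case (Cons p l)
  obtain u b where p: "p = (u, b)" by (cases p)
  let ?y = "x (ch d i)" and ?C = "child_prod d (Suc i) l" and ?R = "brackets l"
  have u: "u \<in> \<gamma> k" "u \<in> carrier G" "b \<in> roots"
    using Cons.prems(1) p lower_central_closed by auto
  have L0: "L ?y = ?y \<otimes> u" using Cons.prems(2)[of 0] p by simp
  have l: "\<forall>(u, b)\<in>set l. u \<in> \<gamma> k \<and> b \<in> roots" using Cons.prems(1) by simp
  have Cc: "child_prod d j l' \<in> carrier G" for j l'
    by (induction d j l' rule: child_prod.induct) auto
  have Rc: "?R \<in> \<gamma> (Suc k)"
    using k l by (intro brackets_lower_central) fastforce+
  have Rcl: "?R \<in> carrier G" using Rc lower_central_closed by blast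
  have ub: "gcomm u (x b) \<in> \<gamma> (Suc k)" "gcomm u (x b) \<in> carrier G"
    using gcomm_lower_central_Suc[OF _ u(1)] k u(2) by auto
  have IH: "close (L ?C) (?C \<otimes> ?R)"
    using Cons.prems(2)[of "Suc j" for j] by (intro Cons.IH[OF l]) fastforce
  have "L (gcomm ?y (x b)) = (?y \<otimes> gcomm u (x b) \<otimes> inv ?y) \<otimes> gcomm ?y (x b)"
    using IA_auto[OF L] fix_roots[OF u(3)] L0 u gcomm_mult_left[of ?y u "x b"] by (simp add: auto_gcomm)
  also have "close \<dots> (gcomm u (x b) \<otimes> gcomm ?y (x b))"
    using k ub by (intro lcong_mult[OF lcong_conj[of "Suc k"]]) auto
  finally have "close (L (gcomm ?y (x b)) \<otimes> L ?C) (gcomm u (x b) \<otimes> gcomm ?y (x b) \<otimes> (?C \<otimes> ?R))"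
    by (rule lcong_mult[OF _ IH])
  also have "gcomm u (x b) \<otimes> gcomm ?y (x b) \<otimes> (?C \<otimes> ?R) = gcomm u (x b) \<otimes> (gcomm ?y (x b) \<otimes> ?C) \<otimes> ?R"
    using ub Cc Rcl by (simp add: m_assoc)
  also have "close \<dots> ((gcomm ?y (x b) \<otimes> ?C) \<otimes> gcomm u (x b) \<otimes> ?R)"
    using ub Cc Rcl by (intro lcong_mult[OF lcong_commute[of "Suc k" 1]]) auto
  finally show ?case
    using IA_auto[OF L] ub Cc Rcl by (simp add: p auto_mult m_assoc)
qed

text \<open>\<open>K\<close> performs \<open>push\<close> and \<open>L\<close> performs
  \<open>pull\<close> on all levels of \<open>I\<close> at once. In \<open>K L\<close> the factor
  \<open>q\<close> moves by the errors on the next levels, in \<open>L K\<close> the factor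
  \<open>p\<close> moves by the old errors, and the commutator compares the two. If 0 is in
  \<open>I\<close>, then \<open>K\<close> moves roots, which are later letters of the words on all
  levels; hence the condition on \<open>I\<close>.\<close>

lemma good_levels:
  assumes w: "admissible w" and I: "0 \<in> I \<Longrightarrow> I = {0}"
  shows "good (\<lambda>b. inv (on_levels I (target w) b) \<otimes> on_levels (Suc ` I) (target w) b)"
    and "deep (on_levels I (target w))"
proof -
  let ?T = "target w"
  note ok = level_ok_target[OF w]
  have T: "?T n b \<in> \<gamma> (Suc k)" if "b \<in> lev n" for n b
    using ok that span_from_lower_central unfolding level_ok_def by blast
  have tA: "on_levels J ?T b \<in> \<gamma> (Suc k)" for J b
    by (rule on_levels_lower_central) (rule T)
  then show "deep (on_levels I ?T)" by (simp add: deep_def)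
  define p where "p = on_levels I (\<lambda>n. push n (?T n))"
  define q where "q = on_levels (Suc ` I) (\<lambda>m. pull (m - 1) (?T (m - 1)))"
  have p: "p b \<in> \<gamma> (Suc 1)" for b
    unfolding p_def using span_from_lower_central[OF push_lam[OF ok]] by (intro on_levels_lower_central) (auto simp: numeral_2_eq_2)
  have q: "q b \<in> \<gamma> k" for b
    unfolding q_def using span_from_lower_central[OF pull_lam[OF ok]] by (intro on_levels_lower_central) auto
  have q2: "q b \<in> \<gamma> (Suc 1)" for b
    using lower_centralD[OF q[of b], of "Suc 1"] k by simp
  have pc: "p b \<in> carrier G" and qc: "q b \<in> carrier G" for b
    using p q lower_central_closed by blast+
  obtain K where K: "K \<in> IA 1" "\<And>b. b \<in> B \<Longrightarrow> K (x b) = x b \<otimes> p b"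
    using IA_realize_1[of p, OF p] by blast
  obtain L where L: "L \<in> IA 1" "\<And>b. b \<in> B \<Longrightarrow> L (x b) = x b \<otimes> q b"
    using IA_realize_1[of q, OF q2] by blast
  note au = IA_auto[OF K(1)] IA_auto[OF L(1)]
  have L_roots: "L (x b) = x b" if "b \<in> roots" for b
  proof -
    have "b \<notin> lev n" if "n \<in> Suc ` I" for n using that lev_unique[OF \<open>b \<in> roots\<close>, of n] by auto
    then have "q b = \<one>" unfolding q_def by (rule on_levels_out)
    then show ?thesis using L(2)[OF lev_basis[OF that]] by simp
  qed
  have Kq: "close (K (q b)) (q b \<otimes> on_levels (Suc ` I) ?T b)" for b
  proof (cases "\<exists>n\<in>I. b \<in> lev (Suc n)")
    case True
    then obtain n where n: "n \<in> I" "b \<in> lev (Suc n)" by blast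
    have qb: "q b = pull n (?T n) b" unfolding q_def using n by (subst on_levels_in[of b "Suc n"]) auto
    have t: "on_levels (Suc ` I) ?T b = inv (q b) \<otimes> push_aut n (?T n) (q b)"
      using n qb on_levels_in[of b "Suc n" "Suc ` I" ?T] by simp
    have span_from: "span_from (lev n) roots k (q b)" unfolding qb by (rule pull_lam[OF ok n(2)])
    note P = push_aut[OF ok[of n]]
    \<comment> \<open>\<open>q b\<close> involves only level \<open>n\<close> and the roots, and
      there \<open>K\<close> and \<open>push_aut n\<close> agree.\<close>
    have "close (K (q b)) (push_aut n (?T n) (q b))"
    proof (rule span_from_agree[OF K(1) P(1) _ _ span_from])
      show 1: "K (x y) = push_aut n (?T n) (x y)" if "y \<in> lev n" for y
        using K(2) P(2) lev_basis[OF that] that n(1) by (simp add: p_def on_levels_in)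
      show "K (x y) = push_aut n (?T n) (x y)" if y: "y \<in> roots" for y
      proof (cases "n = 0")
        case False
        then have "0 \<notin> I" using I n(1) by blast
        then have "y \<notin> lev m" if "m \<in> I" for m
          using that lev_unique[OF y, of m] by (cases m) auto
        then have "p y = \<one>" unfolding p_def by (rule on_levels_out)
        moreover have "y \<notin> lev n" using False lev_unique[OF y] by blast
        ultimately show ?thesis using K(2) P(2) lev_basis[OF y] by simp
      qed (use 1 y in simp)
    qed
    then show ?thesis
      unfolding t using qc[of b] IA_auto[OF P(1)] by (simp add: group_word_simps)
  next
    case False
    then have none: "b \<notin> lev m" if "m \<in> Suc ` I" for m using that by blast
    have "q b = \<one>" "on_levels (Suc ` I) ?T b = \<one>"
      unfolding q_def by (rule on_levels_out, rule none, assumption)+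
    then show ?thesis using au by simp
  qed
  have Lp: "close (L (p b)) (p b \<otimes> on_levels I ?T b)" for b
  proof (cases "\<exists>n\<in>I. b \<in> lev n")
    case True
    then obtain n where n: "n \<in> I" "b \<in> lev n" by blast
    let ?l = "factors n (?T n b)"
    have span_from: "span_from (lev n) roots (Suc k) (?T n b)" using ok n(2) unfolding level_ok_def by blast
    have pb: "p b = child_prod b 0 ?l" unfolding p_def using n by (simp add: on_levels_in push_def)
    have t: "on_levels I ?T b = ?T n b" by (rule on_levels_in[OF n(2,1)])
    have b: "b \<in> B" using lev_basis n(2) by blast
    have "close (L (p b)) (p b \<otimes> brackets ?l)"
      unfolding pb
    proof (rule child_prod_image[OF L(1) L_roots b])
      show "\<forall>(u, b)\<in>set ?l. u \<in> \<gamma> k \<and> b \<in> roots"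
        using factors(1)[OF span_from] span_from_lower_central by fastforce
      fix j assume j: "j < length ?l"
      have e: "ch b j \<in> lev (Suc n)" using n(2) by auto
      have "q (ch b j) = pull n (?T n) (ch b j)"
        unfolding q_def using n e by (subst on_levels_in[of _ "Suc n"]) auto
      also have "\<dots> = fst (?l ! j)"
        using j b by (simp add: pull_def parent_ch index_ch)
      finally show "L (x (ch b (0 + j))) = x (ch b (0 + j)) \<otimes> fst (?l ! j)"
        using L(2)[OF lev_basis[OF e]] by simp
    qed
    also have "close (p b \<otimes> brackets ?l) (p b \<otimes> on_levels I ?T b)"
      unfolding t by (rule lcong_mult[OF lcong_refl[OF pc] lcong_sym[OF factors(2)[OF span_from]]])
    finally show ?thesis .
  next
    case False
    then have none: "b \<notin> lev m" if "m \<in> I" for m using that by blast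
    have "p b = \<one>" "on_levels I ?T b = \<one>"
      unfolding p_def by (rule on_levels_out, rule none, assumption)+
    then show ?thesis using au by simp
  qed
  show "good (\<lambda>b. inv (on_levels I ?T b) \<otimes> on_levels (Suc ` I) ?T b)"
  proof (rule good_commutator[OF K(1) L(1)])
    show "deep (\<lambda>b. inv (on_levels I ?T b) \<otimes> on_levels (Suc ` I) ?T b)"
      unfolding deep_def using tA by (blast intro: lower_central_mult lower_central_inv)
    fix b assume b: "b \<in> B"
    let ?s = "on_levels I ?T b" and ?s' = "on_levels (Suc ` I) ?T b"
    have sc: "?s \<in> carrier G" "?s' \<in> carrier G" using tA lower_central_closed by blast+
    have "K (L (x b)) = x b \<otimes> p b \<otimes> K (q b)"
      using K(2)[OF b] L(2)[OF b] au qc by (simp add: auto_mult)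
    also have "close \<dots> (x b \<otimes> p b \<otimes> (q b \<otimes> ?s'))"
      using pc by (intro lcong_mult[OF lcong_refl Kq]) auto
    also have "x b \<otimes> p b \<otimes> (q b \<otimes> ?s') = x b \<otimes> (p b \<otimes> q b) \<otimes> ?s'"
      using pc qc sc by (simp add: m_assoc)
    \<comment> \<open>\<open>p b\<close> lies in \<gamma> 2 and \<open>q b\<close> in \<gamma> k, so
      they commute modulo \<gamma> (k + 2).\<close>
    also have "close \<dots> (x b \<otimes> (q b \<otimes> p b) \<otimes> ?s')"
      using k p q sc qc pc by (intro lcong_mult[OF lcong_mult[OF lcong_refl lcong_commute[of "Suc 1" k]]]) auto
    also have "x b \<otimes> (q b \<otimes> p b) \<otimes> ?s' = x b \<otimes> q b \<otimes> (p b \<otimes> ?s) \<otimes> (inv ?s \<otimes> ?s')"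
      using pc qc sc by (simp add: group_word_simps)
    also have "close \<dots> (x b \<otimes> q b \<otimes> L (p b) \<otimes> (inv ?s \<otimes> ?s'))"
      using pc qc sc by (intro lcong_mult[OF lcong_mult[OF lcong_refl lcong_sym[OF Lp]]]) auto
    also have "x b \<otimes> q b \<otimes> L (p b) \<otimes> (inv ?s \<otimes> ?s') = L (K (x b)) \<otimes> (inv ?s \<otimes> ?s')"
      using K(2)[OF b] L(2)[OF b] au pc by (simp add: auto_mult)
    finally show "close (K (L (x b))) (L (K (x b)) \<otimes> (inv ?s \<otimes> ?s'))" .
  qed
qed

text \<open>
  The commutator supported on the roots replaces \<open>w\<close> by an element supported on the first level,
  and a second commutator, along the whole tree above the first level, removes that element.
\<close>

lemma good_admissible:
  assumes w: "admissible w" and out: "\<And>b. b \<in> B \<Longrightarrow> b \<notin> roots \<Longrightarrow> w b = \<one>"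
  shows "good w"
proof -
  let ?T = "target w" and ?I = "{n. n > (0::nat)}"
  let ?f = "\<lambda>I b. inv (on_levels I ?T b) \<otimes> on_levels (Suc ` I) ?T b"
  have cl: "on_levels J ?T b \<in> \<gamma> (Suc k)" for J b
    by (rule on_levels_lower_central)
      (use level_ok_target[OF w] span_from_lower_central in \<open>unfold level_ok_def, blast\<close>)
  have deep: "deep (?f J)" for J
    unfolding deep_def using cl by (blast intro: lower_central_mult lower_central_inv)
  have deep_w: "deep (on_levels {0} ?T)" by (rule good_levels(2)[OF w]) simp
  have "good (\<lambda>b. ?f {0} b \<otimes> ?f ?I b)"
    by (intro good_mult deep good_levels(1)[OF w]) auto
  \<comment> \<open>On level 1 the error made by the first commutator meets its inverse from the
    second; on each higher level the second contributes both the error and its inverse. Only level 0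
    survives.\<close>
  moreover have "?f {0} b \<otimes> ?f ?I b = inv (on_levels {0} ?T b)" for b
  proof (cases "\<exists>n. b \<in> lev n")
    case True
    then obtain n where n: "b \<in> lev n" by blast
    have val: "on_levels J ?T b = (if n \<in> J then ?T n b else \<one>)" for J
      using on_levels_in[OF n, of J ?T] on_levels_out[of J b ?T] lev_unique[OF n] by auto
    have tc: "?T n b \<in> carrier G" using val[of "{n}"] cl[of "{n}" b] lower_central_closed by simp
    consider "n = 0" | "n = 1" | "n > 1" by linarith
    then show ?thesis
    proof cases
      case 3
      then have "n \<in> Suc ` ?I" "n \<notin> Suc ` {0}" by (auto intro!: image_eqI[of _ _ "n - 1"])
      then show ?thesis using 3 tc unfolding val by simp
    qed (use tc in \<open>auto simp: val simp del: target.simps\<close>)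
  next
    case False
    then have "on_levels J ?T b = \<one>" for J by (intro on_levels_out) blast
    then show ?thesis by simp
  qed
  ultimately have "good (\<lambda>b. inv (on_levels {0} ?T b))" by simp
  moreover have "deep (\<lambda>b. inv (on_levels {0} ?T b))" using deep_w by (simp add: deep_def lower_central_inv)
  ultimately have "good (\<lambda>b. inv (inv (on_levels {0} ?T b)))" by (rule good_inv)
  then show ?thesis
  proof (rule good_cong)
    fix b assume b: "b \<in> B"
    have "on_levels {0} ?T b = w b"
      using out[OF b] by (cases "b \<in> roots") (simp_all add: on_levels_def level_of)
    moreover have "on_levels {0} ?T b \<in> carrier G" using cl lower_central_closed by blast
    ultimately show "close (inv (inv (on_levels {0} ?T b))) (w b)" by simp
  qed
qed

end

text \<open>Encodes a parent, the number of a child and its colour in one generator; cardinal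
  arithmetic covers uncountable bases as well.\<close>

lemma infinite_times_countable_inj:
  assumes "infinite B"
  shows "\<exists>f :: 'b \<times> nat \<times> nat \<Rightarrow> 'b. inj_on f (B \<times> UNIV) \<and> f ` (B \<times> UNIV) \<subseteq> B"
proof -
  have "(card_of (UNIV :: (nat \<times> nat) set), card_of (UNIV :: nat set)) \<in> ordLeq"
    unfolding card_of_ordLeq[symmetric] using inj_prod_encode[of UNIV] by blast
  moreover have "(card_of (UNIV :: nat set), card_of B) \<in> ordLeq"
    using assms infinite_iff_card_of_nat by blast
  ultimately have "(card_of (UNIV :: (nat \<times> nat) set), card_of B) \<in> ordLeq"
    by (rule ordLeq_transitive)
  then have "(card_of (B \<times> (UNIV :: (nat \<times> nat) set)), card_of B) \<in> ordIso"
    using assms by (intro conjunct1[OF card_of_Times_infinite]) auto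
  then have "(card_of (B \<times> (UNIV :: (nat \<times> nat) set)), card_of B) \<in> ordLeq" by (rule ordIso_imp_ordLeq)
  then show ?thesis unfolding card_of_ordLeq[symmetric] .
qed

context filtration_step
begin

text \<open>
  The children of colour \<open>j\<close> form one of infinitely many disjoint parts of the basis. A word of
  length \<open>k + 1\<close> together with one further letter meets fewer than \<open>k + 3\<close> of these parts.
\<close>

lemma good_deep:
  assumes w: "deep w"
  shows "good w"
proof -
  obtain \<theta> :: "'x \<times> nat \<times> nat \<Rightarrow> 'x" where \<theta>: "inj_on \<theta> (B \<times> UNIV)" "\<theta> ` (B \<times> UNIV) \<subseteq> B"
    using infinite_times_countable_inj[OF infinite_basis] by blast
  have \<theta>_inj: "d = d' \<and> i = i' \<and> j = j'"
    if "d \<in> B" "d' \<in> B" "\<theta> (d, i, j) = \<theta> (d', i', j')" for d d' i i' j j'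
    using inj_onD[OF \<theta>(1) that(3)] that(1,2) by auto
  have tree: "generator_tree G B x c \<Delta> k (\<lambda>d i. \<theta> (d, i, j))" for j
  proof unfold_locales
    show "\<theta> (d, i, j) \<in> B" if "d \<in> B" for d i using \<theta>(2) that by blast
  qed (use \<theta>_inj in blast)
  define part where "part = (\<lambda>j. {\<theta> (d, i, j) |d i. d \<in> B})"
  have parts: "j = j'" if "b \<in> part j" "b \<in> part j'" for b j j'
    using that \<theta>_inj unfolding part_def by blast
  define avoids where "avoids = (\<lambda>v j. set v \<inter> part j = {})"
  \<comment> \<open>Pigeonhole: the parts are disjoint, so a word meets at most as many of them as
    it has letters.\<close>
  have avoidable: "\<exists>j<Suc (length v). avoids v j" for v
  proof (rule ccontr)
    assume "\<not> (\<exists>j<Suc (length v). avoids v j)"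
    then have "\<forall>j\<in>{..<Suc (length v)}. \<exists>b. b \<in> set v \<and> b \<in> part j" by (auto simp: avoids_def)
    then obtain h where h: "\<And>j. j < Suc (length v) \<Longrightarrow> h j \<in> set v \<and> h j \<in> part j" by (metis lessThan_iff)
    have "inj_on h {..<Suc (length v)}"
      using h parts by (metis inj_onI lessThan_iff)
    moreover have "h ` {..<Suc (length v)} \<subseteq> set v" using h by auto
    ultimately have "card {..<Suc (length v)} \<le> card (set v)" by (rule card_inj_on_le) simp
    then show False using card_length[of v] by simp
  qed
  \<comment> \<open>Avoiding \<open>b\<close> too ensures that factors of colour \<open>j\<close>
    occur only at roots of the tree of colour \<open>j\<close>.\<close>
  define colour where "colour = (\<lambda>b v. LEAST j. avoids (b # v) j)"
  have colour: "avoids (b # v) (colour b v)" "colour b v < length v + 2" for b v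
  proof -
    obtain j where j: "j < Suc (length (b # v))" "avoids (b # v) j" using avoidable by blast
    show "avoids (b # v) (colour b v)" unfolding colour_def using LeastI[of "avoids (b # v)"] j(2) .
    show "colour b v < length v + 2" using Least_le[of "avoids (b # v)", OF j(2)] j(1) by (simp add: colour_def)
  qed
  have "\<exists>xs. words (Suc k) xs \<and> close (w b) (word_prod x xs)" if "b \<in> B" for b
    using lower_central_words[OF _ deepD[OF w that]] by blast
  then obtain X where X: "\<And>b. b \<in> B \<Longrightarrow> words (Suc k) (X b)"
    "\<And>b. b \<in> B \<Longrightarrow> close (w b) (word_prod x (X b))" by metis
  have hom: "homogeneous (Suc k) (filter P (X b))" if "b \<in> B" for P b
    using words_homogeneous[OF X(1)[OF that]] homogeneous_filter by simp
  have deep_filter: "deep (\<lambda>b. word_prod x (filter (P b) (X b)))" for P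
    unfolding deep_def using hom word_prod_lower_central by blast
  have good_part: "good (\<lambda>b. word_prod x (filter (\<lambda>(s, v). colour b v = j) (X b)))" for j
  proof -
    interpret T: generator_tree G B x c \<Delta> k "\<lambda>d i. \<theta> (d, i, j)" by (rule tree)
    have roots: "T.roots = B - part j" by (auto simp: T.lev.simps(1) part_def)
    show ?thesis
    proof (rule T.good_admissible)
      show "T.admissible (\<lambda>b. word_prod x (filter (\<lambda>(s, v). colour b v = j) (X b)))"
        unfolding T.admissible_def
      proof
        fix b assume "b \<in> T.roots"
        then have b: "b \<in> B" by (simp add: roots)
        have "length v = Suc k \<and> set v \<subseteq> T.roots" if "(s, v) \<in> set (X b)" "colour b v = j" for s v
        proof -
          have "length v = Suc k" "set v \<subseteq> B" using X(1)[OF b] that(1) by (auto simp: words_def)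
          then show ?thesis using colour(1)[of b v] that(2) by (auto simp: roots avoids_def)
        qed
        then show "span_from T.roots T.roots (Suc k) (word_prod x (filter (\<lambda>(s, v). colour b v = j) (X b)))"
          by (intro span_from_word_prod) auto
      qed
      fix b assume "b \<in> B" "b \<notin> T.roots"
      then have "b \<in> part j" by (simp add: roots)
      then have "colour b v \<noteq> j" for v using colour(1)[of b v] by (auto simp: avoids_def)
      then show "word_prod x (filter (\<lambda>(s, v). colour b v = j) (X b)) = \<one>"
        by (simp add: case_prod_beta)
    qed
  qed
  have "good (\<lambda>b. word_prod x (filter (\<lambda>(s, v). colour b v < J) (X b)))" for J
  proof (induction J)
    case 0
    show ?case using good_one by (simp add: case_prod_beta)
  next
    case (Suc J)
    have "good (\<lambda>b. word_prod x (filter (\<lambda>(s, v). colour b v < J) (X b))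
       \<otimes> word_prod x (filter (\<lambda>(s, v). colour b v = J) (X b)))"
      by (rule good_mult[OF Suc good_part deep_filter deep_filter])
    then show ?case
    proof (rule good_cong)
      fix b assume b: "b \<in> B"
      let ?xs = "filter (\<lambda>(s, v). colour b v < Suc J) (X b)" and ?P = "\<lambda>(s, v). colour b v < J"
      have f: "filter ?P ?xs = filter (\<lambda>(s, v). colour b v < J) (X b)"
        "filter (\<lambda>p. \<not> ?P p) ?xs = filter (\<lambda>(s, v). colour b v = J) (X b)"
        by (auto intro!: filter_cong simp: filter_filter)
      show "close (word_prod x (filter (\<lambda>(s, v). colour b v < J) (X b))
          \<otimes> word_prod x (filter (\<lambda>(s, v). colour b v = J) (X b))) (word_prod x ?xs)"
        using lcong_sym[OF word_prod_filter[OF _ hom[OF b], of "\<lambda>(s, v). colour b v < Suc J" ?P]]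
        unfolding f by simp
    qed
  qed
  from this[of "k + 3"] show ?thesis
  proof (rule good_cong)
    fix b assume b: "b \<in> B"
    have "colour b v < k + 3" if "(s, v) \<in> set (X b)" for s v
      using colour(2)[of b v] X(1)[OF b] that by (auto simp: words_def)
    then have "filter (\<lambda>(s, v). colour b v < k + 3) (X b) = X b"
      by (intro filter_True) auto
    then show "close (word_prod x (filter (\<lambda>(s, v). colour b v < k + 3) (X b))) (w b)"
      using lcong_sym[OF X(2)[OF b]] by simp
  qed
qed

lemma IA_fixed:
  assumes "\<alpha> \<in> IA k"
  shows "\<Delta> \<alpha> = \<alpha>"
proof -
  let ?w = "\<lambda>b. inv (x b) \<otimes> \<alpha> (x b)"
  have "deep ?w"
    unfolding deep_def using IA_lcong[OF assms] by (auto simp: lcong_def)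
  then have "good ?w" by (rule good_deep)
  moreover have "\<alpha> \<in> IA 1" using IA_mono[OF assms] k by simp
  ultimately show ?thesis
    using IA_auto[OF assms] unfolding good_def by (simp add: group_word_simps)
qed

end

context inn_fixing
begin

lemma IA_fixed: "k \<ge> 2 \<Longrightarrow> \<alpha> \<in> IA k \<Longrightarrow> \<Delta> \<alpha> = \<alpha>"
proof (induction "c - k" arbitrary: k \<alpha>)
  case 0
  \<comment> \<open>For \<open>k \<ge> c\<close> the automorphism is the identity, that is,
    conjugation by \<one>.\<close>
  have "\<alpha> = (\<lambda>y\<in>carrier G. \<one> \<otimes> y \<otimes> inv \<one>)"
    using 0 IA_class[of \<alpha> k] by (intro auto_eqI IA_auto[of \<alpha> k] inner_in_auto) auto
  then have "\<alpha> \<in> Inn G" unfolding Inn_def by blast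
  then show ?case by (rule fixes_Inn)
next
  case (Suc n)
  have "\<Delta> \<beta> = \<beta>" if "\<beta> \<in> IA (Suc k)" for \<beta>
    using Suc.hyps(1)[of "Suc k" \<beta>] Suc.hyps(2) Suc.prems(1) that by simp
  then interpret filtration_step G B x c \<Delta> k
    using Suc.prems(1) by unfold_locales auto
  show ?case by (rule IA_fixed[OF Suc.prems(2)])
qed

end

theorem proposition2p7:
  fixes N :: "('a, 'm) monoid_scheme" and B :: "'b set" and c :: nat
    and \<Delta> :: "('a \<Rightarrow> 'a) \<Rightarrow> ('a \<Rightarrow> 'a)"
  assumes "c \<ge> 2"
    and "infinite B"
    and "free_nilpotent_group B c N"
    and "\<Delta> \<in> auto (AutoGroup N)"
    and "\<forall>\<tau> \<in> Inn N. \<Delta> \<tau> = \<tau>"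
  shows "\<forall>\<alpha> \<in> IA2 N. \<Delta> \<alpha> = \<alpha>"
proof -
  obtain x where "free_nilpotent N B x c"
    using free_nilpotent_group_free_nilpotent[OF assms(1-3)] by blast
  then interpret inn_fixing N B x c \<Delta>
    using assms(4,5) by (intro inn_fixing.intro inn_fixing_axioms.intro) auto
  show ?thesis using IA_fixed[of 2] IA2_eq_IA by blast
qed

end
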